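(* For every $\ell\ge 2$ there exist $c,K>0$ such that for all sufficiently large integers $n$ and every $t\ge K$, there exists a collection $\mathcal{C}$ of $3$-graphs on $[n]$ such that (a) $|\mathcal{C}|\le\exp\left(c\cdot\max\left\{(\log n)^{3+\frac{2\ell-2}{4\ell^2-5\ell+2}}n^{\frac{4\ell^2-3\ell+1}{4\ell^2-5\ell+2}}t^{-\frac{2\ell-2}{4\ell^2-5\ell+2}},\ (\log n)^4n^{\frac{2\ell}{2\ell-1}}\right\}\right)$; (b) $e(G)\le tn^2$ for every $G\in\mathcal{C}$; (c) every $C^3_{2\ell}$-free $3$-graph on $[n]$ is a subgraph of some $G\in\mathcal{C}$. In particular, when $t\le n^{\frac{1}{4\ell-2}}(\log n)^{-\frac{4\ell^2-7\ell+4}{2\ell-2}}$, $$|\mathcal{C}|\le\exp\left(c\cdot(\log n)^{3+\frac{2\ell-2}{4\ell^2-5\ell+2}}n^{\frac{4\ell^2-3\ell+1}{4\ell^2-5\ell+2}}t^{-\frac{2\ell-2}{4\ell^2-5\ell+2}}\right).$$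
   Context: A $3$-graph is a $3$-uniform hypergraph; $e(G)$ is the number of edges. The linear cycle $C^3_k$ ($k\ge3$) has vertices $v_1,\dots,v_{2k}$ and edges $e_i=\{v_{2i-2},v_{2i-1},v_{2i}\}$, $1\le i\le k$, with $v_0=v_{2k}$. *)

theory Defs
  imports Complex_Main
begin

type_synonym 'a hypergraph = "'a set \<times> 'a set set"

abbreviation verts :: "'a hypergraph \<Rightarrow> 'a set" where
  "verts G \<equiv> fst G"

abbreviation edges :: "'a hypergraph \<Rightarrow> 'a set set" where
  "edges G \<equiv> snd G"

definition three_graph :: "'a hypergraph \<Rightarrow> bool" where
  "three_graph G \<longleftrightarrow>
     finite (verts G) \<and> (\<forall>e\<in>edges G. e \<subseteq> verts G \<and> card e = 3)"

definition three_graphs_on :: "'a set \<Rightarrow> 'a hypergraph set" where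
  "three_graphs_on V = {G. three_graph G \<and> verts G = V}"

definition subgraph :: "'a hypergraph \<Rightarrow> 'a hypergraph \<Rightarrow> bool" where
  "subgraph H G \<longleftrightarrow> verts H \<subseteq> verts G \<and> edges H \<subseteq> edges G"

definition isomorphic :: "'a hypergraph \<Rightarrow> 'b hypergraph \<Rightarrow> bool" where
  "isomorphic F H \<longleftrightarrow>
     (\<exists>f. bij_betw f (verts F) (verts H) \<and> edges H = (\<lambda>e. f ` e) ` edges F)"

text \<open>Freeness refers to subgraphs that need not be induced.\<close>

definition free_of :: "'b hypergraph \<Rightarrow> 'a hypergraph \<Rightarrow> bool" where
  "free_of F G \<longleftrightarrow> \<not> (\<exists>H. subgraph H G \<and> isomorphic F H)"

text \<open>
  The vertex \<open>v\<^sub>j\<close> is the number \<open>j\<close>, and the index \<open>0\<close>, which occurs only in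
  the first edge, stands for \<open>2 * k\<close>. The definition is meant for \<open>k \<ge> 3\<close>.
\<close>

definition linear_cycle :: "nat \<Rightarrow> nat hypergraph" where
  "linear_cycle k =
     ({1..2 * k},
      (\<lambda>i. {if i = 1 then 2 * k else 2 * i - 2, 2 * i - 1, 2 * i}) ` {1..k})"

end

theory Submission
  imports Defs "HOL-Analysis.Convex" "HOL-Analysis.Harmonic_Numbers" "HOL-Library.FuncSet" "HOL-Real_Asymp.Real_Asymp"
begin

text \<open>
  The proof combines hypergraph containers with a supersaturation statement for linear cycles that is phrased
  dually: inside every triple system \<open>H\<close> with many more than \<open>n\<^sup>2\<close> triples there is a subsystem \<open>V\<close> such that, for
  every family of subsets of \<open>V\<close> of small total weight \<open>(1 / T) ^ (card b - 1)\<close>, some linear \<open>2l\<close>-cycle of \<open>V\<close> contains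
  no member of the family. Such a \<open>V\<close> can be thinned out by a constant factor at the price of about
  \<open>card V / T\<close> recorded elements, and iterating this from all triples down to \<open>t n\<^sup>2\<close> triples gives the containers.

  To find \<open>V\<close>, remove repeatedly all triples through a pair of codegree below a threshold \<open>d\<close>. If something survives,
  every pair in its shadow has codegree at least \<open>d\<close>. A random vertex set of density about \<open>1 / d\<close> still sees more
  triples than a constant multiple of the shadow after one triple of each cheap set is deleted, and this
  forces a linear cycle. If nothing survives, the removed bundles of triples live on the edges of a graph. After
  passing to bundles of comparable size, linear cycles are expansions of \<open>2l\<close>-cycles of this graph. The graph
  has polynomially more than \<open>n powr (1 + 1/l)\<close> edges, so it can be sampled down to a density just above
  \<open>n powr (1 + 1/l)\<close>, where the number of \<open>2l\<close>-cycles is at least quadratic in the number of vertices. The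
  exponents of the theorem arise from balancing the two cases in \<open>d\<close>.

  The count of \<open>2l\<close>-cycles uses closed walks weighted by the inverse square roots of the degrees of their steps:
  the total weight is at least 1, and by log-convexity the closed walks that repeat a vertex carry
  at most half of it once the minimum degree exceeds a constant times \<open>n powr (1/l)\<close>.
\<close>

section \<open>Hypergraph containers\<close>

text \<open>A container step on a subsystem \<open>V\<close> of \<open>H\<close> removes at least
  \<open>\<delta> * card V\<close> triples and costs about \<open>card V / T * ln n\<close> in the
  exponent. The price per removed triple is \<open>ln n / T\<close> up to constants, whatever the
  size of \<open>V\<close>; so \<open>V\<close> only has to be nonempty, and the total cost behaves
  like the integral of \<open>ln n / T\<close> over the sizes \<open>h\<close> between
  \<open>t n\<^sup>2\<close> and \<open>n\<^sup>3\<close>. The two terms in the lower bound for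
  \<open>T\<close> make the integrand a multiple of \<open>h powr (-1 - a)\<close> plus a multiple
  of \<open>1 / h\<close>, whence the two terms of the maximum. The obstacle is the whole cycle.
  Fewer than k triples of a linear k-cycle, say j, span at least 2j + 1 vertices, and j edges of a
  graph cycle at least j + 1, but the full cycle spans one vertex fewer than these patterns suggest.
  With large codegrees the loss is absorbed in the condition on \<open>T\<close>, which gives the
  exponent (4l - 3) / (2l - 1). In the graph case full cycles are outnumbered instead of deleted,
  which gains a factor \<open>s powr (1 - 1 / l)\<close> for a sample of \<open>s\<close>
  vertices.\<close>

definition sdeg :: "'a set set \<Rightarrow> 'a set \<Rightarrow> nat" where
  "sdeg F L = card {E \<in> F. L \<subseteq> E}"

lemma sdeg_mono: "finite G \<Longrightarrow> F \<subseteq> G \<Longrightarrow> sdeg F L \<le> sdeg G L"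
  unfolding sdeg_def by (intro card_mono) auto

lemma sdeg_self:
  assumes "finite F" "L \<in> F" shows "sdeg F L \<ge> 1"
proof -
  have "card {L} \<le> sdeg F L" unfolding sdeg_def using assms by (intro card_mono) auto
  then show ?thesis by simp
qed

text \<open>Double counting of pairs \<open>L \<subseteq> E\<close>. In a uniform family the degrees
  of all sets together exceed the number of members only by a constant factor, so few sets can be
  heavy or saturated.\<close>

lemma sum_sdeg_Pow:
  assumes "finite V" "F \<subseteq> Pow V"
  shows "(\<Sum>L\<in>Pow V. sdeg F L) = (\<Sum>E\<in>F. 2 ^ card E)"
proof -
  have fF: "finite F" using assms finite_subset by fastforce
  have "(\<Sum>L\<in>Pow V. sdeg F L) = (\<Sum>L\<in>Pow V. \<Sum>E\<in>F. if L \<subseteq> E then 1 else 0)"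
    unfolding sdeg_def using fF by (intro sum.cong) (auto simp: sum.If_cases Int_def)
  also have "\<dots> = (\<Sum>E\<in>F. \<Sum>L\<in>Pow V. if L \<subseteq> E then 1 else 0)"
    by (rule sum.swap)
  also have "\<dots> = (\<Sum>E\<in>F. 2 ^ card E)"
  proof (rule sum.cong[OF refl])
    fix E assume E: "E \<in> F"
    then have EV: "E \<subseteq> V" using assms(2) by auto
    then have "Pow V \<inter> {L. L \<subseteq> E} = Pow E" "finite E" using assms(1) finite_subset[OF EV] by auto
    then show "(\<Sum>L\<in>Pow V. if L \<subseteq> E then 1 else 0) = (2::nat) ^ card E"
      using assms(1) by (simp add: sum.If_cases card_Pow)
  qed
  finally show ?thesis .
qed

lemma ex_large_degree:
  assumes "finite V" "A \<subseteq> Pow V" "\<And>E. E \<in> A \<Longrightarrow> E \<noteq> {}" "x > 0" "x * real (card V) \<le> real (card A)" "A \<noteq> {}"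
  shows "\<exists>v\<in>V. x \<le> real (sdeg A {v})"
proof (rule ccontr)
  assume c: "\<not> ?thesis"
  have fA: "finite A" using assms finite_subset by fastforce
  have "A \<subseteq> (\<Union>v\<in>V. {E\<in>A. {v} \<subseteq> E})" using assms(2,3) by fastforce
  then have "card A \<le> card (\<Union>v\<in>V. {E\<in>A. {v} \<subseteq> E})"
    using assms(1) fA by (intro card_mono) auto
  also have "\<dots> \<le> (\<Sum>v\<in>V. sdeg A {v})" unfolding sdeg_def by (rule card_UN_le[OF assms(1)])
  finally have "card A \<le> (\<Sum>v\<in>V. sdeg A {v})" .
  then have 1: "real (card A) \<le> (\<Sum>v\<in>V. real (sdeg A {v}))"
    unfolding of_nat_sum[symmetric] by (rule of_nat_mono)
  have "V \<noteq> {}" using assms(2,3,6) by fastforce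
  then have "(\<Sum>v\<in>V. real (sdeg A {v})) < (\<Sum>v\<in>V. x)"
    using c assms(1) by (intro sum_strict_mono) auto
  then show False using 1 assms(5) by (simp add: mult.commute)
qed

text \<open>Recursion for the leaves of the decision tree: both answers lose an active vertex, and a
  positive one also spends one of the remaining positive answers.\<close>

lemma power_Suc_add_power_le: "u \<ge> 1 \<Longrightarrow> u ^ Suc j + u ^ j \<le> (u + 1) ^ Suc (j::nat)" for u :: nat
proof -
  have "u ^ j \<le> (u+1) ^ j" by (intro power_mono) auto
  then have "(u+1) * u ^ j \<le> (u+1) * (u+1) ^ j" by (rule mult_le_mono2)
  then show ?thesis by simp
qed

text \<open>
  The containers are the leaves of a decision tree that asks for membership of vertices in an independent
  set \<open>I\<close>. It keeps the set \<open>N\<close> of queried vertices outside \<open>I\<close> and the family \<open>out\<close> of the links of the queried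
  vertices in \<open>I\<close>, which \<open>I\<close> does not contain either. Edges through a set that is already heavy in \<open>out\<close> become inactive,
  which keeps the degrees of \<open>out\<close> bounded and makes every new link new.
\<close>

definition heavy :: "real \<Rightarrow> nat \<Rightarrow> 'a set set \<Rightarrow> 'a set \<Rightarrow> bool" where
  "heavy T s out L \<longleftrightarrow> L \<noteq> {} \<and> card L \<le> s \<and> T ^ (s - card L) \<le> real (sdeg out L)"

definition active :: "'a set set \<Rightarrow> real \<Rightarrow> nat \<Rightarrow> 'a set \<Rightarrow> 'a set set \<Rightarrow> 'a set set" where
  "active F T s N out = {E \<in> F. E \<inter> N = {} \<and> (\<forall>L\<subseteq>E. \<not> heavy T s out L)}"

lemma heavy_mono: "finite out' \<Longrightarrow> out \<subseteq> out' \<Longrightarrow> heavy T s out L \<Longrightarrow> heavy T s out' L"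
  unfolding heavy_def using sdeg_mono[of out' out L] by force

lemma active_mono:
  "finite out' \<Longrightarrow> out \<subseteq> out' \<Longrightarrow> N \<subseteq> N' \<Longrightarrow> active F T s N' out' \<subseteq> active F T s N out"
  unfolding active_def using heavy_mono[of out' out T s] by blast

text \<open>An edge is lost by meeting \<open>N\<close> or by containing a heavy set. A heavy
  \<open>L\<close> has in \<open>F\<close> at most \<open>a * T\<close> times its degree in
  \<open>out\<close>, by the degree bound and the definition of heaviness, and the degrees in
  \<open>out\<close> sum to \<open>2 ^ s * card out\<close>.\<close>

lemma card_active:
  fixes T a :: real
  assumes fV: "finite V" and T: "T \<ge> 1" and F: "F \<subseteq> Pow V" "\<And>L. L \<noteq> {} \<Longrightarrow> real (sdeg F L) \<le> a * T ^ (Suc s - card L)"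
    and N: "N \<subseteq> V" and out: "out \<subseteq> Pow V" "\<And>E. E \<in> out \<Longrightarrow> card E = s" and a: "a \<ge> 0"
  shows "real (card F) \<le> real (card (active F T s N out)) + real (card N) * a * T ^ s
           + a * T * 2 ^ s * real (card out)"
proof -
  have fF: "finite F" and fO: "finite out" and fN: "finite N"
    using assms finite_subset by (auto simp: finite_subset[OF _ finite_Pow_iff[THEN iffD2]])
  define HV where "HV = {L\<in>Pow V. heavy T s out L}"
  have fHV: "finite HV" using fV HV_def by auto
  have sub: "F \<subseteq> active F T s N out \<union> ((\<Union>v\<in>N. {E\<in>F. {v} \<subseteq> E}) \<union> (\<Union>L\<in>HV. {E\<in>F. L \<subseteq> E}))"
    unfolding active_def HV_def using F(1) by fastforce
  have "card F \<le> card (active F T s N out) + (card (\<Union>v\<in>N. {E\<in>F. {v} \<subseteq> E}) + card (\<Union>L\<in>HV. {E\<in>F. L \<subseteq> E}))"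
  proof -
    have fin: "finite (active F T s N out \<union> ((\<Union>v\<in>N. {E\<in>F. {v} \<subseteq> E}) \<union> (\<Union>L\<in>HV. {E\<in>F. L \<subseteq> E})))"
      using fF fN fHV by (auto simp: active_def)
    show ?thesis by (rule order_trans[OF card_mono[OF fin sub]])
      (rule order_trans[OF card_Un_le add_left_mono[OF card_Un_le]])
  qed
  also have "\<dots> \<le> card (active F T s N out) + ((\<Sum>v\<in>N. sdeg F {v}) + (\<Sum>L\<in>HV. sdeg F L))"
    unfolding sdeg_def by (intro add_mono order_refl card_UN_le fN fHV)
  finally have 1: "real (card F) \<le> real (card (active F T s N out)) + ((\<Sum>v\<in>N. real (sdeg F {v})) + (\<Sum>L\<in>HV. real (sdeg F L)))"
    unfolding of_nat_sum[symmetric] of_nat_add[symmetric] by (rule of_nat_mono)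
  have 2: "(\<Sum>v\<in>N. real (sdeg F {v})) \<le> (\<Sum>v\<in>N. a * T ^ s)"
    using F(2) by (intro sum_mono) (use F(2)[of "{_}"] in auto)
  have "(\<Sum>L\<in>HV. real (sdeg F L)) \<le> (\<Sum>L\<in>HV. a * T * real (sdeg out L))"
  proof (rule sum_mono)
    fix L assume "L \<in> HV"
    then have L: "L \<noteq> {}" "card L \<le> s" "T ^ (s - card L) \<le> real (sdeg out L)" by (auto simp: HV_def heavy_def)
    have "real (sdeg F L) \<le> a * T ^ (Suc s - card L)" using F(2) L(1) by blast
    also have "\<dots> = a * T * T ^ (s - card L)" using L(2) by (simp add: Suc_diff_le)
    also have "\<dots> \<le> a * T * real (sdeg out L)" using L(3) a T by (intro mult_left_mono) auto
    finally show "real (sdeg F L) \<le> a * T * real (sdeg out L)" .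
  qed
  also have "\<dots> \<le> (\<Sum>L\<in>Pow V. a * T * real (sdeg out L))"
    using fV a T by (intro sum_mono2) (auto simp: HV_def)
  also have "\<dots> = a * T * real (\<Sum>L\<in>Pow V. sdeg out L)" by (simp add: sum_distrib_left)
  also have "\<dots> = a * T * real (\<Sum>E\<in>out. 2 ^ s)" using sum_sdeg_Pow[OF fV out(1)] out(2) by simp
  finally have 3: "(\<Sum>L\<in>HV. real (sdeg F L)) \<le> a * T * 2 ^ s * real (card out)" by (simp add: mult_ac)
  show ?thesis using 1 2 3 by simp
qed

text \<open>The invariants of \<open>out\<close> survive a positive answer. A set that is not heavy
  has degree below \<open>T ^ (s - card L)\<close> and gains at most \<open>a\<close> times this
  from one link, whence \<open>a + 1\<close>; a heavy set gains nothing, as no active edge contains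
  it. For sets of size \<open>s\<close> the threshold is 1, so members of \<open>out\<close> are
  heavy themselves: links are therefore new, and after the answer no active edge passes through
  \<open>v\<close>.\<close>

lemma link_step:
  fixes T a :: real
  assumes fV: "finite V" and T: "T \<ge> 1" and F: "F \<subseteq> Pow V" "\<And>E. E \<in> F \<Longrightarrow> card E = Suc s"
      "\<And>L. L \<noteq> {} \<Longrightarrow> real (sdeg F L) \<le> a * T ^ (Suc s - card L)"
    and s: "s \<ge> 1" and out: "out \<subseteq> Pow V" "\<And>E. E \<in> out \<Longrightarrow> card E = s"
      "\<And>L. L \<noteq> {} \<Longrightarrow> real (sdeg out L) \<le> (a + 1) * T ^ (s - card L)" and a: "a \<ge> 0"
    and A: "A = active F T s N out" and out': "out' = out \<union> (\<lambda>E. E - {v}) ` {E\<in>A. {v} \<subseteq> E}"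
  shows "out' \<subseteq> Pow V" "\<And>E. E \<in> out' \<Longrightarrow> card E = s"
    "\<And>L. L \<noteq> {} \<Longrightarrow> real (sdeg out' L) \<le> (a + 1) * T ^ (s - card L)"
    "card out' = card out + sdeg A {v}" "v \<notin> \<Union>(active F T s N out')"
proof -
  have fF: "finite F" and fO: "finite out"
    using assms finite_subset by (auto simp: finite_subset[OF _ finite_Pow_iff[THEN iffD2]])
  have AF: "A \<subseteq> F" unfolding A active_def by auto
  have fA: "finite A" using AF fF finite_subset by auto
  have finE: "finite E" if "E \<in> F" for E using that F(2)[OF that] s card.infinite by fastforce
  show 1: "out' \<subseteq> Pow V" using out(1) AF F(1) unfolding out' by fastforce
  show 2: "card E = s" if "E \<in> out'" for E
    using that out(2) AF F(2) finE unfolding out' by auto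
  have fO': "finite out'" using fO fA unfolding out' by auto
  have inj: "inj_on (\<lambda>E. E - {v}) {E\<in>A. {v} \<subseteq> E}" by (rule inj_onI) auto
  have heavy_mem: "heavy T s out L" if "L \<in> out" for L
  proof -
    have "L \<noteq> {}" "card L = s" using out(2)[OF that] s by auto
    moreover have "sdeg out L \<ge> 1" using sdeg_self[OF fO that] .
    ultimately show ?thesis unfolding heavy_def by auto
  qed
  have disj: "out \<inter> (\<lambda>E. E - {v}) ` {E\<in>A. {v} \<subseteq> E} = {}"
  proof -
    have "E - {v} \<notin> out" if "E \<in> A" for E
    proof
      assume "E - {v} \<in> out"
      from heavy_mem[OF this] that show False unfolding A active_def by auto
    qed
    then show ?thesis by auto
  qed
  show "card out' = card out + sdeg A {v}"
    unfolding out' sdeg_def using fO fA disj inj by (simp add: card_Un_disjoint card_image)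
  show "v \<notin> \<Union>(active F T s N out')"
  proof
    assume "v \<in> \<Union>(active F T s N out')"
    then obtain E where E: "v \<in> E" "E \<in> active F T s N out'" by auto
    have "out \<subseteq> out'" unfolding out' by auto
    then have "E \<in> A" using E(2) active_mono[OF fO'] unfolding A by blast
    then have mem: "E - {v} \<in> out'" using E(1) unfolding out' by auto
    have cs: "card (E - {v}) = s" using 2[OF mem] .
    then have "E - {v} \<noteq> {}" using s by (metis card.empty not_one_le_zero)
    moreover note cs moreover have "sdeg out' (E-{v}) \<ge> 1" using sdeg_self[OF fO' mem] .
    ultimately have "heavy T s out' (E - {v})" unfolding heavy_def by auto
    then show False using E(2) unfolding active_def by auto
  qed
  show "real (sdeg out' L) \<le> (a + 1) * T ^ (s - card L)" if L: "L \<noteq> {}" for L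
  proof (cases "card L \<le> s \<and> finite L")
    case False
    have "\<not> L \<subseteq> E" if "E \<in> out'" for E
      using False 2[OF that] s that 1 fV by (metis PowD card_mono finite_subset in_mono)
    then have "{E \<in> out'. L \<subseteq> E} = {}" by auto
    then have "sdeg out' L = 0" unfolding sdeg_def by (simp only: card.empty)
    then show ?thesis using a T by simp
  next
    case True
    have split: "{E\<in>out'. L \<subseteq> E} \<subseteq> {E\<in>out. L \<subseteq> E} \<union> (\<lambda>E. E - {v}) ` {E\<in>A. v \<in> E \<and> L \<subseteq> E - {v}}"
      unfolding out' by auto
    have "card {E\<in>out'. L \<subseteq> E} \<le> card ({E\<in>out. L \<subseteq> E} \<union> (\<lambda>E. E - {v}) ` {E\<in>A. v \<in> E \<and> L \<subseteq> E - {v}})"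
      using split fO fA by (intro card_mono) auto
    also have "\<dots> \<le> card {E\<in>out. L \<subseteq> E} + card ((\<lambda>E. E - {v}) ` {E\<in>A. v \<in> E \<and> L \<subseteq> E - {v}})"
      by (rule card_Un_le)
    also have "\<dots> \<le> card {E\<in>out. L \<subseteq> E} + card {E\<in>A. v \<in> E \<and> L \<subseteq> E - {v}}"
      using fA by (intro add_left_mono card_image_le) auto
    finally have le: "sdeg out' L \<le> sdeg out L + card {E\<in>A. v \<in> E \<and> L \<subseteq> E - {v}}" unfolding sdeg_def .
    show ?thesis
    proof (cases "heavy T s out L \<or> v \<in> L")
      case True
      then have "{E\<in>A. v \<in> E \<and> L \<subseteq> E - {v}} = {}" unfolding A active_def by blast
      then have "card {E\<in>A. v \<in> E \<and> L \<subseteq> E - {v}} = 0" by (simp only: card.empty)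
      then have "sdeg out' L \<le> sdeg out L" using le by linarith
      then show ?thesis using out(3)[OF L] by linarith
    next
      case F2: False
      have "{E\<in>A. v \<in> E \<and> L \<subseteq> E - {v}} \<subseteq> {E\<in>F. insert v L \<subseteq> E}" using AF by auto
      then have "card {E\<in>A. v \<in> E \<and> L \<subseteq> E - {v}} \<le> sdeg F (insert v L)" unfolding sdeg_def
        using fF by (intro card_mono) auto
      moreover have "real (sdeg F (insert v L)) \<le> a * T ^ (s - card L)"
        using F(3)[of "insert v L"] F2 True by simp
      moreover have "real (sdeg out L) < T ^ (s - card L)"
        using F2 L True unfolding heavy_def by auto
      ultimately show ?thesis using le by (simp add: algebra_simps)
    qed
  qed
qed

text \<open>A positive answer adds at least \<open>\<beta> / 2 * T ^ s\<close> links, so at most \<open>card V / T\<close> answers are positive; the tree has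
  therefore only few leaves.\<close>

lemma container_round:
  fixes T a \<beta> \<beta>' \<delta> :: real and M q :: nat
  assumes fV: "finite V" and T: "T \<ge> 1" and F: "F \<subseteq> Pow V" "\<And>E. E \<in> F \<Longrightarrow> card E = Suc s"
      "\<And>L. L \<noteq> {} \<Longrightarrow> real (sdeg F L) \<le> a * T ^ (Suc s - card L)"
      "\<beta> * T ^ s * real (card V) \<le> real (card F)"
    and s: "s \<ge> 1" and a: "a \<ge> 1" and b: "\<beta> > 0" "\<beta>' = \<beta> / (4 * a * 2 ^ s)" "\<delta> \<le> \<beta> / (4 * a)" "\<delta> > 0"
    and q: "real (card V) / T \<le> real q" and M: "M \<ge> 1"
    and leaf: "\<And>out. out \<subseteq> Pow V \<Longrightarrow> (\<And>E. E \<in> out \<Longrightarrow> card E = s) \<Longrightarrow>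
       (\<And>L. L \<noteq> {} \<Longrightarrow> real (sdeg out L) \<le> (a + 1) * T ^ (s - card L)) \<Longrightarrow>
       \<beta>' * T ^ (s - 1) * real (card V) \<le> real (card out) \<Longrightarrow>
       \<exists>\<C>. finite \<C> \<and> card \<C> \<le> M \<and> (\<forall>C\<in>\<C>. C \<subseteq> V \<and> real (card C) \<le> (1 - \<delta>) * real (card V)) \<and>
         (\<forall>I\<subseteq>V. (\<forall>E\<in>out. \<not> E \<subseteq> I) \<longrightarrow> (\<exists>C\<in>\<C>. I \<subseteq> C))"
    and N: "N \<subseteq> V" and out: "out \<subseteq> Pow V" "\<And>E. E \<in> out \<Longrightarrow> card E = s"
      "\<And>L. L \<noteq> {} \<Longrightarrow> real (sdeg out L) \<le> (a + 1) * T ^ (s - card L)"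
      "real y * (\<beta> / 2) * T ^ s \<le> real (card out)" "y \<le> q"
  shows "\<exists>\<C>. finite \<C> \<and> card \<C> \<le> (card (\<Union>(active F T s N out)) + 1) ^ (q - y) * M \<and>
         (\<forall>C\<in>\<C>. C \<subseteq> V \<and> real (card C) \<le> (1 - \<delta>) * real (card V)) \<and>
         (\<forall>I\<subseteq>V. (\<forall>E\<in>F. \<not> E \<subseteq> I) \<and> (\<forall>E\<in>out. \<not> E \<subseteq> I) \<and> I \<inter> N = {} \<longrightarrow> (\<exists>C\<in>\<C>. I \<subseteq> C))"
  using N out
\<comment> \<open>The measure is the number of vertices still covered by active edges; either answer
  about \<open>v\<close> removes \<open>v\<close> from it.\<close>
proof (induction "card (\<Union>(active F T s N out))" arbitrary: N out y rule: less_induct)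
  case less
  let ?A = "active F T s N out"
  have fF: "finite F" and fO: "finite out"
    using F(1) less.prems fV finite_subset by (auto simp: finite_subset[OF _ finite_Pow_iff[THEN iffD2]])
  have AF: "?A \<subseteq> F" unfolding active_def by auto
  have fUA: "finite (\<Union>?A)" using AF F(1) fV by (meson Sup_le_iff finite_subset in_mono PowD)
  \<comment> \<open>Two ways to stop: \<open>out\<close> is dense enough for the induction on the
    uniformity, or so many vertices are known to miss \<open>I\<close> that \<open>V - N\<close> is
    itself a container.\<close>
  consider "\<beta>' * T ^ (s - 1) * real (card V) \<le> real (card out)"
    | "real (card N) \<ge> \<delta> * real (card V)"
    | "real (card out) < \<beta>' * T ^ (s - 1) * real (card V)" "real (card N) < \<delta> * real (card V)"
    by linarith
  then show ?case
  proof cases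
    case 1
    obtain \<C> where C: "finite \<C>" "card \<C> \<le> M" "\<forall>C\<in>\<C>. C \<subseteq> V \<and> real (card C) \<le> (1 - \<delta>) * real (card V)"
         "\<forall>I\<subseteq>V. (\<forall>E\<in>out. \<not> E \<subseteq> I) \<longrightarrow> (\<exists>C\<in>\<C>. I \<subseteq> C)"
      using leaf[OF less.prems(2,3,4) 1] by auto
    have "card \<C> \<le> (card (\<Union>?A) + 1) ^ (q - y) * M"
      using C(2) by (metis (no_types) add_gr_0 le_square less_numeral_extra(1) mult_le_mono1 nat_mult_1 one_le_power order_trans Suc_eq_plus1 le_add2)
    then show ?thesis using C by (intro exI[of _ \<C>]) simp
  next
    case 2
    have "card (V - N) = card V - card N" using less.prems(1) fV by (simp add: card_Diff_subset finite_subset)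
    moreover have "card N \<le> card V" using less.prems(1) fV by (simp add: card_mono)
    ultimately have "real (card (V - N)) \<le> (1 - \<delta>) * real (card V)" using 2 by (simp add: of_nat_diff algebra_simps)
    moreover have "card {V - N} \<le> (card (\<Union>?A) + 1) ^ (q - y) * M"
      using M by (simp add: Suc_leI)
    ultimately show ?thesis by (intro exI[of _ "{V-N}"]) auto
  next
    case 3
    have Vpos: "real (card V) > 0" using 3(2) b(4) by (metis less_le_trans mult_zero_right not_less of_nat_0_le_iff order_le_less)
    have T0: "T > 0" using T by simp
    \<comment> \<open>\<open>\<beta>'\<close> and the bound on \<open>\<delta>\<close> are chosen so
      that heavy sets and \<open>N\<close> destroy at most a quarter of the guaranteed edges each;
      half of them stay active.\<close>
    have eq1: "a * T * 2 ^ s * (\<beta>' * T ^ (s - 1) * real (card V)) = \<beta> / 4 * T ^ s * real (card V)"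
      unfolding b(2) using a s by (cases s) (auto simp: field_simps)
    have "a * T * 2 ^ s * real (card out) \<le> \<beta> / 4 * T ^ s * real (card V)"
      unfolding eq1[symmetric] using 3(1) a T0 by (intro mult_left_mono) auto
    moreover have "real (card N) * a * T ^ s \<le> \<beta> / 4 * T ^ s * real (card V)"
    proof -
      have "real (card N) \<le> \<beta> / (4 * a) * real (card V)" using 3(2) b(3) Vpos
        by (smt (verit) mult_right_mono)
      then have "real (card N) * (a * T ^ s) \<le> \<beta> / (4 * a) * real (card V) * (a * T ^ s)"
        using a T0 by (intro mult_right_mono) auto
      then show ?thesis using a by (simp add: field_simps)
    qed
    moreover have "real (card F) \<le> real (card ?A) + real (card N) * a * T ^ s + a * T * 2 ^ s * real (card out)"
      using card_active[OF fV T F(1) F(3) less.prems(1,2,3)] a by simp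
    ultimately have Abig: "\<beta> / 2 * T ^ s * real (card V) \<le> real (card ?A)"
      using F(4) by (simp add: field_simps)
    have pos: "\<beta> / 2 * T ^ s > 0" using b T0 by simp
    have Ane: "?A \<noteq> {}" using Abig pos Vpos by (metis card.empty mult_pos_pos not_le of_nat_0)
    obtain v where v: "v \<in> V" "\<beta> / 2 * T ^ s \<le> real (sdeg ?A {v})"
      using ex_large_degree[OF fV _ _ pos Abig Ane] AF F(1,2) by fastforce
    \<comment> \<open>The \<open>y\<close> positive answers have produced at least
      \<open>y * \<beta> / 2 * T ^ s\<close> links, while \<open>out\<close> is still below the
      stopping threshold; this forces \<open>y * T < card V\<close>, so an answer is left.\<close>
    have yq: "y < q"
    proof -
      have "real y * (\<beta> / 2) * T ^ s < \<beta>' * T ^ (s - 1) * real (card V)" using 3(1) less.prems(5) by linarith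
      also have "\<dots> = \<beta> * T ^ (s-1) * real (card V) / (4 * a * 2^s)" unfolding b(2) by simp
      also have "\<dots> \<le> \<beta> * T ^ (s-1) * real (card V) / 2"
      proof -
        have "4 * a * 2 ^ s \<ge> 2 * 1" using a
          by (intro mult_mono) (auto intro: one_le_power)
        then show ?thesis using b(1) T0 Vpos
          by (intro divide_left_mono) auto
      qed
      finally have "real y * (\<beta> / 2 * T ^ (s-1)) * T < real (card V) * (\<beta> / 2 * T ^ (s-1))"
        using s by (cases s) (auto simp: algebra_simps)
      then have "(real y * T) * (\<beta> / 2 * T ^ (s-1)) < real (card V) * (\<beta> / 2 * T ^ (s-1))"
        by (simp add: algebra_simps)
      then have "real y * T < real (card V)" using b(1) T0 by (simp add: mult_less_cancel_right)
      then have "real y < real (card V) / T" using T0 by (simp add: pos_less_divide_eq)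
      then show ?thesis using q by simp
    qed
    define out' where "out' = out \<union> (\<lambda>E. E - {v}) ` {E\<in>?A. {v} \<subseteq> E}"
    have a0: "a \<ge> 0" using a by simp
    have ls1: "out' \<subseteq> Pow V" by (rule link_step(1)[OF fV T F(1,2,3) s less.prems(2,3,4) a0 refl out'_def]; assumption)
    have ls2: "card E = s" if "E \<in> out'" for E by (rule link_step(2)[OF fV T F(1,2,3) s less.prems(2,3,4) a0 refl out'_def]; (assumption | rule that))
    have ls3: "real (sdeg out' L) \<le> (a + 1) * T ^ (s - card L)" if "L \<noteq> {}" for L
      by (rule link_step(3)[OF fV T F(1,2,3) s less.prems(2,3,4) a0 refl out'_def]; (assumption | rule that))
    have ls4: "card out' = card out + sdeg ?A {v}" by (rule link_step(4)[OF fV T F(1,2,3) s less.prems(2,3,4) a0 refl out'_def]; assumption)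
    have ls5: "v \<notin> \<Union>(active F T s N out')" by (rule link_step(5)[OF fV T F(1,2,3) s less.prems(2,3,4) a0 refl out'_def]; assumption)
    have fO': "finite out'" using ls1 fV by (meson finite_Pow_iff finite_subset)
    have sdpos: "sdeg ?A {v} > 0" using v(2) pos by linarith
    have vA: "v \<in> \<Union>?A"
    proof (rule ccontr)
      assume "v \<notin> \<Union>?A"
      then have "{E\<in>?A. {v} \<subseteq> E} = {}" by auto
      then show False using sdpos unfolding sdeg_def by (metis card.empty less_irrefl)
    qed
    have s1: "\<Union>(active F T s N out') \<subseteq> \<Union>?A - {v}"
    proof -
      have "out \<subseteq> out'" unfolding out'_def by simp
      then have "active F T s N out' \<subseteq> ?A" by (rule active_mono[OF fO' _ order_refl])
      then show ?thesis using ls5 by auto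
    qed
    have s2: "\<Union>(active F T s (insert v N) out) \<subseteq> \<Union>?A - {v}"
    proof -
      have "active F T s (insert v N) out \<subseteq> ?A" by (rule active_mono[OF fO order_refl]) auto
      moreover have "v \<notin> \<Union>(active F T s (insert v N) out)" unfolding active_def by auto
      ultimately show ?thesis by auto
    qed
    have cA: "card (\<Union>?A - {v}) + 1 = card (\<Union>?A)" using vA fUA
      by (metis Suc_eq_plus1 card_Suc_Diff1)
    have c1: "card (\<Union>(active F T s N out')) + 1 \<le> card (\<Union>?A)"
      using card_mono[OF _ s1] fUA cA by simp
    have c2: "card (\<Union>(active F T s (insert v N) out)) + 1 \<le> card (\<Union>?A)"
      using card_mono[OF _ s2] fUA cA by simp
    have out'4: "real (y + 1) * (\<beta> / 2) * T ^ s \<le> real (card out')"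
      using ls4 v(2) less.prems(5) by (simp add: algebra_simps)
    have "\<exists>\<C>. finite \<C> \<and> card \<C> \<le> (card (\<Union>(active F T s N out')) + 1) ^ (q - (y+1)) * M \<and>
         (\<forall>C\<in>\<C>. C \<subseteq> V \<and> real (card C) \<le> (1 - \<delta>) * real (card V)) \<and>
         (\<forall>I\<subseteq>V. (\<forall>E\<in>F. \<not> E \<subseteq> I) \<and> (\<forall>E\<in>out'. \<not> E \<subseteq> I) \<and> I \<inter> N = {} \<longrightarrow> (\<exists>C\<in>\<C>. I \<subseteq> C))"
      using c1 yq less.prems(1) ls1 ls2 ls3 out'4 by (intro less.hyps) auto
    then obtain C1 where C1: "finite C1" "card C1 \<le> (card (\<Union>(active F T s N out')) + 1) ^ (q - (y+1)) * M"
         "\<forall>C\<in>C1. C \<subseteq> V \<and> real (card C) \<le> (1 - \<delta>) * real (card V)"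
         "\<forall>I\<subseteq>V. (\<forall>E\<in>F. \<not> E \<subseteq> I) \<and> (\<forall>E\<in>out'. \<not> E \<subseteq> I) \<and> I \<inter> N = {} \<longrightarrow> (\<exists>C\<in>C1. I \<subseteq> C)" by blast
    have "\<exists>\<C>. finite \<C> \<and> card \<C> \<le> (card (\<Union>(active F T s (insert v N) out)) + 1) ^ (q - y) * M \<and>
         (\<forall>C\<in>\<C>. C \<subseteq> V \<and> real (card C) \<le> (1 - \<delta>) * real (card V)) \<and>
         (\<forall>I\<subseteq>V. (\<forall>E\<in>F. \<not> E \<subseteq> I) \<and> (\<forall>E\<in>out. \<not> E \<subseteq> I) \<and> I \<inter> insert v N = {} \<longrightarrow> (\<exists>C\<in>\<C>. I \<subseteq> C))"
      using c2 less.prems v(1) by (intro less.hyps) auto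
    then obtain C2 where C2: "finite C2" "card C2 \<le> (card (\<Union>(active F T s (insert v N) out)) + 1) ^ (q - y) * M"
         "\<forall>C\<in>C2. C \<subseteq> V \<and> real (card C) \<le> (1 - \<delta>) * real (card V)"
         "\<forall>I\<subseteq>V. (\<forall>E\<in>F. \<not> E \<subseteq> I) \<and> (\<forall>E\<in>out. \<not> E \<subseteq> I) \<and> I \<inter> insert v N = {} \<longrightarrow> (\<exists>C\<in>C2. I \<subseteq> C)" by blast
    let ?u = "card (\<Union>?A)"
    obtain j where j: "q - y = Suc j" "q - (y+1) = j" using yq by (metis Suc_diff_Suc Suc_eq_plus1)
    have "card (C1 \<union> C2) \<le> card C1 + card C2" by (rule card_Un_le)
    also have "\<dots> \<le> ?u ^ j * M + ?u ^ Suc j * M"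
    proof (rule add_mono)
      show "card C1 \<le> ?u ^ j * M" using C1(2) unfolding j(2)
        by (rule order_trans) (intro mult_le_mono1 power_mono c1; simp)
      show "card C2 \<le> ?u ^ Suc j * M" using C2(2) unfolding j(1)
        by (rule order_trans) (intro mult_le_mono1 power_mono c2; simp)
    qed
    also have "\<dots> \<le> (?u + 1) ^ Suc j * M"
      using power_Suc_add_power_le[of ?u j] c1 by (metis add.commute add_leD2 add_mult_distrib mult_le_mono1)
    finally have cc: "card (C1 \<union> C2) \<le> (?u + 1) ^ (q - y) * M" unfolding j .
    have cov1: "\<exists>C\<in>C1 \<union> C2. I \<subseteq> C" if I: "I \<subseteq> V" "\<forall>E\<in>F. \<not> E \<subseteq> I" "\<forall>E\<in>out. \<not> E \<subseteq> I" "I \<inter> N = {}" for I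
    proof (cases "v \<in> I")
      case True
      have "\<not> E \<subseteq> I" if Eo: "E \<in> out'" for E
      proof (cases "E \<in> out")
        case False
        then obtain E' where E': "E = E' - {v}" "E' \<in> F" using Eo AF unfolding out'_def by auto
        show ?thesis
        proof
          assume "E \<subseteq> I"
          then have "E' \<subseteq> I" using True E'(1) by auto
          then show False using I(2) E'(2) by auto
        qed
      qed (use I(3) in auto)
      then obtain C where "C \<in> C1" "I \<subseteq> C" using C1(4) I by auto
      then show ?thesis by auto
    next
      case False
      then have "I \<inter> insert v N = {}" using I(4) by auto
      then obtain C where "C \<in> C2" "I \<subseteq> C" using C2(4) I by auto
      then show ?thesis by auto
    qed
    have fin12: "finite (C1 \<union> C2)" using C1(1) C2(1) by simp
    have sz: "\<forall>C\<in>C1 \<union> C2. C \<subseteq> V \<and> real (card C) \<le> (1 - \<delta>) * real (card V)" using C1(3) C2(3) by auto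
    show ?thesis
      by (intro exI[of _ "C1 \<union> C2"] conjI fin12 cc sz allI impI) (elim conjE, rule cov1)
  qed
qed


text \<open>Induction on the uniformity. A round on sets of size \<open>s + 1\<close> ends with a
  removal of vertices or with a family of sets of size \<open>s\<close> that the independent set
  still avoids, with \<open>a + 1\<close> and \<open>\<beta>'\<close> in place of \<open>a\<close>
  and \<open>\<beta>\<close>. Each round contributes one more power of \<open>card V + 1\<close> for
  every possible positive answer. In the base case the singletons are simply deleted.\<close>

lemma container_uniform:
  fixes a \<beta> :: real
  assumes "s \<ge> 1" "a \<ge> 1" "\<beta> > 0"
  shows "\<exists>\<delta>>0. \<forall>(V::'a set) F (T::real). finite V \<and> T \<ge> 1 \<and> F \<subseteq> Pow V \<and> (\<forall>E\<in>F. card E = s) \<and>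
      (\<forall>L. L \<noteq> {} \<longrightarrow> real (sdeg F L) \<le> a * T ^ (s - card L)) \<and>
      \<beta> * T ^ (s - 1) * real (card V) \<le> real (card F) \<longrightarrow>
      (\<exists>\<C>. finite \<C> \<and> card \<C> \<le> (card V + 1) ^ ((s - 1) * nat \<lceil>real (card V) / T\<rceil>) \<and>
         (\<forall>C\<in>\<C>. C \<subseteq> V \<and> real (card C) \<le> (1 - \<delta>) * real (card V)) \<and>
         (\<forall>I\<subseteq>V. (\<forall>E\<in>F. \<not> E \<subseteq> I) \<longrightarrow> (\<exists>C\<in>\<C>. I \<subseteq> C)))"
  using assms
proof (induction s arbitrary: a \<beta> rule: dec_induct)
  case base
  show ?case
  proof (intro exI[of _ \<beta>] conjI allI impI)
    fix V :: "'a set" and F and T :: real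
    assume h: "finite V \<and> T \<ge> 1 \<and> F \<subseteq> Pow V \<and> (\<forall>E\<in>F. card E = 1) \<and>
      (\<forall>L. L \<noteq> {} \<longrightarrow> real (sdeg F L) \<le> a * T ^ (1 - card L)) \<and>
      \<beta> * T ^ (1 - 1) * real (card V) \<le> real (card F)"
    have UV: "\<Union>F \<subseteq> V" using h by auto
    have fU: "finite (\<Union>F)" by (rule finite_subset[OF UV]) (use h in simp)
    have "F \<subseteq> (\<lambda>x. {x}) ` \<Union>F"
    proof
      fix E assume "E \<in> F"
      moreover then obtain x where "E = {x}" using h card_1_singletonE by metis
      ultimately show "E \<in> (\<lambda>x. {x}) ` \<Union>F" by auto
    qed
    then have "card F \<le> card (\<Union>F)" using fU by (meson card_image_le card_mono finite_imageI order_trans)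
    then have "\<beta> * real (card V) \<le> real (card (\<Union>F))" using h by simp
    moreover have "card (V - \<Union>F) = card V - card (\<Union>F)" using UV fU by (simp add: card_Diff_subset)
    moreover have "card (\<Union>F) \<le> card V" using UV h by (simp add: card_mono)
    ultimately have cC: "real (card (V - \<Union>F)) \<le> (1 - \<beta>) * real (card V)"
      by (simp add: of_nat_diff algebra_simps)
    have cov: "I \<subseteq> V - \<Union>F" if "I \<subseteq> V" "\<forall>E\<in>F. \<not> E \<subseteq> I" for I
    proof
      fix x assume x: "x \<in> I"
      have "x \<notin> E" if E: "E \<in> F" for E
      proof
        assume "x \<in> E"
        moreover obtain z where "E = {z}" using h E card_1_singletonE by metis
        ultimately have "E \<subseteq> I" using x by auto
        then show False using that(1) \<open>\<forall>E\<in>F. \<not> E \<subseteq> I\<close> by blast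
      qed
      then show "x \<in> V - \<Union>F" using x that by auto
    qed
    show "\<exists>\<C>. finite \<C> \<and> card \<C> \<le> (card V + 1) ^ ((1 - 1) * nat \<lceil>real (card V) / T\<rceil>) \<and>
         (\<forall>C\<in>\<C>. C \<subseteq> V \<and> real (card C) \<le> (1 - \<beta>) * real (card V)) \<and>
         (\<forall>I\<subseteq>V. (\<forall>E\<in>F. \<not> E \<subseteq> I) \<longrightarrow> (\<exists>C\<in>\<C>. I \<subseteq> C))"
      by (rule exI[of _ "{V - \<Union>F}"]) (use cC cov in auto)
  qed (use base in auto)
next
  case (step s)
  define \<beta>' where "\<beta>' = \<beta> / (4 * a * 2 ^ s)"
  have b': "\<beta>' > 0" unfolding \<beta>'_def using step.prems by simp
  have a1: "a + 1 \<ge> 1" using step.prems by simp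
  obtain \<delta>' where d': "\<delta>' > 0" and IH: "\<forall>(V::'a set) F (T::real). finite V \<and> T \<ge> 1 \<and> F \<subseteq> Pow V \<and> (\<forall>E\<in>F. card E = s) \<and>
      (\<forall>L. L \<noteq> {} \<longrightarrow> real (sdeg F L) \<le> (a + 1) * T ^ (s - card L)) \<and>
      \<beta>' * T ^ (s - 1) * real (card V) \<le> real (card F) \<longrightarrow>
      (\<exists>\<C>. finite \<C> \<and> card \<C> \<le> (card V + 1) ^ ((s - 1) * nat \<lceil>real (card V) / T\<rceil>) \<and>
         (\<forall>C\<in>\<C>. C \<subseteq> V \<and> real (card C) \<le> (1 - \<delta>') * real (card V)) \<and>
         (\<forall>I\<subseteq>V. (\<forall>E\<in>F. \<not> E \<subseteq> I) \<longrightarrow> (\<exists>C\<in>\<C>. I \<subseteq> C)))"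
    using step.IH[OF a1 b'] by (elim exE conjE) (rule that)
  define \<delta> where "\<delta> = min \<delta>' (\<beta> / (4 * a))"
  have d: "\<delta> > 0" "\<delta> \<le> \<beta> / (4 * a)" "\<delta> \<le> \<delta>'" unfolding \<delta>_def using d' step.prems by auto
  show ?case
  proof (intro exI[of _ \<delta>] conjI allI impI)
    fix V :: "'a set" and F and T :: real
    assume h: "finite V \<and> T \<ge> 1 \<and> F \<subseteq> Pow V \<and> (\<forall>E\<in>F. card E = Suc s) \<and>
      (\<forall>L. L \<noteq> {} \<longrightarrow> real (sdeg F L) \<le> a * T ^ (Suc s - card L)) \<and>
      \<beta> * T ^ (Suc s - 1) * real (card V) \<le> real (card F)"
    let ?q = "nat \<lceil>real (card V) / T\<rceil>"
    let ?M = "(card V + 1) ^ ((s - 1) * ?q)"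
    have fV: "finite V" and T: "T \<ge> 1" using h by auto
    have "\<exists>\<C>. finite \<C> \<and> card \<C> \<le> (card (\<Union>(active F T s {} {})) + 1) ^ (?q - 0) * ?M \<and>
         (\<forall>C\<in>\<C>. C \<subseteq> V \<and> real (card C) \<le> (1 - \<delta>) * real (card V)) \<and>
         (\<forall>I\<subseteq>V. (\<forall>E\<in>F. \<not> E \<subseteq> I) \<and> (\<forall>E\<in>{}. \<not> E \<subseteq> I) \<and> I \<inter> {} = {} \<longrightarrow> (\<exists>C\<in>\<C>. I \<subseteq> C))"
    proof (rule container_round[where a=a and \<beta>=\<beta> and \<beta>'=\<beta>' and \<delta>=\<delta>])
      fix out assume out: "out \<subseteq> Pow V" "\<And>E. E \<in> out \<Longrightarrow> card E = s"
       "\<And>L. L \<noteq> {} \<Longrightarrow> real (sdeg out L) \<le> (a + 1) * T ^ (s - card L)"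
       "\<beta>' * T ^ (s - 1) * real (card V) \<le> real (card out)"
      have "\<exists>\<C>. finite \<C> \<and> card \<C> \<le> ?M \<and>
         (\<forall>C\<in>\<C>. C \<subseteq> V \<and> real (card C) \<le> (1 - \<delta>') * real (card V)) \<and>
         (\<forall>I\<subseteq>V. (\<forall>E\<in>out. \<not> E \<subseteq> I) \<longrightarrow> (\<exists>C\<in>\<C>. I \<subseteq> C))"
        by (rule IH[rule_format]) (use out fV T in auto)
      moreover have "real (card C) \<le> (1 - \<delta>) * real (card V)" if "real (card C) \<le> (1 - \<delta>') * real (card V)" for C :: "'a set"
        by (rule order_trans[OF that]) (use d in \<open>intro mult_right_mono; simp\<close>)
      ultimately show "\<exists>\<C>. finite \<C> \<and> card \<C> \<le> ?M \<and>
         (\<forall>C\<in>\<C>. C \<subseteq> V \<and> real (card C) \<le> (1 - \<delta>) * real (card V)) \<and>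
         (\<forall>I\<subseteq>V. (\<forall>E\<in>out. \<not> E \<subseteq> I) \<longrightarrow> (\<exists>C\<in>\<C>. I \<subseteq> C))"
        by meson
    qed (use h step d \<beta>'_def in \<open>auto simp: sdeg_def of_nat_ceiling\<close>)
    then obtain \<C> where C: "finite \<C>" "card \<C> \<le> (card (\<Union>(active F T s {} {})) + 1) ^ ?q * ?M"
         "\<forall>C\<in>\<C>. C \<subseteq> V \<and> real (card C) \<le> (1 - \<delta>) * real (card V)"
         "\<forall>I\<subseteq>V. (\<forall>E\<in>F. \<not> E \<subseteq> I) \<longrightarrow> (\<exists>C\<in>\<C>. I \<subseteq> C)" by auto
    have "\<Union>(active F T s {} {}) \<subseteq> V" using h unfolding active_def by auto
    then have "card (\<Union>(active F T s {} {})) + 1 \<le> card V + 1" using fV by (simp add: card_mono)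
    then have "(card (\<Union>(active F T s {} {})) + 1) ^ ?q * ?M \<le> (card V + 1) ^ ?q * ?M"
      by (intro mult_le_mono1 power_mono) auto
    also have "\<dots> = (card V + 1) ^ ((Suc s - 1) * ?q)"
    proof -
      have "?q + (s - 1) * ?q = (Suc s - 1) * ?q" using step.hyps by (cases s) auto
      then show ?thesis by (metis power_add)
    qed
    finally show "\<exists>\<C>. finite \<C> \<and> card \<C> \<le> (card V + 1) ^ ((Suc s - 1) * ?q) \<and>
         (\<forall>C\<in>\<C>. C \<subseteq> V \<and> real (card C) \<le> (1 - \<delta>) * real (card V)) \<and>
         (\<forall>I\<subseteq>V. (\<forall>E\<in>F. \<not> E \<subseteq> I) \<longrightarrow> (\<exists>C\<in>\<C>. I \<subseteq> C))"
      using C by (intro exI[of _ \<C>]) auto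
  qed (use d in auto)
qed

section \<open>Robustness and balanced subfamilies\<close>

text \<open>By duality, this amounts to a probability distribution on \<open>H\<close> in which a set of size \<open>j\<close> is contained in a random
  member with probability of order at most \<open>T ^ - (j - 1) / (\<epsilon> * card V)\<close>.\<close>

definition robust :: "'a set \<Rightarrow> 'a set set \<Rightarrow> real \<Rightarrow> real \<Rightarrow> bool" where
  "robust V H T \<epsilon> \<longleftrightarrow> (\<forall>B \<subseteq> Pow V - {{}}. (\<Sum>b\<in>B. (1 / T) ^ (card b - 1)) \<le> \<epsilon> * real (card V) \<longrightarrow>
     (\<exists>S\<in>H. \<forall>b\<in>B. \<not> b \<subseteq> S))"

text \<open>A largest subfamily subject to the degree bounds works. The sets whose degree cannot
  grow by one have total weight at most \<open>2 ^ (r + 1) / T ^ (r - 1) * card F\<close>; if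
  \<open>F\<close> were too small, robustness would provide an \<open>S \<in> H\<close> that
  contains none of them and could be added.\<close>

lemma robust_balanced:
  fixes T \<epsilon> :: real
  assumes fV: "finite V" and H: "H \<subseteq> Pow V" "\<And>S. S \<in> H \<Longrightarrow> card S = r" and r: "r \<ge> 1" and T: "T \<ge> 1"
    and rob: "robust V H T \<epsilon>"
  shows "\<exists>F\<subseteq>H. (\<forall>L. L \<noteq> {} \<longrightarrow> real (sdeg F L) \<le> T ^ (r - card L)) \<and>
      \<epsilon> / 2 ^ (r + 1) * T ^ (r - 1) * real (card V) \<le> real (card F)"
proof -
  have fH: "finite H" using H fV finite_subset by fastforce
  define P where "P F \<longleftrightarrow> F \<subseteq> H \<and> (\<forall>L. L \<noteq> {} \<longrightarrow> real (sdeg F L) \<le> T ^ (r - card L))" for F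
  have T0: "T > 0" using T by simp
  have "P {}" unfolding P_def sdeg_def using T0 by simp
  moreover have bnd: "\<And>F. P F \<Longrightarrow> card F \<le> card H" unfolding P_def using fH card_mono by blast
  ultimately obtain F where F: "P F" "\<And>G. P G \<Longrightarrow> card G \<le> card F"
    using ex_has_greatest_nat[of P "{}" card "card H + 1"] by (metis less_Suc_eq_le Suc_eq_plus1)
  have fF: "finite F" and FV: "F \<subseteq> Pow V" using F(1) fH H(1) finite_subset unfolding P_def by auto
  have "\<epsilon> / 2 ^ (r + 1) * T ^ (r - 1) * real (card V) \<le> real (card F)"
  proof (rule ccontr)
    assume c: "\<not> ?thesis"
    define B where "B = {L\<in>Pow V - {{}}. card L \<le> r \<and> real (sdeg F L) + 1 > T ^ (r - card L)}"
    have "(\<Sum>b\<in>B. (1 / T) ^ (card b - 1)) \<le> (\<Sum>b\<in>B. 2 / T ^ (r - 1) * real (sdeg F b))"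
    proof (rule sum_mono)
      fix b assume b: "b \<in> B"
      then have cb: "card b \<ge> 1" "card b \<le> r" and gt: "real (sdeg F b) + 1 > T ^ (r - card b)"
        using fV by (auto simp: B_def card_gt_0_iff Suc_le_eq intro: finite_subset)
      have "T ^ (r - card b) \<ge> 1" using T by simp
      then have "real (sdeg F b) > 0" using gt by linarith
      then have "real (sdeg F b) \<ge> 1" by simp
      then have "T ^ (r - card b) \<le> 2 * real (sdeg F b)" using gt by linarith
      then have "T ^ (r - card b) / T ^ (r - 1) \<le> 2 * real (sdeg F b) / T ^ (r-1)" using T0 by (intro divide_right_mono) auto
      moreover have "T ^ (r - 1) = T ^ (r - card b) * T ^ (card b - 1)" using cb by (simp add: power_add[symmetric])
      ultimately show "(1 / T) ^ (card b - 1) \<le> 2 / T ^ (r - 1) * real (sdeg F b)" using T0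
        by (simp add: power_one_over field_simps)
    qed
    also have "\<dots> \<le> (\<Sum>b\<in>Pow V. 2 / T ^ (r - 1) * real (sdeg F b))"
      using fV T0 by (intro sum_mono2) (auto simp: B_def)
    also have "\<dots> = 2 / T ^ (r - 1) * real (\<Sum>b\<in>Pow V. sdeg F b)" by (simp add: sum_distrib_left)
    also have "\<dots> = 2 / T ^ (r - 1) * real (\<Sum>E\<in>F. 2 ^ r)"
      using sum_sdeg_Pow[OF fV FV] H(2) F(1) unfolding P_def by (metis (no_types, lifting) subsetD sum.cong)
    also have "\<dots> = 2 ^ (r + 1) / T ^ (r - 1) * real (card F)" by simp
    also have "\<dots> \<le> \<epsilon> * real (card V)"
    proof -
      have "2 ^ (r + 1) / T ^ (r - 1) * real (card F) \<le> 2 ^ (r + 1) / T ^ (r - 1) * (\<epsilon> / 2 ^ (r + 1) * T ^ (r - 1) * real (card V))"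
        using c T0 by (intro mult_left_mono) auto
      also have "\<dots> = \<epsilon> * real (card V)" using T0 by simp
      finally show ?thesis .
    qed
    finally have w: "(\<Sum>b\<in>B. (1 / T) ^ (card b - 1)) \<le> \<epsilon> * real (card V)" .
    have "B \<subseteq> Pow V - {{}}" unfolding B_def by auto
    then obtain S where S: "S \<in> H" "\<forall>b\<in>B. \<not> b \<subseteq> S" using rob w unfolding robust_def by meson
    have finS2: "S \<subseteq> V" using S(1) H(1) by auto
    have finS1: "finite S" by (rule finite_subset[OF finS2 fV])
    note finS = finS1 finS2
    \<comment> \<open>The threshold for sets of size \<open>r\<close> is \<open>T ^ 0 = 1\<close>,
      so members of \<open>F\<close> are saturated themselves.\<close>
    have SF: "S \<notin> F"
    proof
      assume "S \<in> F"
      then have "sdeg F S \<ge> 1" using sdeg_self[OF fF] by simp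
      then have "S \<in> B" unfolding B_def using H(2)[OF S(1)] r finS by auto
      then show False using S(2) by blast
    qed
    have "P (insert S F)" unfolding P_def
    proof (intro conjI allI impI)
      show "insert S F \<subseteq> H" using S(1) F(1) unfolding P_def by auto
      fix L :: "'a set" assume L: "L \<noteq> {}"
      show "real (sdeg (insert S F) L) \<le> T ^ (r - card L)"
      proof (cases "L \<subseteq> S")
        case False
        then have "{E\<in>insert S F. L \<subseteq> E} = {E\<in>F. L \<subseteq> E}" by auto
        then show ?thesis using F(1) L unfolding P_def sdeg_def by simp
      next
        case True
        have "{E\<in>insert S F. L \<subseteq> E} = insert S {E\<in>F. L \<subseteq> E}" using True by auto
        then have e: "sdeg (insert S F) L = sdeg F L + 1" unfolding sdeg_def using fF SF by simp
        have "card L \<le> r" using True finS(1) H(2)[OF S(1)] card_mono by metis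
        moreover have "L \<notin> B" using S(2) True by blast
        ultimately show ?thesis unfolding e B_def using True finS(2) L by auto
      qed
    qed
    then have "card (insert S F) \<le> card F" using F(2) by blast
    then show False using SF fF by simp
  qed
  then show ?thesis using F(1) unfolding P_def by blast
qed

text \<open>The bound \<open>\<delta> \<le> 1/2\<close> serves the iteration, which books at most
  half of the current size as progress in one step.\<close>

theorem container_robust:
  fixes \<epsilon> :: real
  assumes r: "r \<ge> 2" and e: "\<epsilon> > 0"
  shows "\<exists>\<delta> b. 0 < \<delta> \<and> \<delta> \<le> 1/2 \<and> 0 < b \<and> (\<forall>(V::'a set) H (T::real). finite V \<and> V \<noteq> {} \<and> T \<ge> 1 \<and> H \<subseteq> Pow V \<and>
      (\<forall>S\<in>H. card S = r) \<and> robust V H T \<epsilon> \<longrightarrow>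
      (\<exists>\<C>. finite \<C> \<and> real (card \<C>) \<le> exp (b * (real (card V) / T) * ln (real (card V) + 1)) \<and>
         (\<forall>C\<in>\<C>. C \<subseteq> V \<and> real (card C) \<le> (1 - \<delta>) * real (card V)) \<and>
         (\<forall>I\<subseteq>V. (\<forall>S\<in>H. \<not> S \<subseteq> I) \<longrightarrow> (\<exists>C\<in>\<C>. I \<subseteq> C))))"
proof -
  define \<beta> where "\<beta> = \<epsilon> / 2 ^ (r + 1)"
  have b0: "\<beta> > 0" unfolding \<beta>_def using e by simp
  obtain \<delta>0 where d0: "\<delta>0 > 0" and CU: "\<forall>(V::'a set) F (T::real). finite V \<and> T \<ge> 1 \<and> F \<subseteq> Pow V \<and> (\<forall>E\<in>F. card E = r) \<and>
      (\<forall>L. L \<noteq> {} \<longrightarrow> real (sdeg F L) \<le> 1 * T ^ (r - card L)) \<and>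
      \<beta> * T ^ (r - 1) * real (card V) \<le> real (card F) \<longrightarrow>
      (\<exists>\<C>. finite \<C> \<and> card \<C> \<le> (card V + 1) ^ ((r - 1) * nat \<lceil>real (card V) / T\<rceil>) \<and>
         (\<forall>C\<in>\<C>. C \<subseteq> V \<and> real (card C) \<le> (1 - \<delta>0) * real (card V)) \<and>
         (\<forall>I\<subseteq>V. (\<forall>E\<in>F. \<not> E \<subseteq> I) \<longrightarrow> (\<exists>C\<in>\<C>. I \<subseteq> C)))"
    using container_uniform[where 'a='a, of r 1 \<beta>] r b0 by auto
  define b where "b = real r * (1 + 1 / \<beta>)"
  show ?thesis
  proof (rule exI[of _ "min \<delta>0 (1/2)"], rule exI[of _ b], intro conjI allI impI)
    show "b > 0" unfolding b_def using r b0 by (simp add: add_pos_pos)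
    fix V :: "'a set" and H and T :: real
    assume h: "finite V \<and> V \<noteq> {} \<and> T \<ge> 1 \<and> H \<subseteq> Pow V \<and> (\<forall>S\<in>H. card S = r) \<and> robust V H T \<epsilon>"
    have T0: "T > 0" using h by simp
    obtain F where F: "F \<subseteq> H" "\<forall>L. L \<noteq> {} \<longrightarrow> real (sdeg F L) \<le> T ^ (r - card L)"
      "\<beta> * T ^ (r - 1) * real (card V) \<le> real (card F)"
      using robust_balanced[of V H r T \<epsilon>] h r unfolding \<beta>_def by auto
    have "\<exists>\<C>. finite \<C> \<and> card \<C> \<le> (card V + 1) ^ ((r - 1) * nat \<lceil>real (card V) / T\<rceil>) \<and>
         (\<forall>C\<in>\<C>. C \<subseteq> V \<and> real (card C) \<le> (1 - \<delta>0) * real (card V)) \<and>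
         (\<forall>I\<subseteq>V. (\<forall>E\<in>F. \<not> E \<subseteq> I) \<longrightarrow> (\<exists>C\<in>\<C>. I \<subseteq> C))"
      by (rule CU[rule_format]) (use h F in auto)
    then obtain \<C> where C: "finite \<C>" "card \<C> \<le> (card V + 1) ^ ((r - 1) * nat \<lceil>real (card V) / T\<rceil>)"
         "\<forall>C\<in>\<C>. C \<subseteq> V \<and> real (card C) \<le> (1 - \<delta>0) * real (card V)"
         "\<forall>I\<subseteq>V. (\<forall>E\<in>F. \<not> E \<subseteq> I) \<longrightarrow> (\<exists>C\<in>\<C>. I \<subseteq> C)" by blast
    have V1: "card V \<ge> 1" using h by (simp add: Suc_le_eq card_gt_0_iff)
    have FV: "F \<subseteq> Pow V" using F(1) h by auto
    have fF: "finite F" using FV h by (meson finite_Pow_iff finite_subset)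
    \<comment> \<open>This absorbs the rounding up of \<open>card V / T\<close>. Some vertex lies in
      at least \<open>\<beta> * T ^ (r - 1)\<close> edges, and these are spread over fewer than
      \<open>card V\<close> pairs with at most \<open>T ^ (r - 2)\<close> edges each.\<close>
    have "\<beta> * T \<le> real (card V)"
    proof -
      have "\<beta> * T ^ (r - 1) * real (card V) > 0" using b0 T0 V1 by simp
      then have "F \<noteq> {}" using F(3) by auto
      obtain v where v: "v \<in> V" "\<beta> * T ^ (r - 1) \<le> real (sdeg F {v})"
        using ex_large_degree[of V F "\<beta> * T ^ (r - 1)"] h FV b0 T0 F(1,3) \<open>F \<noteq> {}\<close> r by fastforce
      have "{E\<in>F. {v} \<subseteq> E} \<subseteq> (\<Union>w\<in>V-{v}. {E\<in>F. {v,w} \<subseteq> E})"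
      proof
        fix E assume E: "E \<in> {E\<in>F. {v} \<subseteq> E}"
        then have "card E = r" "E \<subseteq> V" using F(1) h FV by auto
        then have "E \<noteq> {v}" using r by auto
        then show "E \<in> (\<Union>w\<in>V-{v}. {E\<in>F. {v,w} \<subseteq> E})" using E \<open>E \<subseteq> V\<close> by blast
      qed
      then have "sdeg F {v} \<le> card (\<Union>w\<in>V-{v}. {E\<in>F. {v,w} \<subseteq> E})"
        unfolding sdeg_def using h fF by (intro card_mono) auto
      also have "\<dots> \<le> (\<Sum>w\<in>V-{v}. sdeg F {v,w})" unfolding sdeg_def using h by (intro card_UN_le) auto
      finally have "real (sdeg F {v}) \<le> (\<Sum>w\<in>V-{v}. real (sdeg F {v,w}))"
        unfolding of_nat_sum[symmetric] by (rule of_nat_mono)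
      also have "\<dots> \<le> (\<Sum>w\<in>V-{v}. T ^ (r - 2))"
      proof (rule sum_mono)
        fix w assume "w \<in> V - {v}"
        then have "card {v,w} = 2" by auto
        then show "real (sdeg F {v,w}) \<le> T ^ (r - 2)" using F(2) by (metis insert_not_empty)
      qed
      also have "\<dots> \<le> real (card V) * T ^ (r - 2)" using T0 h by (simp add: card_Diff_subset v(1))
      finally have "\<beta> * T ^ (r - 1) \<le> real (card V) * T ^ (r - 2)" using v(2) by linarith
      moreover have "T ^ (r - 1) = T * T ^ (r - 2)" using r by (metis Suc_1 Suc_diff_le diff_Suc_Suc power_Suc)
      ultimately have "(\<beta> * T) * T ^ (r - 2) \<le> real (card V) * T ^ (r - 2)" by simp
      then show ?thesis using T0 by (simp add: mult_le_cancel_right)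
    qed
    then have "1 \<le> (1 / \<beta>) * (real (card V) / T)" using b0 T0 by (simp add: field_simps)
    moreover have "real (nat \<lceil>real (card V) / T\<rceil>) \<le> real (card V) / T + 1"
      using T0 by (simp add: of_nat_ceiling)
    ultimately have q: "real (nat \<lceil>real (card V) / T\<rceil>) \<le> (1 + 1 / \<beta>) * (real (card V) / T)"
      unfolding distrib_right by simp
    have "real ((r - 1) * nat \<lceil>real (card V) / T\<rceil>) \<le> b * (real (card V) / T)"
    proof -
      have "real (r - 1) * real (nat \<lceil>real (card V) / T\<rceil>) \<le> real r * ((1 + 1 / \<beta>) * (real (card V) / T))"
        using q by (intro mult_mono) auto
      then show ?thesis unfolding b_def by (simp add: mult_ac)
    qed
    then have ex: "real ((r - 1) * nat \<lceil>real (card V) / T\<rceil>) * ln (real (card V) + 1) \<le> b * (real (card V) / T) * ln (real (card V) + 1)"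
      by (intro mult_right_mono) auto
    have "real (card \<C>) \<le> (real (card V) + 1) ^ ((r - 1) * nat \<lceil>real (card V) / T\<rceil>)"
      using C(2) by (metis of_nat_1 of_nat_add of_nat_mono of_nat_power)
    also have "\<dots> = exp (real ((r - 1) * nat \<lceil>real (card V) / T\<rceil>) * ln (real (card V) + 1))"
      by (subst exp_of_nat_mult) simp
    also have "\<dots> \<le> exp (b * (real (card V) / T) * ln (real (card V) + 1))" using ex by simp
    finally have c: "real (card \<C>) \<le> exp (b * (real (card V) / T) * ln (real (card V) + 1))" .
    have sz: "real (card C) \<le> (1 - min \<delta>0 (1/2)) * real (card V)" if "C \<in> \<C>" for C
    proof -
      have "real (card C) \<le> (1 - \<delta>0) * real (card V)" using C(3) that by blast
      also have "\<dots> \<le> (1 - min \<delta>0 (1/2)) * real (card V)" by (intro mult_right_mono) auto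
      finally show ?thesis .
    qed
    show "\<exists>\<C>. finite \<C> \<and> real (card \<C>) \<le> exp (b * (real (card V) / T) * ln (real (card V) + 1)) \<and>
         (\<forall>C\<in>\<C>. C \<subseteq> V \<and> real (card C) \<le> (1 - min \<delta>0 (1/2)) * real (card V)) \<and>
         (\<forall>I\<subseteq>V. (\<forall>S\<in>H. \<not> S \<subseteq> I) \<longrightarrow> (\<exists>C\<in>\<C>. I \<subseteq> C))"
    proof (intro exI[of _ \<C>] conjI C(1) c ballI allI impI)
      fix I assume I: "I \<subseteq> V" "\<forall>S\<in>H. \<not> S \<subseteq> I"
      then have "\<forall>E\<in>F. \<not> E \<subseteq> I" using F(1) by auto
      then show "\<exists>C\<in>\<C>. I \<subseteq> C" using C(4) I(1) by simp
    qed (use C(3) sz in auto)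
  qed (use d0 in auto)
qed

section \<open>Supersaturation of even cycles in graphs\<close>

lemma sum_UN_le:
  fixes f :: "'b \<Rightarrow> real"
  assumes "finite I" "\<And>i. finite (A i)" "\<And>x. f x \<ge> 0"
  shows "sum f (\<Union>i\<in>I. A i) \<le> (\<Sum>i\<in>I. sum f (A i))"
  using assms(1)
proof (induction I rule: finite_induct)
  case (insert i I)
  have "sum f (\<Union>j\<in>insert i I. A j) = sum f (A i) + sum f (\<Union>j\<in>I. A j) - sum f (A i \<inter> (\<Union>j\<in>I. A j))"
    using insert assms(2) by (simp add: sum_Un)
  also have "\<dots> \<le> sum f (A i) + sum f (\<Union>j\<in>I. A j)" using assms(3) by (simp add: sum_nonneg)
  finally show ?case using insert by simp
qed simp

lemma sum_product3:
  fixes f :: "'i \<Rightarrow> real"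
  shows "(\<Sum>p\<in>A. \<Sum>q\<in>B. \<Sum>r\<in>C. f p * (g q * h r)) = sum f A * (sum g B * sum h C)"
  by (simp add: sum_distrib_left[symmetric] sum_distrib_right[symmetric])

section \<open>The normalised adjacency matrix and its powers\<close>

locale min_degree_graph =
  fixes U :: "'a set" and adj :: "'a \<Rightarrow> 'a \<Rightarrow> bool" and \<delta> :: real
  assumes finU: "finite U" and neU: "U \<noteq> {}" and sym: "adj x y \<Longrightarrow> adj y x" and irrefl: "\<not> adj x x"
    and d0: "\<delta> > 0" and mindeg: "x \<in> U \<Longrightarrow> \<delta> \<le> real (card {y\<in>U. adj x y})"
begin

definition dg :: "'a \<Rightarrow> real" where "dg x = real (card {y\<in>U. adj x y})"

text \<open>Symmetric normalisation of the adjacency matrix; \<open>W j\<close> is its power with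
  exponent \<open>j\<close>. It replaces regularity: \<open>sqrt (dg x)\<close> is an eigenvector
  for the eigenvalue 1 whatever the degrees are, while every entry is at most
  \<open>1 / \<delta>\<close>.\<close>

definition M :: "'a \<Rightarrow> 'a \<Rightarrow> real" where
  "M x y = (if adj x y then 1 / sqrt (dg x * dg y) else 0)"

fun W :: "nat \<Rightarrow> 'a \<Rightarrow> 'a \<Rightarrow> real" where
  "W 0 x y = (if x = y then 1 else 0)"
| "W (Suc j) x y = (\<Sum>z\<in>U. M x z * W j z y)"

lemma dg_ge: "x \<in> U \<Longrightarrow> \<delta> \<le> dg x" using mindeg unfolding dg_def .
lemma dg_pos: "x \<in> U \<Longrightarrow> 0 < dg x" using dg_ge d0 by fastforce

lemma M_sym: "M x y = M y x" unfolding M_def using sym by (auto simp: mult.commute)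
lemma M_nonneg: "M x y \<ge> 0" unfolding M_def dg_def by simp

lemma M_le: "x \<in> U \<Longrightarrow> y \<in> U \<Longrightarrow> M x y \<le> 1 / \<delta>"
proof -
  assume xy: "x \<in> U" "y \<in> U"
  have "\<delta> = sqrt (\<delta> * \<delta>)" using d0 by simp
  also have "\<dots> \<le> sqrt (dg x * dg y)" using dg_ge xy d0 by (intro real_sqrt_le_mono mult_mono) (auto simp: dg_def)
  finally show ?thesis unfolding M_def using d0 dg_pos xy by (auto intro!: divide_left_mono mult_pos_pos)
qed

lemma W_nonneg: "W j x y \<ge> 0"
  by (induction j arbitrary: x) (auto intro!: sum_nonneg mult_nonneg_nonneg M_nonneg)

lemma W_1: "y \<in> U \<Longrightarrow> W 1 x y = M x y"
  using finU by (simp add: sum.delta' if_distrib[of "(*) _"] cong: if_cong)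

lemma W_add: "x \<in> U \<Longrightarrow> W (i + j) x y = (\<Sum>z\<in>U. W i x z * W j z y)"
proof (induction i arbitrary: x)
  case 0
  then show ?case using finU by (simp add: if_distrib[of "\<lambda>t. t * _"] sum.delta cong: if_cong)
next
  case (Suc i)
  have "W (Suc i + j) x y = (\<Sum>u\<in>U. M x u * (\<Sum>z\<in>U. W i u z * W j z y))"
    using Suc.IH by simp
  also have "\<dots> = (\<Sum>u\<in>U. \<Sum>z\<in>U. M x u * W i u z * W j z y)" by (simp add: sum_distrib_left mult_ac)
  also have "\<dots> = (\<Sum>z\<in>U. \<Sum>u\<in>U. M x u * W i u z * W j z y)" by (rule sum.swap)
  also have "\<dots> = (\<Sum>z\<in>U. W (Suc i) x z * W j z y)" by (simp add: sum_distrib_right)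
  finally show ?case .
qed

lemma W_sym: "x \<in> U \<Longrightarrow> y \<in> U \<Longrightarrow> W j x y = W j y x"
proof (induction j arbitrary: x y)
  case (Suc j)
  have "W (Suc j) x y = W (j + 1) x y" by simp
  also have "\<dots> = (\<Sum>z\<in>U. W j x z * W 1 z y)" using Suc.prems(1) by (rule W_add)
  also have "\<dots> = (\<Sum>z\<in>U. M y z * W j z x)"
    by (rule sum.cong[OF refl]) (use Suc W_1 M_sym in \<open>simp del: W.simps add: mult.commute\<close>)
  finally show ?case by simp
qed simp

lemma W_even_diag: "x \<in> U \<Longrightarrow> W (2 * i) x x = (\<Sum>z\<in>U. (W i x z)\<^sup>2)"
  using W_add[of x i i x] W_sym[of x _ i] by (simp add: mult_2 power2_eq_square cong: sum.cong)

lemma W_add_diag: "x \<in> U \<Longrightarrow> W (i + j) x x = (\<Sum>z\<in>U. W i x z * W j x z)"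
  using W_add[of x i j x] W_sym[of x _ j] by (simp cong: sum.cong)

lemma W_CS: "x \<in> U \<Longrightarrow> (W (i + j) x x)\<^sup>2 \<le> W (2 * i) x x * W (2 * j) x x"
  unfolding W_even_diag W_add_diag by (rule Cauchy_Schwarz_ineq_sum)

lemma W_1_diag: "x \<in> U \<Longrightarrow> W 1 x x = 0" using W_1[of x x] irrefl unfolding M_def by simp

lemma W_2_diag: "x \<in> U \<Longrightarrow> W 2 x x \<le> 1 / \<delta>"
proof -
  assume x: "x \<in> U"
  have "W 2 x x = (\<Sum>z\<in>U. (W 1 x z)\<^sup>2)" using W_even_diag[OF x, of 1] by simp
  also have "\<dots> = (\<Sum>z\<in>U. if adj x z then 1 / (dg x * dg z) else 0)"
    by (rule sum.cong[OF refl]) (use W_1 x dg_pos in \<open>auto simp del: W.simps simp: M_def power_divide less_imp_le\<close>)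
  also have "\<dots> \<le> (\<Sum>z\<in>U. if adj x z then 1 / (dg x * \<delta>) else 0)"
    by (rule sum_mono) (use dg_ge dg_pos x d0 in \<open>auto intro!: divide_left_mono mult_left_mono mult_pos_pos simp: less_imp_le\<close>)
  also have "\<dots> = dg x * (1 / (dg x * \<delta>))" using finU by (simp add: sum.If_cases Int_def dg_def)
  also have "\<dots> = 1 / \<delta>" using dg_pos[OF x] by simp
  finally show ?thesis .
qed

lemma W_even_pos: "x \<in> U \<Longrightarrow> W (2 * i) x x > 0"
proof (induction i)
  case 0 then show ?case by simp
next
  case (Suc i)
  then have p: "W (2 * i) x x > 0" by simp
  have "{y\<in>U. adj x y} \<noteq> {}" using dg_pos[OF Suc.prems] unfolding dg_def by (metis card.empty less_irrefl of_nat_0)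
  then obtain y where y: "y \<in> U" "adj x y" by auto
  have M: "M x y > 0" unfolding M_def using y dg_pos Suc.prems by simp
  obtain z where z: "z \<in> U" "W i x z \<noteq> 0"
    using p unfolding W_even_diag[OF Suc.prems] by (metis (no_types, lifting) less_irrefl power_zero_numeral sum.neutral)
  have "\<exists>u\<in>U. W (Suc i) x u \<noteq> 0"
  proof -
    have "{v\<in>U. adj z v} \<noteq> {}" using dg_pos[OF z(1)] unfolding dg_def by (metis card.empty less_irrefl of_nat_0)
    then obtain v where v: "v \<in> U" "adj z v" by auto
    have "M z v > 0" unfolding M_def using v dg_pos z by simp
    then have "W i x z * W 1 z v > 0" using z W_nonneg[of i x z] W_1[OF v(1)] by (simp del: W.simps)
    moreover have "W i x z * W 1 z v \<le> (\<Sum>t\<in>U. W i x t * W 1 t v)"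
      by (rule member_le_sum[OF z(1) _ finU]) (intro mult_nonneg_nonneg W_nonneg)
    ultimately have "W (i + 1) x v > 0" using W_add[OF Suc.prems, of i 1 v] by linarith
    then show ?thesis using v(1) by (intro bexI[of _ v]) simp_all
  qed
  then obtain u where u: "u \<in> U" "W (Suc i) x u \<noteq> 0" by auto
  have "0 < (W (Suc i) x u)\<^sup>2" using u by (simp del: W.simps)
  also have "\<dots> \<le> (\<Sum>z\<in>U. (W (Suc i) x z)\<^sup>2)" by (rule member_le_sum[OF u(1) _ finU]) simp
  finally show ?case using W_even_diag[OF Suc.prems, of "Suc i"] by (simp del: W.simps)
qed

end

text \<open>By log-convexity the ratios of consecutive terms never decrease, so moving two indices
  apart with fixed sum can only enlarge the product.\<close>

lemma log_convex_ends:
  fixes g :: "nat \<Rightarrow> real"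
  assumes pos: "\<And>i. g i > 0" and lc: "\<And>i. (g (Suc i))\<^sup>2 \<le> g i * g (Suc (Suc i))"
    and ij: "1 \<le> i" "i \<le> j"
  shows "g i * g j \<le> g 1 * g (i + j - 1)"
proof -
  have ratio: "g (Suc a) * g b \<le> g a * g (Suc b)" if "a \<le> b" for a b
    using that
  proof (induction b rule: dec_induct)
    case (step b)
    have "g (Suc a) * g (Suc b) * g b \<le> (g a * g (Suc b)) * g (Suc b)"
      using mult_right_mono[OF step.IH less_imp_le[OF pos[of "Suc b"]]] by (simp add: mult_ac)
    also have "\<dots> = g a * (g (Suc b))\<^sup>2" by (simp add: power2_eq_square)
    also have "\<dots> \<le> g a * (g b * g (Suc (Suc b)))" using lc less_imp_le[OF pos] by (intro mult_left_mono) auto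
    finally have "(g (Suc a) * g (Suc b)) * g b \<le> (g a * g (Suc (Suc b))) * g b" by (simp add: mult_ac)
    then show ?case using pos[of b] by (simp add: mult_le_cancel_right)
  qed simp
  have "\<forall>j\<ge>i. g i * g j \<le> g 1 * g (i + j - 1)"
    using ij(1)
  proof (induction i rule: dec_induct)
    case (step i)
    show ?case
    proof (intro allI impI)
      fix j assume "Suc i \<le> j"
      then have "g (Suc i) * g j \<le> g i * g (Suc j)" using ratio[of i j] by simp
      also have "\<dots> \<le> g 1 * g (i + Suc j - 1)" using step.IH \<open>Suc i \<le> j\<close> by (meson Suc_leD le_SucI)
      finally show "g (Suc i) * g j \<le> g 1 * g (Suc i + j - 1)" by simp
    qed
  qed simp
  then show ?thesis using ij by simp
qed

text \<open>If the last ratio \<open>a k / a (k - 1)\<close> were below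
  \<open>n powr (-1 / k)\<close>, so would be all earlier ratios, which are no larger; then
  \<open>a k < a 0 / n \<le> 1\<close>.\<close>

lemma log_convex_last_ratio:
  fixes a :: "nat \<Rightarrow> real"
  assumes pos: "\<And>i. a i > 0" and lc: "\<And>i. (a (Suc i))\<^sup>2 \<le> a i * a (Suc (Suc i))"
    and k: "k \<ge> 1" and ak: "a k \<ge> 1" and n: "a 0 \<le> n"
  shows "a (k - 1) \<le> n powr (1 / k) * a k"
proof (rule ccontr)
  assume c: "\<not> ?thesis"
  define \<rho> where "\<rho> = a k / a (k - 1)"
  have r0: "\<rho> > 0" unfolding \<rho>_def using pos by simp
  have n0: "n > 0" using n pos[of 0] by linarith
  have "a k < a (k-1) * (1 / n powr (1/k))" using c n0 by (simp add: field_simps)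
  then have rs: "\<rho> < 1 / n powr (1 / k)" unfolding \<rho>_def using pos[of "k-1"] by (simp add: field_simps)
  have mono: "a (Suc i) \<le> \<rho> * a i" if "i < k" for i
  proof -
    have "a (Suc i) / a i \<le> a (Suc j) / a j" if "i \<le> j" for j
      using that
    proof (induction j rule: dec_induct)
      case (step j)
      have "a (Suc j) / a j \<le> a (Suc (Suc j)) / a (Suc j)"
        using lc[of j] pos[of j] pos[of "Suc j"] by (simp add: field_simps power2_eq_square)
      then show ?case using step.IH by linarith
    qed simp
    from this[of "k - 1"] show ?thesis using that k pos[of i] unfolding \<rho>_def by (simp add: field_simps)
  qed
  have "i \<le> k \<Longrightarrow> a i \<le> \<rho> ^ i * a 0" for i
  proof (induction i)
    case (Suc i)
    have "a (Suc i) \<le> \<rho> * a i" using mono Suc.prems by simp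
    also have "\<dots> \<le> \<rho> * (\<rho> ^ i * a 0)" using Suc r0 by (intro mult_left_mono) auto
    finally show ?case by simp
  qed simp
  then have "a k \<le> \<rho> ^ k * a 0" by simp
  also have "\<dots> \<le> \<rho> ^ k * n" using n r0 by (intro mult_left_mono) auto
  also have "\<dots> < (1 / n powr (1 / k)) ^ k * n"
    using rs r0 n0 k by (intro mult_strict_right_mono power_strict_mono) auto
  also have "(1 / n powr (1 / k)) ^ k = 1 / n"
    using n0 k by (simp add: power_divide powr_realpow[symmetric] powr_powr)
  finally show False using ak n0 by simp
qed

section \<open>Traces of even powers\<close>

context min_degree_graph
begin

text \<open>The even diagonal entries form a positive log-convex sequence, so
  \<open>log_convex_ends\<close> pushes two even lengths apart to \<open>2\<close> and
  \<open>2 * k - 2\<close>. An odd entry is bounded by its two even neighbours through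
  Cauchy-Schwarz; length 1 contributes 0, as there are no loops.\<close>

lemma W_split:
  assumes x: "x \<in> U" and ab: "a \<ge> 1" "b \<ge> 1" "a + b = 2 * k"
  shows "W a x x * W b x x \<le> W 2 x x * W (2 * k - 2) x x"
proof -
  define g where "g i = W (2 * i) x x" for i
  have pos: "g i > 0" for i unfolding g_def using W_even_pos[OF x] .
  have lc: "(g (Suc i))\<^sup>2 \<le> g i * g (Suc (Suc i))" for i
    using W_CS[OF x, of i "Suc (Suc i)"] unfolding g_def by (simp del: W.simps add: mult_2)
  have even_case: "g i * g j \<le> g 1 * g (k - 1)" if "i \<ge> 1" "j \<ge> 1" "i + j = k" for i j
    using log_convex_ends[of g i j, OF pos lc] log_convex_ends[of g j i, OF pos lc] that
    by (cases "i \<le> j") (auto simp: add.commute mult.commute)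
  have rhs: "W 2 x x * W (2 * k - 2) x x = g 1 * g (k - 1)"
  proof -
    have "2 * (k - 1) = 2 * k - 2" by simp
    then show ?thesis unfolding g_def by (simp del: W.simps)
  qed
  show ?thesis
  proof (cases "even a")
    case True
    then obtain i where "a = 2 * i" by auto
    moreover then obtain j where "b = 2 * j" using ab(3) by (metis dvd_def even_add dvd_triv_left)
    ultimately show ?thesis using even_case[of i j] ab unfolding rhs by (simp add: g_def del: W.simps)
  next
    case odd: False
    then obtain i where a: "a = 2 * i + 1" by (elim oddE)
    have "odd b" using odd ab(3) by (metis even_add dvd_triv_left)
    then obtain j where b: "b = 2 * j + 1" by (elim oddE)
    show ?thesis
    proof (cases "i = 0 \<or> j = 0")
      case True
      then have "W a x x * W b x x = 0" using a b W_1_diag[OF x] by auto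
      moreover have "0 \<le> W 2 x x * W (2 * k - 2) x x" by (intro mult_nonneg_nonneg W_nonneg)
      ultimately show ?thesis by linarith
    next
      case False
      have sa: "(W a x x)\<^sup>2 \<le> g i * g (Suc i)" using W_CS[OF x, of i "Suc i"] unfolding g_def a by (simp del: W.simps add: mult_2)
      have sb: "(W b x x)\<^sup>2 \<le> g (Suc j) * g j" using W_CS[OF x, of j "Suc j"] unfolding g_def b by (simp del: W.simps add: mult_2 mult.commute mult_2_right)
      have "(W a x x * W b x x)\<^sup>2 \<le> (g i * g (Suc i)) * (g (Suc j) * g j)"
        unfolding power_mult_distrib using sa sb pos by (intro mult_mono) (auto intro: less_imp_le mult_nonneg_nonneg)
      also have "\<dots> = (g i * g (Suc j)) * (g (Suc i) * g j)" by simp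
      also have "\<dots> \<le> (g 1 * g (k-1)) * (g 1 * g (k - 1))"
        using False ab a b pos by (intro mult_mono even_case) (auto intro: less_imp_le mult_nonneg_nonneg)
      finally have "(W a x x * W b x x)\<^sup>2 \<le> (g 1 * g (k - 1))\<^sup>2" by (simp add: power2_eq_square)
      moreover have "0 \<le> g 1 * g (k - 1)" using pos by (intro mult_nonneg_nonneg) (auto intro: less_imp_le)
      ultimately show ?thesis unfolding rhs by (rule power2_le_imp_le)
    qed
  qed
qed

definition tr :: "nat \<Rightarrow> real" where "tr j = (\<Sum>x\<in>U. W (2 * j) x x)"

lemma tr_pos: "tr j > 0" unfolding tr_def using finU neU W_even_pos by (intro sum_pos) auto

text \<open>\<open>tr j\<close> is the squared Frobenius norm of the symmetric matrix
  \<open>W j\<close>, so this is Cauchy-Schwarz for the inner product of two matrices.\<close>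

lemma tr_log_convex: "(tr (Suc i))\<^sup>2 \<le> tr i * tr (Suc (Suc i))"
proof -
  have 1: "tr j = (\<Sum>p\<in>U\<times>U. (W j (fst p) (snd p))\<^sup>2)" for j
    unfolding tr_def by (simp add: W_even_diag sum.cartesian_product split_def del: W.simps cong: sum.cong)
  have "tr (Suc i) = (\<Sum>x\<in>U. W (i + Suc (Suc i)) x x)" unfolding tr_def by (simp add: mult_2 del: W.simps)
  also have "\<dots> = (\<Sum>x\<in>U. \<Sum>z\<in>U. W i x z * W (Suc (Suc i)) x z)" by (rule sum.cong[OF refl]) (rule W_add_diag)
  also have "\<dots> = (\<Sum>p\<in>U\<times>U. W i (fst p) (snd p) * W (Suc (Suc i)) (fst p) (snd p))"
    by (simp add: sum.cartesian_product split_def del: W.simps)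
  finally have 2: "tr (Suc i) = \<dots>" .
  show ?thesis unfolding 2 unfolding 1 by (rule Cauchy_Schwarz_ineq_sum)
qed

lemma tr_0: "tr 0 = real (card U)" unfolding tr_def by simp

text \<open>The vector \<open>sqrt (dg x)\<close> is fixed by the normalised adjacency matrix, so its powers have norm at least 1.\<close>

lemma W_fix: "x \<in> U \<Longrightarrow> (\<Sum>y\<in>U. W k x y * sqrt (dg y)) = sqrt (dg x)"
proof (induction k arbitrary: x)
  case 0
  then show ?case using finU by (simp add: if_distrib[of "\<lambda>t. t * _"] sum.delta cong: if_cong)
next
  case (Suc k)
  have "(\<Sum>y\<in>U. W (Suc k) x y * sqrt (dg y)) = (\<Sum>y\<in>U. \<Sum>z\<in>U. M x z * (W k z y * sqrt (dg y)))"
    by (simp add: sum_distrib_right mult.assoc)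
  also have "\<dots> = (\<Sum>z\<in>U. M x z * (\<Sum>y\<in>U. W k z y * sqrt (dg y)))"
    by (subst sum.swap) (simp add: sum_distrib_left)
  also have "\<dots> = (\<Sum>z\<in>U. M x z * sqrt (dg z))" using Suc.IH by simp
  also have "\<dots> = (\<Sum>z\<in>U. if adj x z then 1 / sqrt (dg x) else 0)"
    by (rule sum.cong[OF refl]) (use dg_pos in \<open>auto simp: M_def real_sqrt_mult less_le\<close>)
  also have "\<dots> = dg x / sqrt (dg x)" using finU by (simp add: sum.If_cases Int_def dg_def)
  also have "\<dots> = sqrt (dg x)" using dg_pos[OF Suc.prems] by (simp add: real_div_sqrt)
  finally show ?case .
qed

lemma tr_ge_1: "tr k \<ge> 1"
proof -
  let ?s = "\<Sum>x\<in>U. dg x"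
  have s: "?s > 0" using finU neU dg_pos by (intro sum_pos) auto
  have "?s = (\<Sum>x\<in>U. (\<Sum>y\<in>U. W k x y * sqrt (dg y))\<^sup>2)"
    by (rule sum.cong[OF refl]) (simp add: W_fix dg_pos less_imp_le)
  also have "\<dots> \<le> (\<Sum>x\<in>U. (\<Sum>y\<in>U. (W k x y)\<^sup>2) * (\<Sum>y\<in>U. (sqrt (dg y))\<^sup>2))"
    by (intro sum_mono Cauchy_Schwarz_ineq_sum)
  also have "\<dots> = (\<Sum>x\<in>U. W (2 * k) x x * ?s)"
    by (rule sum.cong[OF refl]) (simp add: W_even_diag dg_pos less_imp_le del: W.simps)
  also have "\<dots> = tr k * ?s" unfolding tr_def by (simp add: sum_distrib_right)
  finally show ?thesis using s by simp
qed

text \<open>The source of the degree threshold: shortening closed walks by two steps gains at most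
  the factor \<open>card U powr (1 / k)\<close>, because \<open>tr 0\<close> is the number of
  vertices and \<open>tr k \<ge> 1\<close>.\<close>

lemma tr_ratio: "k \<ge> 1 \<Longrightarrow> tr (k - 1) \<le> real (card U) powr (1 / k) * tr k"
  by (rule log_convex_last_ratio) (auto intro: tr_pos tr_log_convex tr_ge_1 simp: tr_0)

section \<open>Closed walks as lists of vertices\<close>

fun wt :: "'a \<Rightarrow> 'a list \<Rightarrow> 'a \<Rightarrow> real" where
  "wt x [] y = M x y"
| "wt x (z # zs) y = M x z * wt z zs y"

definition vertex_lists :: "nat \<Rightarrow> 'a list set" where "vertex_lists m = {xs. set xs \<subseteq> U \<and> length xs = m}"

lemma finite_vertex_lists: "finite (vertex_lists m)" unfolding vertex_lists_def using finite_lists_length_eq[OF finU] .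

lemma wt_nonneg: "wt x zs y \<ge> 0"
  by (induction zs arbitrary: x) (auto intro: mult_nonneg_nonneg M_nonneg)

lemma wt_append: "wt x (ys @ v # zs) y = wt x ys v * wt v zs y"
  by (induction ys arbitrary: x) auto

lemma wt_le: "x \<in> U \<Longrightarrow> y \<in> U \<Longrightarrow> set zs \<subseteq> U \<Longrightarrow> wt x zs y \<le> (1 / \<delta>) ^ Suc (length zs)"
proof (induction zs arbitrary: x)
  case (Cons z zs)
  have "wt z zs y \<le> (1 / \<delta>) ^ Suc (length zs)" using Cons by auto
  moreover have "M x z \<le> 1 / \<delta>" using M_le[of x z] Cons.prems by auto
  ultimately have "M x z * wt z zs y \<le> (1 / \<delta>) * (1 / \<delta>) ^ Suc (length zs)"
    using d0 wt_nonneg by (intro mult_mono) auto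
  then show ?case by simp
qed (use M_le in auto)

lemma vertex_lists_Suc: "vertex_lists (Suc m) = (\<lambda>(z, zs). z # zs) ` (U \<times> vertex_lists m)"
  unfolding vertex_lists_def by (auto simp: length_Suc_conv image_iff)

lemma sum_wt: "y \<in> U \<Longrightarrow> (\<Sum>zs\<in>vertex_lists m. wt x zs y) = W (Suc m) x y"
proof (induction m arbitrary: x)
  case 0
  have "vertex_lists 0 = {[]}" unfolding vertex_lists_def by auto
  then show ?case using W_1[OF 0] by simp
next
  case (Suc m)
  have "(\<Sum>zs\<in>vertex_lists (Suc m). wt x zs y) = (\<Sum>p\<in>U \<times> vertex_lists m. wt x (fst p # snd p) y)"
    unfolding vertex_lists_Suc by (subst sum.reindex) (auto intro: inj_onI simp: split_def)
  also have "\<dots> = (\<Sum>z\<in>U. \<Sum>zs\<in>vertex_lists m. M x z * wt z zs y)"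
    by (simp add: sum.cartesian_product split_def)
  also have "\<dots> = (\<Sum>z\<in>U. M x z * W (Suc m) z y)" using Suc by (simp add: sum_distrib_left[symmetric] del: W.simps)
  finally show ?case by simp
qed

text \<open>A closed walk that repeats a vertex splits there into two shorter closed walks.\<close>

lemma repeating_walks_weight:
  assumes k: "k \<ge> 2"
  shows "(\<Sum>x\<in>U. \<Sum>zs\<in>{zs\<in>vertex_lists (2 * k - 1). \<not> distinct (x # zs)}. wt x zs x)
     \<le> 8 * real k ^ 2 * ((1 / \<delta>) * tr (k - 1))"
proof -
  define D where "D = (1 / \<delta>) * tr (k - 1)"
  have D: "(\<Sum>v\<in>U. W a v v * W b v v) \<le> D" if "a \<ge> 1" "b \<ge> 1" "a + b = 2 * k" for a b
  proof -
    have "(\<Sum>v\<in>U. W a v v * W b v v) \<le> (\<Sum>v\<in>U. (1 / \<delta>) * W (2 * (k - 1)) v v)"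
    proof (rule sum_mono)
      fix v assume v: "v \<in> U"
      have "W a v v * W b v v \<le> W 2 v v * W (2 * k - 2) v v" using W_split[OF v that] .
      also have "\<dots> \<le> (1 / \<delta>) * W (2 * k - 2) v v" by (intro mult_right_mono W_2_diag v W_nonneg)
      also have "2 * k - 2 = 2 * (k - 1)" by simp
      finally show "W a v v * W b v v \<le> (1 / \<delta>) * W (2 * (k - 1)) v v" .
    qed
    then show ?thesis unfolding D_def tr_def by (simp add: sum_distrib_left)
  qed
  have D0: "D \<ge> 0" unfolding D_def using d0 tr_pos[of "k-1"] by simp
  let ?n = "2 * k"
  \<comment> \<open>In \<open>A x a\<close> the walk returns to its start \<open>x\<close> after
    \<open>a + 1\<close> steps. In \<open>B a b\<close> an inner vertex \<open>v\<close> is reached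
    after \<open>a + 1\<close> steps and again \<open>b + 1\<close> steps later. The last piece
    makes up the total of \<open>2 * k\<close> steps.\<close>
  define A where "A x a = (\<lambda>(p, q). p @ x # q) ` (vertex_lists a \<times> vertex_lists (?n - 2 - a))" for x a
  define B where "B a b = (\<lambda>(v, p, q, r). p @ v # q @ v # r) ` (U \<times> vertex_lists a \<times> vertex_lists b \<times> vertex_lists (?n - 3 - a - b))" for a b
  have finA: "finite (A x a)" for x a unfolding A_def using finite_vertex_lists by auto
  have finB: "finite (B a b)" for a b unfolding B_def using finite_vertex_lists finU by auto
  have cover: "{zs\<in>vertex_lists (?n - 1). \<not> distinct (x # zs)} \<subseteq> (\<Union>a\<in>{..?n-2}. A x a) \<union> (\<Union>p\<in>{(a,b). a \<le> ?n \<and> b \<le> ?n \<and> a + b \<le> ?n - 3}. B (fst p) (snd p))" for x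
  proof
    fix zs assume "zs \<in> {zs\<in>vertex_lists (?n - 1). \<not> distinct (x # zs)}"
    then have z: "set zs \<subseteq> U" "length zs = ?n - 1" "x \<in> set zs \<or> \<not> distinct zs" unfolding vertex_lists_def by auto
    show "zs \<in> (\<Union>a\<in>{..?n-2}. A x a) \<union> (\<Union>p\<in>{(a,b). a \<le> ?n \<and> b \<le> ?n \<and> a + b \<le> ?n - 3}. B (fst p) (snd p))"
    proof (cases "x \<in> set zs")
      case True
      then obtain p q where pq: "zs = p @ x # q" by (auto simp: in_set_conv_decomp)
      then have "(p, q) \<in> vertex_lists (length p) \<times> vertex_lists (?n - 2 - length p)" "length p \<le> ?n - 2" using z by (auto simp: vertex_lists_def)
      then have "zs \<in> A x (length p)" unfolding A_def pq by force
      then show ?thesis using \<open>length p \<le> ?n - 2\<close> by auto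
    next
      case False
      then obtain p q r v where pq: "zs = p @ [v] @ q @ [v] @ r" using z(3) not_distinct_decomp by blast
      then have m: "(v, p, q, r) \<in> U \<times> vertex_lists (length p) \<times> vertex_lists (length q) \<times> vertex_lists (?n - 3 - length p - length q)"
        and l: "length p \<le> ?n" "length q \<le> ?n" "length p + length q \<le> ?n - 3"
        using z by (auto simp: vertex_lists_def)
      have "zs \<in> B (length p) (length q)" unfolding B_def pq by (rule image_eqI[OF _ m]) simp
      then show ?thesis using l by (intro UnI2 UN_I[of "(length p, length q)"]) auto
    qed
  qed
  define P where "P = {(a,b). a \<le> ?n \<and> b \<le> ?n \<and> a + b \<le> ?n - (3::nat)}"
  have Psub: "P \<subseteq> {..?n-3} \<times> {..?n-3}" unfolding P_def by auto
  then have finP: "finite P" by (rule finite_subset) auto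
  have "card {..?n-3} = ?n - 2" using k by simp
  then have cardP: "card P \<le> (?n-2) * (?n-2)" using card_mono[OF _ Psub] by (simp add: card_cartesian_product)
  have bound: "(\<Sum>zs\<in>{zs\<in>vertex_lists (?n - 1). \<not> distinct (x # zs)}. wt x zs x)
      \<le> (\<Sum>a\<in>{..?n-2}. \<Sum>zs\<in>A x a. wt x zs x) + (\<Sum>p\<in>P. \<Sum>zs\<in>B (fst p) (snd p). wt x zs x)" for x
  proof -
    have "(\<Sum>zs\<in>{zs\<in>vertex_lists (?n - 1). \<not> distinct (x # zs)}. wt x zs x)
       \<le> (\<Sum>zs\<in>(\<Union>a\<in>{..?n-2}. A x a) \<union> (\<Union>p\<in>P. B (fst p) (snd p)). wt x zs x)"
      using cover[of x] finA finB finP unfolding P_def[symmetric] by (intro sum_mono2 wt_nonneg) auto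
    also have "\<dots> \<le> (\<Sum>zs\<in>(\<Union>a\<in>{..?n-2}. A x a). wt x zs x) + (\<Sum>zs\<in>(\<Union>p\<in>P. B (fst p) (snd p)). wt x zs x)"
      using finA finB finP by (subst sum_Un) (auto intro!: sum_nonneg wt_nonneg)
    also have "\<dots> \<le> (\<Sum>a\<in>{..?n-2}. \<Sum>zs\<in>A x a. wt x zs x) + (\<Sum>p\<in>P. \<Sum>zs\<in>B (fst p) (snd p). wt x zs x)"
      using finA finB finP by (intro add_mono sum_UN_le) (auto intro: wt_nonneg)
    finally show ?thesis .
  qed
  have Asum: "(\<Sum>x\<in>U. \<Sum>zs\<in>A x a. wt x zs x) \<le> D" if a: "a \<le> ?n - 2" for a
  proof -
    have "(\<Sum>x\<in>U. \<Sum>zs\<in>A x a. wt x zs x) \<le> (\<Sum>x\<in>U. W (Suc a) x x * W (Suc (?n - 2 - a)) x x)"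
    proof (rule sum_mono)
      fix x assume x: "x \<in> U"
      have "(\<Sum>zs\<in>A x a. wt x zs x) \<le> (\<Sum>pq\<in>vertex_lists a \<times> vertex_lists (?n-2-a). wt x (fst pq) x * wt x (snd pq) x)"
        unfolding A_def by (rule order_trans[OF sum_image_le]) (auto simp: finite_vertex_lists wt_nonneg wt_append split_def)
      also have "\<dots> = (\<Sum>p\<in>vertex_lists a. wt x p x) * (\<Sum>q\<in>vertex_lists (?n-2-a). wt x q x)"
        by (simp add: sum_product sum.cartesian_product split_def)
      also have "\<dots> = W (Suc a) x x * W (Suc (?n - 2 - a)) x x" using sum_wt[OF x] by simp
      finally show "(\<Sum>zs\<in>A x a. wt x zs x) \<le> W (Suc a) x x * W (Suc (?n - 2 - a)) x x" .
    qed
    also have "\<dots> \<le> D" by (rule D) (use a k in auto)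
    finally show ?thesis .
  qed
  have Bsum: "(\<Sum>x\<in>U. \<Sum>zs\<in>B a b. wt x zs x) \<le> D" if ab: "a + b \<le> ?n - 3" for a b
  proof -
    let ?c = "?n - 3 - a - b"
    have "(\<Sum>x\<in>U. \<Sum>zs\<in>B a b. wt x zs x) \<le> (\<Sum>x\<in>U. \<Sum>v\<in>U. W (Suc a) x v * W (Suc b) v v * W (Suc ?c) v x)"
    proof (rule sum_mono)
      fix x assume x: "x \<in> U"
      have "(\<Sum>zs\<in>B a b. wt x zs x) \<le> (\<Sum>t\<in>U \<times> vertex_lists a \<times> vertex_lists b \<times> vertex_lists ?c.
          wt x (fst (snd t)) (fst t) * wt (fst t) (fst (snd (snd t))) (fst t) * wt (fst t) (snd (snd (snd t))) x)"
        unfolding B_def by (rule order_trans[OF sum_image_le]) (auto simp: finU finite_vertex_lists wt_nonneg wt_append split_def mult.assoc)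
      also have "\<dots> = (\<Sum>v\<in>U. (\<Sum>p\<in>vertex_lists a. wt x p v) * (\<Sum>q\<in>vertex_lists b. wt v q v) * (\<Sum>r\<in>vertex_lists ?c. wt v r x))"
        by (simp add: sum.cartesian_product' sum_product3 mult.assoc)
      also have "\<dots> = (\<Sum>v\<in>U. W (Suc a) x v * W (Suc b) v v * W (Suc ?c) v x)" using sum_wt x by (simp del: W.simps)
      finally show "(\<Sum>zs\<in>B a b. wt x zs x) \<le> (\<Sum>v\<in>U. W (Suc a) x v * W (Suc b) v v * W (Suc ?c) v x)" .
    qed
    \<comment> \<open>Summed over the start \<open>x\<close>, the last and the first piece join to
      one closed walk at \<open>v\<close>.\<close>
    also have "\<dots> = (\<Sum>v\<in>U. W (Suc b) v v * (\<Sum>x\<in>U. W (Suc ?c) v x * W (Suc a) x v))"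
      by (subst sum.swap) (simp add: sum_distrib_left mult_ac del: W.simps)
    also have "\<dots> = (\<Sum>v\<in>U. W (Suc b) v v * W (Suc ?c + Suc a) v v)"
      by (rule sum.cong[OF refl]) (simp only: W_add)
    also have "\<dots> \<le> D" by (rule D) (use ab k in auto)
    finally show ?thesis .
  qed
  have "(\<Sum>x\<in>U. \<Sum>zs\<in>{zs\<in>vertex_lists (?n - 1). \<not> distinct (x # zs)}. wt x zs x)
     \<le> (\<Sum>x\<in>U. (\<Sum>a\<in>{..?n-2}. \<Sum>zs\<in>A x a. wt x zs x) + (\<Sum>p\<in>P. \<Sum>zs\<in>B (fst p) (snd p). wt x zs x))"
    by (intro sum_mono bound)
  also have "\<dots> = (\<Sum>a\<in>{..?n-2}. \<Sum>x\<in>U. \<Sum>zs\<in>A x a. wt x zs x) + (\<Sum>p\<in>P. \<Sum>x\<in>U. \<Sum>zs\<in>B (fst p) (snd p). wt x zs x)"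
    unfolding sum.distrib by (intro arg_cong2[where f="(+)"] sum.swap)
  also have "\<dots> \<le> (\<Sum>a\<in>{..?n-2}. D) + (\<Sum>p\<in>P. D)"
    by (intro add_mono sum_mono Asum Bsum) (auto simp: P_def)
  also have "\<dots> = real (?n - 1 + card P) * D" using k by (simp add: algebra_simps Suc_diff_le)
  \<comment> \<open>There are at most \<open>2 * (2 * k)\<^sup>2\<close> splitting patterns, the
    origin of the constant 8.\<close>
  also have "\<dots> \<le> real (8 * k^2) * D"
  proof (rule mult_right_mono[OF _ D0], rule of_nat_mono)
    have "(?n-2) * (?n-2) \<le> ?n * ?n" by (intro mult_le_mono) auto
    moreover have "?n \<le> ?n * ?n" using k by simp
    ultimately have "?n - 1 + card P \<le> ?n * ?n + ?n * ?n" using cardP by linarith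
    then show "?n - 1 + card P \<le> 8 * k^2" by (simp add: power2_eq_square)
  qed
  finally show ?thesis unfolding D_def by simp
qed

text \<open>The factor 16 is twice the 8 of \<open>repeating_walks_weight\<close>, which leaves
  total weight at least 1/2 for closed walks without repetition. Each of these weighs at most
  \<open>(1 / \<delta>) ^ (2 * k)\<close>, and this turns weight into number.\<close>

theorem cycle_supersaturation:
  assumes k: "k \<ge> 2" and big: "16 * real k ^ 2 * real (card U) powr (1 / k) \<le> \<delta>"
  shows "\<delta> ^ (2 * k) / 2 \<le> real (card {xs. length xs = 2 * k \<and> distinct xs \<and> set xs \<subseteq> U \<and>
      (\<forall>i<2*k. adj (xs ! i) (xs ! (Suc i mod (2 * k))))})"
proof -
  let ?n = "2 * k"
  let ?S = "{xs. length xs = ?n \<and> distinct xs \<and> set xs \<subseteq> U \<and> (\<forall>i<?n. adj (xs ! i) (xs ! (Suc i mod ?n)))}"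
  have finS: "finite ?S" by (rule finite_subset[OF _ finite_vertex_lists[of ?n]]) (auto simp: vertex_lists_def)
  have wt_adj: "adj ((x # zs) ! i) ((x # zs @ [y]) ! Suc i)" if "wt x zs y \<noteq> 0" "i < Suc (length zs)" for x zs y i
    using that
  proof (induction zs arbitrary: x i)
    case Nil
    then show ?case by (auto simp: M_def split: if_splits)
  next
    case (Cons z zs)
    show ?case
    proof (cases i)
      case 0
      then show ?thesis using Cons.prems by (auto simp: M_def split: if_splits)
    next
      case (Suc j)
      then show ?thesis using Cons.IH[of z j] Cons.prems by auto
    qed
  qed
  have "tr k = (\<Sum>x\<in>U. \<Sum>zs\<in>vertex_lists (?n - 1). wt x zs x)"
    unfolding tr_def using k by (intro sum.cong refl) (simp add: sum_wt del: W.simps)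
  also have "\<dots> = (\<Sum>x\<in>U. (\<Sum>zs\<in>{zs\<in>vertex_lists (?n - 1). \<not> distinct (x # zs)}. wt x zs x) + (\<Sum>zs\<in>{zs\<in>vertex_lists (?n - 1). distinct (x # zs)}. wt x zs x))"
    by (intro sum.cong refl, subst sum.union_disjoint[symmetric]) (auto simp: finite_vertex_lists intro!: sum.cong)
  also have "\<dots> \<le> 8 * real k ^ 2 * ((1 / \<delta>) * tr (k - 1)) + (\<Sum>x\<in>U. \<Sum>zs\<in>{zs\<in>vertex_lists (?n - 1). distinct (x # zs)}. wt x zs x)"
    unfolding sum.distrib using repeating_walks_weight[OF k] by simp
  finally have 1: "tr k \<le> \<dots>" .
  have "8 * real k ^ 2 * ((1 / \<delta>) * tr (k - 1)) \<le> 8 * real k ^ 2 * ((1 / \<delta>) * (real (card U) powr (1 / k) * tr k))"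
    using tr_ratio[of k] k d0 by (intro mult_left_mono) auto
  also have "\<dots> = (16 * real k ^ 2 * real (card U) powr (1 / k)) / \<delta> * (tr k / 2)" by simp
  also have "\<dots> \<le> 1 * (tr k / 2)" using big d0 tr_pos[of k] by (intro mult_right_mono) (auto simp: field_simps)
  finally have 2: "1 / 2 \<le> (\<Sum>x\<in>U. \<Sum>zs\<in>{zs\<in>vertex_lists (?n - 1). distinct (x # zs)}. wt x zs x)"
    using 1 tr_ge_1[of k] by linarith
  define Q where "Q = Sigma U (\<lambda>x. {zs\<in>vertex_lists (?n - 1). distinct (x # zs)})"
  have finQ: "finite Q" unfolding Q_def using finU finite_vertex_lists by auto
  have "(\<Sum>x\<in>U. \<Sum>zs\<in>{zs\<in>vertex_lists (?n - 1). distinct (x # zs)}. wt x zs x) = (\<Sum>p\<in>Q. wt (fst p) (snd p) (fst p))"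
    unfolding Q_def by (subst sum.Sigma) (auto simp: finU finite_vertex_lists split_def)
  also have "\<dots> \<le> (\<Sum>p\<in>Q. if fst p # snd p \<in> ?S then (1 / \<delta>) ^ ?n else 0)"
  proof (rule sum_mono)
    fix p assume p: "p \<in> Q"
    obtain x zs where xz: "p = (x, zs)" by (cases p)
    have h: "x \<in> U" "set zs \<subseteq> U" "length zs = ?n - 1" "distinct (x # zs)" using p unfolding Q_def xz vertex_lists_def by auto
    show "wt (fst p) (snd p) (fst p) \<le> (if fst p # snd p \<in> ?S then (1 / \<delta>) ^ ?n else 0)"
    proof (cases "wt x zs x = 0")
      case True
      then show ?thesis unfolding xz using d0 by simp
    next
      case False
      have "adj ((x # zs) ! i) ((x # zs) ! (Suc i mod ?n))" if i: "i < ?n" for i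
      proof (cases "Suc i = ?n")
        case True
        have "adj ((x # zs) ! i) ((x # zs @ [x]) ! Suc i)" by (rule wt_adj[OF False]) (use h i k in auto)
        moreover have "(x # zs @ [x]) ! Suc i = x" using True h(3) by (simp add: nth_append)
        ultimately show ?thesis using True by simp
      next
        case F2: False
        have "adj ((x # zs) ! i) ((x # zs @ [x]) ! Suc i)" by (rule wt_adj[OF False]) (use h i k in auto)
        moreover have "i < length zs" using F2 i h(3) by simp
        then have "(x # zs @ [x]) ! Suc i = (x # zs) ! Suc i" by (simp add: nth_append)
        ultimately show ?thesis using F2 i by simp
      qed
      then have "x # zs \<in> ?S" using h k by auto
      moreover have "wt x zs x \<le> (1 / \<delta>) ^ ?n" using wt_le[OF h(1) h(1) h(2)] h(3) k by (metis Suc_diff_1 Suc_1 lessI mult_pos_pos order_less_le_trans zero_less_Suc)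
      ultimately show ?thesis unfolding xz by simp
    qed
  qed
  also have "\<dots> = (1 / \<delta>) ^ ?n * real (card {p\<in>Q. fst p # snd p \<in> ?S})"
    using finQ by (simp add: sum.If_cases Int_def)
  also have "\<dots> \<le> (1 / \<delta>) ^ ?n * real (card ?S)"
  proof -
    have "inj_on (\<lambda>p. fst p # snd p) {p\<in>Q. fst p # snd p \<in> ?S}" by (rule inj_onI) (auto simp: prod_eq_iff)
    then have "card {p\<in>Q. fst p # snd p \<in> ?S} \<le> card ?S" by (rule card_inj_on_le) (use finS in auto)
    then show ?thesis using d0 by (intro mult_left_mono) auto
  qed
  finally have "1 / 2 \<le> (1 / \<delta>) ^ ?n * real (card ?S)" using 2 by linarith
  then show ?thesis using d0 by (simp add: power_divide field_simps)
qed

end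

section \<open>Linear cycles\<close>

text \<open>\<open>w\<close> runs through the vertices shared by consecutive triples,
  \<open>u\<close> through the private ones. Only the set of triples is kept, since the container
  argument works with sets of triples.\<close>

definition linear_cycle_edges :: "nat \<Rightarrow> 'a set set \<Rightarrow> bool" where
  "linear_cycle_edges k S \<longleftrightarrow> (\<exists>w u. inj_on w {..<k} \<and> inj_on u {..<k} \<and> w ` {..<k} \<inter> u ` {..<k} = {} \<and>
     S = (\<lambda>i. {w i, w (Suc i mod k), u i}) ` {..<k})"

definition cycle_copies :: "nat \<Rightarrow> 'a set set \<Rightarrow> 'a set set set" where
  "cycle_copies k V = {S. S \<subseteq> V \<and> linear_cycle_edges k S}"

text \<open>Otherwise \<open>I\<close> would be closed under the cyclic successor and so be
  everything. This extra vertex of a proper part of a cycle is what the deletion arguments live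
  on.\<close>

lemma cyclic_neighbourhood:
  assumes I: "I \<subseteq> {..<k}" "I \<noteq> {}" "I \<noteq> {..<k}"
  shows "Suc (card I) \<le> card (I \<union> (\<lambda>i. Suc i mod k) ` I)"
proof (rule ccontr)
  assume c: "\<not> ?thesis"
  have fI: "finite I" using I(1) finite_subset by auto
  have "card (I \<union> (\<lambda>i. Suc i mod k) ` I) \<le> card I" using c by simp
  then have "I \<union> (\<lambda>i. Suc i mod k) ` I = I" using fI by (metis Un_upper1 card_seteq finite_UnI finite_imageI)
  then have cl: "Suc i mod k \<in> I" if "i \<in> I" for i using that by blast
  obtain i where i: "i \<in> I" using I by auto
  have k: "i < k" using i I by auto
  have "(i + m) mod k \<in> I" for m
  proof (induction m)
    case (Suc m)
    then show ?case using cl[OF Suc] by (simp add: mod_Suc_eq)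
  qed (use i k in simp)
  then have "(i + (j + (k - i))) mod k \<in> I" for j .
  then have "j \<in> I" if "j < k" for j using k that by (metis add.assoc add.commute le_add_diff_inverse less_imp_le mod_add_self1 mod_less)
  then show False using I by auto
qed

text \<open>The triples with index set \<open>I\<close> cover \<open>card I\<close> private vertices
  and the shared vertices with index in \<open>I\<close> or among its successors; the latter
  outnumber \<open>I\<close> unless \<open>I\<close> is empty or everything.\<close>

lemma linear_cycle_card:
  assumes S: "linear_cycle_edges k S" and k: "k \<ge> 1"
  shows "card S = k" "finite S" "b \<subseteq> S \<Longrightarrow> b \<noteq> {} \<Longrightarrow> b \<noteq> S \<Longrightarrow> 2 * card b + 1 \<le> card (\<Union>b)" "card (\<Union>S) = 2 * k"
proof -
  obtain w u where wu: "inj_on w {..<k}" "inj_on u {..<k}" "w ` {..<k} \<inter> u ` {..<k} = {}"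
    and S: "S = (\<lambda>i. {w i, w (Suc i mod k), u i}) ` {..<k}"
    using S unfolding linear_cycle_edges_def by blast
  have inj: "inj_on (\<lambda>i. {w i, w (Suc i mod k), u i}) {..<k}"
  proof (rule inj_onI)
    fix i j assume ij: "i \<in> {..<k}" "j \<in> {..<k}" "{w i, w (Suc i mod k), u i} = {w j, w (Suc j mod k), u j}"
    then have "u i \<in> {w j, w (Suc j mod k), u j}" by auto
    moreover have "Suc j mod k \<in> {..<k}" using k by simp
    ultimately have "u i = u j" using wu(3) ij by blast
    then show "i = j" using wu(2) ij by (auto dest: inj_onD)
  qed
  show "card S = k" "finite S" unfolding S using inj by (auto simp: card_image)
  have un: "card (\<Union>((\<lambda>i. {w i, w (Suc i mod k), u i}) ` I)) = card (I \<union> (\<lambda>i. Suc i mod k) ` I) + card I"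
    if I: "I \<subseteq> {..<k}" for I
  proof -
    have fI: "finite I" using I finite_subset by auto
    have J: "I \<union> (\<lambda>i. Suc i mod k) ` I \<subseteq> {..<k}" using I k by auto
    have "\<Union>((\<lambda>i. {w i, w (Suc i mod k), u i}) ` I) = w ` (I \<union> (\<lambda>i. Suc i mod k) ` I) \<union> u ` I" by auto
    moreover have "w ` (I \<union> (\<lambda>i. Suc i mod k) ` I) \<inter> u ` I = {}" using J I wu(3) by blast
    ultimately show ?thesis using fI card_image[OF inj_on_subset[OF wu(1) J]] card_image[OF inj_on_subset[OF wu(2) I]]
      by (simp add: card_Un_disjoint)
  qed
  have all: "{..<k} \<union> (\<lambda>i. Suc i mod k) ` {..<k} = {..<k}" using k by auto
  show "card (\<Union>S) = 2 * k" using un[of "{..<k}"] all unfolding S by simp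
  show "2 * card b + 1 \<le> card (\<Union>b)" if b: "b \<subseteq> S" "b \<noteq> {}" "b \<noteq> S"
  proof -
    obtain I where I: "I \<subseteq> {..<k}" "b = (\<lambda>i. {w i, w (Suc i mod k), u i}) ` I"
      using b(1) unfolding S by (meson subset_imageE)
    have "I \<noteq> {}" "I \<noteq> {..<k}" using b I S by auto
    then have "Suc (card I) \<le> card (I \<union> (\<lambda>i. Suc i mod k) ` I)" using cyclic_neighbourhood I(1) by blast
    moreover have "card b = card I" unfolding I(2) using inj_on_subset[OF inj I(1)] by (rule card_image)
    ultimately show ?thesis using un[OF I(1)] I(2) by simp
  qed
qed

section \<open>Uniformly random vertex sets\<close>

lemma binomial_real_step: "1 \<le> j \<Longrightarrow> j \<le> m \<Longrightarrow> real ((m - 1) choose (j - 1)) = real j / real m * real (m choose j)"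
proof -
  assume h: "1 \<le> j" "j \<le> m"
  then obtain a b where ab: "j = Suc a" "m = Suc b" by (metis Suc_le_D le_trans One_nat_def)
  have "real (Suc a * (Suc b choose Suc a)) = real (Suc b * (b choose a))"
    using Suc_times_binomial_eq[of b a] by (simp only: mult.commute)
  then show ?thesis unfolding ab by (simp add: field_simps del: binomial_Suc_Suc)
qed

text \<open>Random sets are uniform among those of size \<open>s\<close>, so the degree of
  \<open>W\<close> in the family of all these sets, divided by \<open>n choose s\<close>, is the
  probability of containing \<open>W\<close>. It is a product of factors
  \<open>(s - i) / (n - i) \<le> s / n\<close>.\<close>

lemma binomial_sub_le: "w \<le> s \<Longrightarrow> s \<le> n \<Longrightarrow> real ((n - w) choose (s - w)) \<le> (real s / real n) ^ w * real (n choose s)"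
proof (induction w)
  case (Suc w)
  have "real ((n - Suc w) choose (s - Suc w)) = real (s - w) / real (n - w) * real ((n - w) choose (s - w))"
    using binomial_real_step[of "s - w" "n - w"] Suc.prems by simp
  also have "\<dots> \<le> real s / real n * ((real s / real n) ^ w * real (n choose s))"
  proof (intro mult_mono Suc.IH)
    have "real w * real s \<le> real w * real n" using Suc.prems by (intro mult_left_mono) auto
    then show "real (s - w) / real (n - w) \<le> real s / real n"
      using Suc.prems by (simp add: of_nat_diff field_simps)
  qed (use Suc in auto)
  finally show ?case by simp
qed simp

lemma sdeg_subsets:
  assumes A: "finite A" "W \<subseteq> A" "card W \<le> s"
  shows "sdeg {U. U \<subseteq> A \<and> card U = s} W = (card A - card W) choose (s - card W)"
proof -
  have fW: "finite W" using A finite_subset by auto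
  have "bij_betw (\<lambda>U. U \<union> W) {U. U \<subseteq> A - W \<and> card U = s - card W} {U \<in> {U. U \<subseteq> A \<and> card U = s}. W \<subseteq> U}"
  proof (rule bij_betw_byWitness[where f' = "\<lambda>U. U - W"])
    show "(\<lambda>U. U \<union> W) ` {U. U \<subseteq> A - W \<and> card U = s - card W} \<subseteq> {U \<in> {U. U \<subseteq> A \<and> card U = s}. W \<subseteq> U}"
    proof
      fix X assume "X \<in> (\<lambda>U. U \<union> W) ` {U. U \<subseteq> A - W \<and> card U = s - card W}"
      then obtain U where U: "X = U \<union> W" "U \<subseteq> A - W" "card U = s - card W" by auto
      have "finite U" using U(2) A(1) by (meson finite_Diff finite_subset)
      then have "card X = s" using U A(3) fW by (simp add: card_Un_disjoint Int_Diff Diff_Int_distrib disjoint_iff subset_iff)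
      then show "X \<in> {U \<in> {U. U \<subseteq> A \<and> card U = s}. W \<subseteq> U}" using U A by auto
    qed
    show "(\<lambda>U. U - W) ` {U \<in> {U. U \<subseteq> A \<and> card U = s}. W \<subseteq> U} \<subseteq> {U. U \<subseteq> A - W \<and> card U = s - card W}"
      using fW by (auto simp: card_Diff_subset)
  qed auto
  from bij_betw_same_card[OF this] have "sdeg {U. U \<subseteq> A \<and> card U = s} W = card {U. U \<subseteq> A - W \<and> card U = s - card W}"
    unfolding sdeg_def by (rule sym)
  also have "\<dots> = (card A - card W) choose (s - card W)"
    using n_subsets[of "A - W"] A fW by (simp add: card_Diff_subset)
  finally show ?thesis .
qed

lemma sdeg_subsets_le:
  assumes A: "finite A" "W \<subseteq> A" "s \<le> card A"
  shows "real (sdeg {U. U \<subseteq> A \<and> card U = s} W) \<le> (real s / real (card A)) ^ card W * real (card A choose s)"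
proof (cases "card W \<le> s")
  case True
  then show ?thesis using sdeg_subsets[OF A(1,2) True] binomial_sub_le[OF True A(3)] by simp
next
  case False
  have "{U \<in> {U. U \<subseteq> A \<and> card U = s}. W \<subseteq> U} = {}"
    using False A(1) by (auto dest: finite_subset card_mono)
  then have "sdeg {U. U \<subseteq> A \<and> card U = s} W = 0" unfolding sdeg_def by (simp only: card.empty)
  then show ?thesis by simp
qed

lemma sdeg_subsets_ge2:
  assumes A: "finite A" "W \<subseteq> A" "s \<le> card A" "card W = 2" "s \<ge> 2"
  shows "(real s / real (card A)) ^ 2 / 2 * real (card A choose s) \<le> real (sdeg {U. U \<subseteq> A \<and> card U = s} W)"
proof -
  let ?n = "card A"
  have "real ((?n - 2) choose (s - 2)) = real (s - 1) / real (?n - 1) * (real s / real ?n * real (?n choose s))"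
    using binomial_real_step[of "s - 1" "?n - 1"] binomial_real_step[of s ?n] A by (simp add: numeral_2_eq_2)
  moreover have "real s / 2 / real ?n \<le> real (s - 1) / real (?n - 1)"
    using A by (intro frac_le) (auto simp: of_nat_diff)
  then have "real s / 2 / real ?n * (real s / real ?n * real (?n choose s)) \<le> real (s - 1) / real (?n - 1) * (real s / real ?n * real (?n choose s))"
    by (intro mult_right_mono) auto
  ultimately show ?thesis using sdeg_subsets[OF A(1,2)] A by (simp add: power2_eq_square)
qed

lemma sdeg_subsets_ge3:
  assumes A: "finite A" "W \<subseteq> A" "s \<le> card A" "card W = 3" "s \<ge> 6"
  shows "(real s / real (card A)) ^ 3 / 2 * real (card A choose s) \<le> real (sdeg {U. U \<subseteq> A \<and> card U = s} W)"
proof -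
  let ?n = "card A"
  have "real ((?n - 3) choose (s - 3)) = real (s - 2) / real (?n - 2) * (real (s - 1) / real (?n - 1) * (real s / real ?n * real (?n choose s)))"
    using binomial_real_step[of "s - 2" "?n - 2"] binomial_real_step[of "s - 1" "?n - 1"] binomial_real_step[of s ?n] A
    by (simp add: numeral_3_eq_3 numeral_2_eq_2)
  \<comment> \<open>For \<open>s \<ge> 6\<close> one has \<open>s - 2 \<ge> 2 * s / 3\<close> and
    \<open>s - 1 \<ge> 5 * s / 6\<close>; the product 5/9 of the two losses is still at least
    1/2.\<close>
  moreover have "real s * (2 / 3) / real ?n \<le> real (s - 2) / real (?n - 2)"
    using A by (intro frac_le) (auto simp: of_nat_diff)
  moreover have "real s * (5 / 6) / real ?n \<le> real (s - 1) / real (?n - 1)"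
    using A by (intro frac_le) (auto simp: of_nat_diff)
  ultimately have "real s * (2 / 3) / real ?n * (real s * (5 / 6) / real ?n * (real s / real ?n * real (?n choose s))) \<le> real ((?n - 3) choose (s - 3))"
    by (simp only:) (intro mult_mono order_refl mult_nonneg_nonneg divide_nonneg_nonneg; simp)
  moreover have "(real s / real ?n) ^ 3 / 2 * real (?n choose s) \<le> (real s / real ?n) ^ 3 * (5 / 9) * real (?n choose s)"
    by (intro mult_right_mono) auto
  ultimately show ?thesis using sdeg_subsets[OF A(1,2)] A by (simp add: power3_eq_cube)
qed

text \<open>Linearity of expectation in counting form.\<close>

lemma sum_sample:
  assumes "finite X" "finite Us"
  shows "(\<Sum>U\<in>Us. real (card {x\<in>X. g x \<subseteq> U})) = (\<Sum>x\<in>X. real (sdeg Us (g x)))"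
proof -
  have "(\<Sum>U\<in>Us. real (card {x\<in>X. g x \<subseteq> U})) = (\<Sum>U\<in>Us. \<Sum>x\<in>X. if g x \<subseteq> U then 1 else 0)"
    using assms by (simp add: sum.If_cases Int_def)
  also have "\<dots> = (\<Sum>x\<in>X. \<Sum>U\<in>Us. if g x \<subseteq> U then 1 else 0)" by (rule sum.swap)
  also have "\<dots> = (\<Sum>x\<in>X. real (sdeg Us (g x)))"
    using assms by (simp add: sum.If_cases Int_def sdeg_def)
  finally show ?thesis .
qed

section \<open>Triple systems with large codegrees\<close>

text \<open>\<open>\<phi>\<close> names the pair with which a triple was removed. All triples
  removed with \<open>f\<close> go at the same moment, when fewer than \<open>d\<close> triples
  through \<open>f\<close> are left, and none through \<open>f\<close> remains afterwards.\<close>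

lemma codegree_peeling:
  fixes d :: real
  assumes "finite W" "d > 0" "\<And>e. e \<in> W \<Longrightarrow> card e = 3"
  shows "(\<exists>W'\<subseteq>W. W' \<noteq> {} \<and> (\<forall>f. card f = 2 \<longrightarrow> (\<exists>e\<in>W'. f \<subseteq> e) \<longrightarrow> d \<le> real (sdeg W' f))) \<or>
         (\<exists>\<phi>. (\<forall>e\<in>W. \<phi> e \<subseteq> e \<and> card (\<phi> e) = 2) \<and> (\<forall>f. real (card {e\<in>W. \<phi> e = f}) < d))"
  using assms
proof (induction "card W" arbitrary: W rule: less_induct)
  case less
  show ?case
  proof (cases "W \<noteq> {} \<and> (\<exists>f. card f = 2 \<and> (\<exists>e\<in>W. f \<subseteq> e) \<and> real (sdeg W f) < d)")
    case False
    then show ?thesis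
    proof (cases "W = {}")
      case True
      then show ?thesis using less.prems(2) by auto
    next
      case F2: False
      then show ?thesis using False by (intro disjI1 exI[of _ W]) force
    qed
  next
    case True
    then obtain f e where f: "card f = 2" "e \<in> W" "f \<subseteq> e" "real (sdeg W f) < d" by auto
    let ?X = "{e\<in>W. \<not> f \<subseteq> e}"
    have "?X \<subset> W" using f by auto
    then have "card ?X < card W" using less.prems(1) by (rule psubset_card_mono[rotated])
    then have IH: "(\<exists>W'\<subseteq>?X. W' \<noteq> {} \<and> (\<forall>f. card f = 2 \<longrightarrow> (\<exists>e\<in>W'. f \<subseteq> e) \<longrightarrow> d \<le> real (sdeg W' f))) \<or>
         (\<exists>\<phi>. (\<forall>e\<in>?X. \<phi> e \<subseteq> e \<and> card (\<phi> e) = 2) \<and> (\<forall>f. real (card {e\<in>?X. \<phi> e = f}) < d))"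
      using less.prems by (intro less.hyps) auto
    then show ?thesis
    proof
      assume "\<exists>W'\<subseteq>?X. W' \<noteq> {} \<and> (\<forall>f. card f = 2 \<longrightarrow> (\<exists>e\<in>W'. f \<subseteq> e) \<longrightarrow> d \<le> real (sdeg W' f))"
      then obtain W' where "W' \<subseteq> ?X" "W' \<noteq> {} \<and> (\<forall>f. card f = 2 \<longrightarrow> (\<exists>e\<in>W'. f \<subseteq> e) \<longrightarrow> d \<le> real (sdeg W' f))" by auto
      then show ?thesis by (intro disjI1 exI[of _ W']) auto
    next
      assume "\<exists>\<phi>. (\<forall>e\<in>?X. \<phi> e \<subseteq> e \<and> card (\<phi> e) = 2) \<and> (\<forall>f. real (card {e\<in>?X. \<phi> e = f}) < d)"
      then obtain \<phi> where \<phi>: "\<forall>e\<in>?X. \<phi> e \<subseteq> e \<and> card (\<phi> e) = 2" "\<forall>f. real (card {e\<in>?X. \<phi> e = f}) < d" by auto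
      define \<psi> where "\<psi> e = (if f \<subseteq> e then f else \<phi> e)" for e
      have "real (card {e\<in>W. \<psi> e = g}) < d" for g
      proof (cases "g = f")
        case True
        have "{e\<in>W. \<psi> e = g} \<subseteq> {e\<in>W. f \<subseteq> e}" using True \<phi>(1) unfolding \<psi>_def by auto
        then have "card {e\<in>W. \<psi> e = g} \<le> sdeg W f" unfolding sdeg_def using less.prems(1) by (intro card_mono) auto
        then show ?thesis using f(4) by linarith
      next
        case False
        have "{e\<in>W. \<psi> e = g} \<subseteq> {e\<in>?X. \<phi> e = g}" using False unfolding \<psi>_def by auto
        then have "card {e\<in>W. \<psi> e = g} \<le> card {e\<in>?X. \<phi> e = g}" using less.prems(1) by (intro card_mono) auto
        then show ?thesis using \<phi>(2) by (meson le_less_trans of_nat_mono)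
      qed
      moreover have "\<forall>e\<in>W. \<psi> e \<subseteq> e \<and> card (\<psi> e) = 2" using \<phi>(1) f(1) unfolding \<psi>_def by auto
      ultimately show ?thesis by (intro disjI2 exI[of _ \<psi>] conjI allI) simp_all
    qed
  qed
qed

section \<open>Greedy embedding of linear cycles\<close>

lemma third_vertices:
  assumes "finite W" "\<And>e. e \<in> W \<Longrightarrow> card e = 3" "a \<noteq> b"
  shows "sdeg W {a, b} \<le> card {x. x \<noteq> a \<and> x \<noteq> b \<and> {a, b, x} \<in> W}" "finite {x. x \<noteq> a \<and> x \<noteq> b \<and> {a, b, x} \<in> W}"
proof -
  let ?X = "{x. x \<noteq> a \<and> x \<noteq> b \<and> {a, b, x} \<in> W}"
  have "finite (\<Union>W)" using assms(1,2) by (intro finite_Union) (auto intro: card_ge_0_finite)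
  then show fin: "finite ?X" by (rule finite_subset[rotated]) auto
  have "{e\<in>W. {a,b} \<subseteq> e} \<subseteq> (\<lambda>x. {a,b,x}) ` ?X"
  proof
    fix e assume e: "e \<in> {e\<in>W. {a,b} \<subseteq> e}"
    then have "card e = 3" "finite e" using assms(2) by (auto intro: card_ge_0_finite)
    then have "card (e - {a,b}) = 1" using e assms(3) by (simp add: card_Diff_subset)
    then obtain x where "e - {a,b} = {x}" by (auto simp: card_1_singleton_iff)
    then have "e = {a,b,x}" "x \<noteq> a" "x \<noteq> b" using e by auto
    then show "e \<in> (\<lambda>x. {a,b,x}) ` ?X" using e by auto
  qed
  then show "sdeg W {a, b} \<le> card ?X" unfolding sdeg_def using fin by (meson card_image_le card_mono finite_imageI order_trans)
qed

lemma greedy_representatives: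
  assumes "finite X" "\<And>i. i < k \<Longrightarrow> k + card X \<le> card (N i)"
  shows "\<exists>u. inj_on u {..<k} \<and> (\<forall>i<k. u i \<in> N i - X)"
proof -
  have "j \<le> k \<Longrightarrow> \<exists>u. inj_on u {..<j} \<and> (\<forall>i<j. u i \<in> N i - X)" for j
  proof (induction j)
    case (Suc j)
    then obtain u where u: "inj_on u {..<j}" "\<forall>i<j. u i \<in> N i - X" by auto
    have "card (X \<union> u ` {..<j}) \<le> card X + card (u ` {..<j})" by (rule card_Un_le)
    also have "\<dots> \<le> card X + j" using card_image_le[of "{..<j}" u] by simp
    also have "\<dots> < card (N j)" using assms(2)[of j] Suc.prems by simp
    finally have "\<not> N j \<subseteq> X \<union> u ` {..<j}" using assms(1) by (meson card_mono finite_UnI finite_imageI finite_lessThan not_le)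
    then obtain x where x: "x \<in> N j" "x \<notin> X" "x \<notin> u ` {..<j}" by auto
    show ?case
    proof (intro exI[of _ "u(j := x)"] conjI)
      show "inj_on (u(j := x)) {..<Suc j}" using u(1) x by (auto simp: inj_on_def lessThan_Suc)
      show "\<forall>i<Suc j. (u(j := x)) i \<in> N i - X" using u(2) x by (auto simp: less_Suc_eq)
    qed
  qed auto
  then show ?thesis by auto
qed

text \<open>A fixed vertex \<open>z\<close> is put on the cycle, and the other \<open>k - 1\<close>
  shared vertices form a path in the shadow all of whose vertices are shadow neighbours of
  \<open>z\<close>: each new one completes a triple with \<open>z\<close> and its predecessor. Such
  a path always closes through \<open>z\<close>. Codegree \<open>2 * k\<close> then leaves room for
  distinct private vertices off the cycle.\<close>

lemma linear_cycle_of_codegrees: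
  assumes W: "finite W" "\<And>e. e \<in> W \<Longrightarrow> card e = 3" "W \<noteq> {}" and k: "k \<ge> 3"
    and cd: "\<And>f. card f = 2 \<Longrightarrow> \<exists>e\<in>W. f \<subseteq> e \<Longrightarrow> 2 * k \<le> sdeg W f"
  shows "\<exists>S\<subseteq>W. linear_cycle_edges k S"
proof -
  define sh where "sh a b \<longleftrightarrow> a \<noteq> b \<and> (\<exists>e\<in>W. {a,b} \<subseteq> e)" for a b
  define N where "N a b = {x. x \<noteq> a \<and> x \<noteq> b \<and> {a, b, x} \<in> W}" for a b
  have N: "2 * k \<le> card (N a b)" if "sh a b" for a b
  proof -
    have "2 * k \<le> sdeg W {a,b}" using cd[of "{a,b}"] that unfolding sh_def by auto
    also have "\<dots> \<le> card (N a b)" unfolding N_def using third_vertices(1)[OF W(1,2)] that unfolding sh_def by auto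
    finally show ?thesis .
  qed
  obtain e where e: "e \<in> W" using W(3) by auto
  then obtain z y x where zyx: "e = {z,y,x}" "z \<noteq> y" "z \<noteq> x" "y \<noteq> x" using W(2)[OF e] by (auto simp: card_3_iff)
  have path: "m \<ge> 1 \<Longrightarrow> m \<le> k \<Longrightarrow> \<exists>w. inj_on w {..<m} \<and> z \<notin> w ` {..<m} \<and> (\<forall>i<m. sh z (w i)) \<and> (\<forall>i. Suc i < m \<longrightarrow> sh (w i) (w (Suc i)))" for m
  proof (induction m)
    case (Suc m)
    show ?case
    proof (cases "m = 0")
      case True
      have "sh z y" unfolding sh_def using e zyx by auto
      then show ?thesis using True zyx by (intro exI[of _ "\<lambda>_. y"]) (auto simp: inj_on_def)
    next
      case False
      then obtain w where w: "inj_on w {..<m}" "z \<notin> w ` {..<m}" "\<forall>i<m. sh z (w i)" "\<forall>i. Suc i < m \<longrightarrow> sh (w i) (w (Suc i))"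
        using Suc by auto
      have "sh z (w (m - 1))" using w(3) False by simp
      then have "2 * k \<le> card (N z (w (m-1)))" by (rule N)
      moreover have "card (w ` {..<m}) < 2 * k" using card_image_le[of "{..<m}" w] Suc.prems by simp
      ultimately have "\<not> N z (w (m-1)) \<subseteq> w ` {..<m}" by (metis card_mono finite_imageI finite_lessThan le_trans not_le)
      then obtain v where v: "v \<in> N z (w (m-1))" "v \<notin> w ` {..<m}" by auto
      have vv: "v \<noteq> z" "v \<noteq> w (m - 1)" "{z, w (m-1), v} \<in> W" using v(1) unfolding N_def by auto
      show ?thesis
      proof (intro exI[of _ "w(m := v)"] conjI allI impI)
        show "inj_on (w(m := v)) {..<Suc m}" using w(1) v(2) by (auto simp: inj_on_def lessThan_Suc)
        show "z \<notin> (w(m := v)) ` {..<Suc m}" using w(2) vv(1) by (auto simp: lessThan_Suc)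
        show "sh z ((w(m := v)) i)" if "i < Suc m" for i
        proof (cases "i = m")
          case True
          have "sh z v" unfolding sh_def using vv by auto
          then show ?thesis using True by simp
        qed (use that w(3) in auto)
        show "sh ((w(m := v)) i) ((w(m := v)) (Suc i))" if "Suc i < Suc m" for i
        proof (cases "Suc i = m")
          case True
          then have im: "i = m - 1" "i \<noteq> m" by simp_all
          have "{w (m - 1), v} \<subseteq> {z, w (m-1), v}" by blast
          then have "sh (w (m - 1)) v" unfolding sh_def using vv(2,3) by metis
          then show ?thesis using True im by simp
        next
          case False
          then have "Suc i < m" "i \<noteq> m" using that by simp_all
          then show ?thesis using w(4) by simp
        qed
      qed
    qed
  qed simp
  have k1: "k - 1 \<ge> 1" "k - 1 \<le> k" using k by simp_all
  from path[OF k1] obtain w where w: "inj_on w {..<k-1}" "z \<notin> w ` {..<k-1}" "\<forall>i<k-1. sh z (w i)" "\<forall>i. Suc i < k-1 \<longrightarrow> sh (w i) (w (Suc i))"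
    by (elim exE conjE) (rule that)
  define c where "c i = (case i of 0 \<Rightarrow> z | Suc j \<Rightarrow> w j)" for i
  have cinj: "inj_on c {..<k}"
  proof (rule inj_onI)
    fix i j assume "i \<in> {..<k}" "j \<in> {..<k}" "c i = c j"
    then show "i = j" using w(1,2) by (cases i; cases j) (auto simp: c_def inj_on_def)
  qed
  have csh: "sh (c i) (c (Suc i mod k))" if i: "i < k" for i
  proof (cases "Suc i = k")
    case True
    then have "c i = w (k - 2)" "c (Suc i mod k) = z" unfolding c_def using k by (auto split: nat.split simp: numeral_2_eq_2)
    moreover have "sh z (w (k - 2))" using w(3) k by simp
    then have "sh (w (k - 2)) z" unfolding sh_def by (metis insert_commute)
    ultimately show ?thesis by simp
  next
    case False
    then have s: "Suc i mod k = Suc i" using i by simp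
    show ?thesis unfolding s c_def using w(3,4) False i by (cases i) auto
  qed
  define X where "X = c ` {..<k}"
  have "card X \<le> k" unfolding X_def using card_image_le[of "{..<k}" c] by simp
  then have "\<exists>u. inj_on u {..<k} \<and> (\<forall>i<k. u i \<in> N (c i) (c (Suc i mod k)) - X)"
  proof (intro greedy_representatives)
    show "finite X" unfolding X_def by simp
    fix i assume "i < k"
    then have "2 * k \<le> card (N (c i) (c (Suc i mod k)))" by (intro N csh)
    then show "k + card X \<le> card (N (c i) (c (Suc i mod k)))" using \<open>card X \<le> k\<close> by simp
  qed
  then obtain u where u: "inj_on u {..<k}" "\<forall>i<k. u i \<in> N (c i) (c (Suc i mod k)) - X" by auto
  show ?thesis
  proof (intro exI[of _ "(\<lambda>i. {c i, c (Suc i mod k), u i}) ` {..<k}"] conjI)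
    show "(\<lambda>i. {c i, c (Suc i mod k), u i}) ` {..<k} \<subseteq> W" using u(2) unfolding N_def by auto
    have "u ` {..<k} \<inter> X = {}" using u(2) by auto
    then have "c ` {..<k} \<inter> u ` {..<k} = {}" unfolding X_def by (simp only: Int_commute)
    then show "linear_cycle_edges k ((\<lambda>i. {c i, c (Suc i mod k), u i}) ` {..<k})"
      unfolding linear_cycle_edges_def using cinj u(1) by blast
  qed
qed

text \<open>With threshold \<open>2 * k\<close>, complete peeling would charge fewer than
  \<open>2 * k\<close> triples to each pair of \<open>P\<close>, which contradicts the size of
  \<open>W\<close>; so a core with codegrees at least \<open>2 * k\<close> survives.\<close>

lemma linear_cycle_of_shadow:
  assumes W: "finite W" "\<And>e. e \<in> W \<Longrightarrow> card e = 3" and P: "finite P" and k: "k \<ge> 3"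
    and sh: "\<And>e f. e \<in> W \<Longrightarrow> f \<subseteq> e \<Longrightarrow> card f = 2 \<Longrightarrow> f \<in> P" and big: "2 * k * card P < card W"
  shows "\<exists>S\<subseteq>W. linear_cycle_edges k S"
proof -
  have d: "real (2 * k) > 0" using k by simp
  from codegree_peeling[OF W(1) d W(2)] show ?thesis
  proof
    assume "\<exists>W'\<subseteq>W. W' \<noteq> {} \<and> (\<forall>f. card f = 2 \<longrightarrow> (\<exists>e\<in>W'. f \<subseteq> e) \<longrightarrow> real (2 * k) \<le> real (sdeg W' f))"
    then obtain W' where W': "W' \<subseteq> W" "W' \<noteq> {}" "\<forall>f. card f = 2 \<longrightarrow> (\<exists>e\<in>W'. f \<subseteq> e) \<longrightarrow> real (2 * k) \<le> real (sdeg W' f)" by auto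
    have "\<exists>S\<subseteq>W'. linear_cycle_edges k S"
    proof (rule linear_cycle_of_codegrees[OF _ _ W'(2) k])
      show "finite W'" using W'(1) W(1) finite_subset by auto
      show "\<And>e. e \<in> W' \<Longrightarrow> card e = 3" using W'(1) W(2) by auto
      show "2 * k \<le> sdeg W' f" if "card f = 2" "\<exists>e\<in>W'. f \<subseteq> e" for f
        using W'(3) that by (metis of_nat_le_iff)
    qed
    then show ?thesis using W'(1) by auto
  next
    assume "\<exists>\<phi>. (\<forall>e\<in>W. \<phi> e \<subseteq> e \<and> card (\<phi> e) = 2) \<and> (\<forall>f. real (card {e\<in>W. \<phi> e = f}) < real (2 * k))"
    then obtain \<phi> where \<phi>: "\<forall>e\<in>W. \<phi> e \<subseteq> e \<and> card (\<phi> e) = 2" "\<forall>f. real (card {e\<in>W. \<phi> e = f}) < real (2 * k)" by auto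
    have "W \<subseteq> (\<Union>f\<in>P. {e\<in>W. \<phi> e = f})" using \<phi>(1) sh by auto
    then have "card W \<le> card (\<Union>f\<in>P. {e\<in>W. \<phi> e = f})" using P W(1) by (intro card_mono) auto
    also have "\<dots> \<le> (\<Sum>f\<in>P. card {e\<in>W. \<phi> e = f})" using P by (rule card_UN_le)
    also have "\<dots> \<le> (\<Sum>f\<in>P. 2 * k)" using \<phi>(2) by (intro sum_mono) (metis less_imp_le of_nat_less_iff)
    finally show ?thesis using big by (simp add: mult.commute)
  qed
qed

text \<open>The factor \<open>q ^ 3\<close> accounts for one triple. A proper part of a cycle spans
  at least \<open>2 * card b + 1\<close> vertices, so each further triple contributes
  \<open>q\<^sup>2 \<le> 1 / T\<close>. The whole cycle spans only \<open>2 * k\<close> vertices,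
  one fewer than this pattern, hence the second condition on \<open>T\<close>.\<close>

lemma sample_subset_weight:
  fixes q T :: real
  assumes q: "0 \<le> q" "q \<le> 1" and T: "T > 0" "T * q ^ 2 \<le> 1" "T ^ (k - 1) * q ^ (2 * k - 3) \<le> 1" and k: "k \<ge> 3"
    and S: "linear_cycle_edges k S" "b \<subseteq> S" "b \<noteq> {}"
  shows "q ^ card (\<Union>b) \<le> q ^ 3 * (1 / T) ^ (card b - 1)"
proof -
  note lc = linear_cycle_card[OF S(1)]
  have cb: "card b \<ge> 1" using S lc(2) k by (metis One_nat_def Suc_leI card_gt_0_iff finite_subset le_trans one_le_numeral)
  show ?thesis
  proof (cases "b = S")
    case True
    have c: "card b = k" "card (\<Union>b) = 2 * k" unfolding True using lc k by auto
    have "q ^ (2 * k - 3) \<le> (1 / T) ^ (k - 1)" using T by (simp add: power_one_over pos_le_divide_eq mult.commute)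
    then have "q ^ 3 * q ^ (2 * k - 3) \<le> q ^ 3 * (1 / T) ^ (k - 1)" using q by (intro mult_left_mono) auto
    moreover have "q ^ 3 * q ^ (2 * k - 3) = q ^ (2 * k)" using k by (simp add: power_add[symmetric])
    ultimately show ?thesis unfolding c by simp
  next
    case False
    then have "2 * card b + 1 \<le> card (\<Union>b)" using lc(3) S k by auto
    then have "q ^ card (\<Union>b) \<le> q ^ (2 * card b + 1)" using q by (intro power_decreasing) auto
    also have "\<dots> = q ^ 3 * (q ^ 2) ^ (card b - 1)"
    proof -
      have "2 * card b + 1 = 3 + 2 * (card b - 1)" using cb by simp
      then show ?thesis by (metis power_add power_mult)
    qed
    also have "\<dots> \<le> q ^ 3 * (1 / T) ^ (card b - 1)"
    proof (intro mult_left_mono power_mono)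
      show "q\<^sup>2 \<le> 1 / T" using T by (simp add: pos_le_divide_eq mult.commute)
    qed (use q in auto)
    finally show ?thesis .
  qed
qed

text \<open>Deletion method: in a random vertex set of density \<open>q\<close>, the triples outnumber the pairs of the shadow and the
  forbidden sets.\<close>

theorem robust_dense:
  fixes T :: real
  assumes A: "finite A" and V: "\<And>e. e \<in> V \<Longrightarrow> e \<subseteq> A \<and> card e = 3" "V \<noteq> {}" and k: "k \<ge> 3"
    and P: "\<And>f. f \<in> P \<Longrightarrow> f \<subseteq> A \<and> card f = 2" "\<And>e f. e \<in> V \<Longrightarrow> f \<subseteq> e \<Longrightarrow> card f = 2 \<Longrightarrow> f \<in> P"
    and s: "6 \<le> s" "s \<le> card A" and q: "q = real s / real (card A)"
    and sP: "16 * real k * real (card P) \<le> q * real (card V)"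
    and T: "T > 0" "T * q ^ 2 \<le> 1" "T ^ (k - 1) * q ^ (2 * k - 3) \<le> 1"
  shows "robust V (cycle_copies k V) T (1 / 8)"
  unfolding robust_def
proof (intro allI impI)
  fix B assume B: "B \<subseteq> Pow V - {{}}" "(\<Sum>b\<in>B. (1 / T) ^ (card b - 1)) \<le> 1 / 8 * real (card V)"
  let ?n = "card A"
  define Us where "Us = {U. U \<subseteq> A \<and> card U = s}"
  have fV: "finite V" using A V by (meson finite_Pow_iff finite_subset PowI subsetI)
  have fP: "finite P" using A P(1) by (meson finite_Pow_iff finite_subset PowI subsetI)
  have fB: "finite B" using B(1) fV by (meson finite_Diff finite_Pow_iff finite_subset)
  have fUs: "finite Us" unfolding Us_def using A by simp
  \<comment> \<open>Only members of \<open>B\<close> inside some linear cycle matter, and only for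
    these is the number of spanned vertices under control.\<close>
  define B1 where "B1 = {b\<in>B. \<exists>S\<in>cycle_copies k V. b \<subseteq> S}"
  have fB1: "finite B1" unfolding B1_def using fB by simp
  have n0: "?n > 0" using s by simp
  have q01: "0 < q" "q \<le> 1" unfolding q using s n0 by auto
  let ?C = "real (?n choose s)"
  have C0: "?C > 0" using s by (simp add: zero_less_binomial_iff)
  have cV: "real (card V) > 0" using fV V(2) by (simp add: card_gt_0_iff)
  have s1: "q ^ 3 / 2 * ?C * real (card V) \<le> (\<Sum>U\<in>Us. real (card {e\<in>V. e \<subseteq> U}))"
  proof -
    have "(\<Sum>e\<in>V. q ^ 3 / 2 * ?C) \<le> (\<Sum>e\<in>V. real (sdeg Us e))"
      unfolding Us_def q by (intro sum_mono sdeg_subsets_ge3) (use A V s in auto)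
    then show ?thesis using sum_sample[OF fV fUs, of "\<lambda>e. e"] by (simp add: mult.commute)
  qed
  have s2: "(\<Sum>U\<in>Us. real (card {f\<in>P. f \<subseteq> U})) \<le> q ^ 2 * ?C * real (card P)"
  proof -
    have "(\<Sum>f\<in>P. real (sdeg Us f)) \<le> (\<Sum>f\<in>P. q ^ 2 * ?C)"
    proof (rule sum_mono)
      fix f assume f: "f \<in> P"
      then show "real (sdeg Us f) \<le> q ^ 2 * ?C" using sdeg_subsets_le[OF A _ s(2), of f] P(1)[OF f] unfolding Us_def q by auto
    qed
    then show ?thesis using sum_sample[OF fP fUs, of "\<lambda>e. e"] by (simp add: mult.commute)
  qed
  have s3: "(\<Sum>U\<in>Us. real (card {b\<in>B1. \<Union>b \<subseteq> U})) \<le> q ^ 3 * ?C * (1 / 8 * real (card V))"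
  proof -
    have "(\<Sum>b\<in>B1. real (sdeg Us (\<Union>b))) \<le> (\<Sum>b\<in>B1. q ^ 3 * ?C * (1 / T) ^ (card b - 1))"
    proof (rule sum_mono)
      fix b assume b: "b \<in> B1"
      then obtain S where S: "linear_cycle_edges k S" "b \<subseteq> S" "b \<noteq> {}" "b \<subseteq> V" using B(1) unfolding B1_def cycle_copies_def by blast
      have "\<Union>b \<subseteq> A" using S(4) V(1) by auto
      then have "real (sdeg Us (\<Union>b)) \<le> q ^ card (\<Union>b) * ?C" unfolding Us_def q by (intro sdeg_subsets_le A s(2))
      also have "\<dots> \<le> q ^ 3 * (1 / T) ^ (card b - 1) * ?C"
        by (intro mult_right_mono sample_subset_weight[OF _ q01(2) T k S(1,2,3)]) (use q01 in auto)
      finally show "real (sdeg Us (\<Union>b)) \<le> q ^ 3 * ?C * (1 / T) ^ (card b - 1)" by (simp add: mult_ac)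
    qed
    also have "\<dots> = q ^ 3 * ?C * (\<Sum>b\<in>B1. (1 / T) ^ (card b - 1))" by (simp add: sum_distrib_left)
    also have "\<dots> \<le> q ^ 3 * ?C * (1 / 8 * real (card V))"
    proof (rule mult_left_mono)
      have "(\<Sum>b\<in>B1. (1 / T) ^ (card b - 1)) \<le> (\<Sum>b\<in>B. (1 / T) ^ (card b - 1))"
        using fB T(1) by (intro sum_mono2) (auto simp: B1_def)
      then show "(\<Sum>b\<in>B1. (1 / T) ^ (card b - 1)) \<le> 1 / 8 * real (card V)" using B(2) by linarith
    qed (use q01 C0 in auto)
    finally show ?thesis using sum_sample[OF fB1 fUs, of "\<lambda>b. \<Union>b"] by simp
  qed
  \<comment> \<open>In units of \<open>q ^ 3 * ?C * card V\<close> the three sums are at least 1/2,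
    at most 1/8 and at most 1/8.\<close>
  have "0 < (\<Sum>U\<in>Us. real (card {e\<in>V. e \<subseteq> U}) - 2 * real k * real (card {f\<in>P. f \<subseteq> U}) - real (card {b\<in>B1. \<Union>b \<subseteq> U}))"
  proof -
    have "2 * real k * (\<Sum>U\<in>Us. real (card {f\<in>P. f \<subseteq> U})) \<le> 2 * real k * (q ^ 2 * ?C * real (card P))"
      using s2 by (intro mult_left_mono) auto
    also have "\<dots> = q ^ 2 * ?C * (16 * real k * real (card P)) / 8" by simp
    also have "\<dots> \<le> q ^ 2 * ?C * (q * real (card V)) / 8"
      using sP q01 C0 by (intro divide_right_mono mult_left_mono) auto
    finally have t2: "2 * real k * (\<Sum>U\<in>Us. real (card {f\<in>P. f \<subseteq> U})) \<le> q ^ 3 * ?C * real (card V) / 8"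
      by (simp add: power3_eq_cube power2_eq_square mult_ac)
    have "q ^ 3 * ?C * real (card V) > 0" using q01 C0 cV by simp
    then show ?thesis unfolding sum_subtractf sum_distrib_left[symmetric] using s1 s3 t2 by (simp add: field_simps)
  qed
  then obtain U where U: "U \<in> Us" "0 < real (card {e\<in>V. e \<subseteq> U}) - 2 * real k * real (card {f\<in>P. f \<subseteq> U}) - real (card {b\<in>B1. \<Union>b \<subseteq> U})"
    by (metis (no_types, lifting) not_le sum_nonpos)
  define BU where "BU = {b\<in>B1. \<Union>b \<subseteq> U}"
  define pick where "pick b = (SOME e. e \<in> b)" for b :: "'a set set"
  have pick: "pick b \<in> b" if "b \<in> BU" for b
  proof -
    have "b \<noteq> {}" using that B(1) unfolding BU_def B1_def by auto
    then show ?thesis unfolding pick_def by (simp add: some_in_eq)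
  qed
  define W where "W = {e\<in>V. e \<subseteq> U} - pick ` BU"
  have fBU: "finite BU" unfolding BU_def using fB1 by simp
  have "card {e\<in>V. e \<subseteq> U} - card (pick ` BU) \<le> card W" unfolding W_def using fBU by (intro diff_card_le_card_Diff) auto
  moreover have "card (pick ` BU) \<le> card BU" using fBU by (rule card_image_le)
  ultimately have "card {e\<in>V. e \<subseteq> U} \<le> card W + card BU" by linarith
  moreover have "real (2 * k * card {f\<in>P. f \<subseteq> U} + card BU) < real (card {e\<in>V. e \<subseteq> U})" using U(2) unfolding BU_def by simp
  then have "2 * k * card {f\<in>P. f \<subseteq> U} + card BU < card {e\<in>V. e \<subseteq> U}" by (simp only: of_nat_less_iff)
  ultimately have big: "2 * k * card {f\<in>P. f \<subseteq> U} < card W" by linarith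
  have "\<exists>S\<subseteq>W. linear_cycle_edges k S"
  proof (rule linear_cycle_of_shadow[OF _ _ _ k _ big])
    show "f \<in> {f\<in>P. f \<subseteq> U}" if "e \<in> W" "f \<subseteq> e" "card f = 2" for e f
      using P(2)[of e f] that unfolding W_def by auto
  qed (use fV V(1) fP in \<open>simp_all add: W_def\<close>)
  then obtain S where S: "S \<subseteq> W" "linear_cycle_edges k S" by auto
  have SV: "S \<in> cycle_copies k V" using S unfolding cycle_copies_def W_def by auto
  moreover have "\<not> b \<subseteq> S" if b: "b \<in> B" for b
  proof
    assume bS: "b \<subseteq> S"
    have "b \<in> B1" unfolding B1_def using b SV bS by simp blast
    moreover have "\<Union>b \<subseteq> U" using S(1) bS unfolding W_def by auto
    ultimately have "b \<in> BU" unfolding BU_def by simp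
    then have "pick b \<in> S" "pick b \<in> pick ` BU" using pick bS by auto
    then show False using S(1) unfolding W_def by auto
  qed
  ultimately show "\<exists>S\<in>cycle_copies k V. \<forall>b\<in>B. \<not> b \<subseteq> S" by auto
qed

section \<open>Triple systems spread over the edges of a graph\<close>

definition graph_cycles :: "nat \<Rightarrow> 'a set set \<Rightarrow> 'a list set" where
  "graph_cycles k G = {xs. length xs = k \<and> distinct xs \<and> (\<forall>i<k. {xs ! i, xs ! (Suc i mod k)} \<in> G)}"

definition cycle_edges :: "nat \<Rightarrow> 'a list \<Rightarrow> 'a set set" where
  "cycle_edges k xs = (\<lambda>i. {xs ! i, xs ! (Suc i mod k)}) ` {..<k}"

lemma graph_cycles_mono: "G \<subseteq> G' \<Longrightarrow> graph_cycles k G \<subseteq> graph_cycles k G'"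
  unfolding graph_cycles_def by auto

lemma cycle_edges_subset: "xs \<in> graph_cycles k G \<Longrightarrow> cycle_edges k xs \<subseteq> G"
  unfolding graph_cycles_def cycle_edges_def by auto

lemma cycle_edges_card:
  assumes xs: "xs \<in> graph_cycles k G" and k: "k \<ge> 3"
  shows "inj_on (\<lambda>i. {xs ! i, xs ! (Suc i mod k)}) {..<k}"
    "card (cycle_edges k xs) = k" "\<Union>(cycle_edges k xs) = set xs" "finite (cycle_edges k xs)"
    "J \<subseteq> cycle_edges k xs \<Longrightarrow> J \<noteq> {} \<Longrightarrow> J \<noteq> cycle_edges k xs \<Longrightarrow> card J + 1 \<le> card (\<Union>J)"
proof -
  have len: "length xs = k" and dis: "distinct xs" using xs unfolding graph_cycles_def by auto
  have nth_inj: "inj_on (\<lambda>i. xs ! i) {..<k}" using dis len by (auto simp: inj_on_def nth_eq_iff_index_eq)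
  show inj: "inj_on (\<lambda>i. {xs ! i, xs ! (Suc i mod k)}) {..<k}"
  proof (rule inj_onI)
    fix i j assume ij: "i \<in> {..<k}" "j \<in> {..<k}" "{xs ! i, xs ! (Suc i mod k)} = {xs ! j, xs ! (Suc j mod k)}"
    have m: "Suc i mod k < k" "Suc j mod k < k" using k by auto
    show "i = j"
    proof (rule ccontr)
      assume ne: "i \<noteq> j"
      then have "xs ! i \<noteq> xs ! j" using nth_inj ij by (auto dest: inj_onD)
      \<comment> \<open>Distinct indices with the same edge would be cyclic successors of each
        other, so \<open>j = j + 2\<close> modulo \<open>k\<close>, which is impossible for
        \<open>k \<ge> 3\<close>.\<close>
      then have "xs ! i = xs ! (Suc j mod k)" "xs ! (Suc i mod k) = xs ! j" using ij(3) by (auto simp: doubleton_eq_iff)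
      then have e: "i = Suc j mod k" "Suc i mod k = j" using nth_inj ij m by (auto dest: inj_onD)
      then have "j = Suc (Suc j mod k) mod k" by simp
      then have "j = Suc (Suc j) mod k" by (simp add: mod_Suc_eq)
      moreover have "j < k" using ij by simp
      ultimately show False using k by (cases "Suc (Suc j) < k") (auto simp: mod_if split: if_splits)
    qed
  qed
  show "card (cycle_edges k xs) = k" "finite (cycle_edges k xs)" unfolding cycle_edges_def using inj by (auto simp: card_image)
  have un: "\<Union>((\<lambda>i. {xs ! i, xs ! (Suc i mod k)}) ` I) = (\<lambda>i. xs ! i) ` (I \<union> (\<lambda>i. Suc i mod k) ` I)" for I by auto
  have all: "{..<k} \<union> (\<lambda>i. Suc i mod k) ` {..<k} = {..<k}" using k by auto
  show "\<Union>(cycle_edges k xs) = set xs" unfolding cycle_edges_def un all using len by (auto simp: set_conv_nth)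
  show "card J + 1 \<le> card (\<Union>J)" if J: "J \<subseteq> cycle_edges k xs" "J \<noteq> {}" "J \<noteq> cycle_edges k xs"
  proof -
    obtain I where I: "I \<subseteq> {..<k}" "J = (\<lambda>i. {xs ! i, xs ! (Suc i mod k)}) ` I"
      using J(1) unfolding cycle_edges_def by (meson subset_imageE)
    have "I \<noteq> {}" "I \<noteq> {..<k}" using J I unfolding cycle_edges_def by auto
    then have c: "Suc (card I) \<le> card (I \<union> (\<lambda>i. Suc i mod k) ` I)" using cyclic_neighbourhood I(1) by blast
    have "I \<union> (\<lambda>i. Suc i mod k) ` I \<subseteq> {..<k}" using I(1) k by auto
    then have "card (\<Union>J) = card (I \<union> (\<lambda>i. Suc i mod k) ` I)"
      unfolding I(2) un using inj_on_subset[OF nth_inj] by (metis card_image)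
    moreover have "card J = card I" unfolding I(2) using inj_on_subset[OF inj I(1)] by (rule card_image)
    ultimately show ?thesis using c by simp
  qed
qed

text \<open>A smallest vertex set that spans at least \<open>x\<close> edges per vertex works:
  removing a vertex of degree below \<open>x\<close> would preserve this density.\<close>

lemma min_degree_subgraph:
  fixes x :: real
  assumes U: "finite U" "U \<noteq> {}" and G: "\<And>e. e \<in> G \<Longrightarrow> e \<subseteq> U \<and> card e = 2" and x: "x > 0"
    and big: "x * real (card U) \<le> real (card G)"
  shows "\<exists>U'\<subseteq>U. U' \<noteq> {} \<and> (\<forall>v\<in>U'. x \<le> real (card {y\<in>U'. {v, y} \<in> G}))"
proof -
  define Q where "Q X \<longleftrightarrow> X \<subseteq> U \<and> X \<noteq> {} \<and> x * real (card X) \<le> real (card {e\<in>G. e \<subseteq> X})" for X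
  have fG: "finite G" using U(1) G by (meson finite_Pow_iff finite_subset PowI subsetI)
  have "{e\<in>G. e \<subseteq> U} = G" using G by auto
  then have "Q U" unfolding Q_def using U(2) big by simp
  then obtain X where X: "Q X" "\<And>Y. Q Y \<Longrightarrow> card X \<le> card Y" using ex_has_least_nat[of Q U card] by blast
  have fX: "finite X" using X(1) U(1) finite_subset unfolding Q_def by auto
  have "x \<le> real (card {y\<in>X. {v, y} \<in> G})" if v: "v \<in> X" for v
  proof -
    have cX: "card (X - {v}) = card X - 1" "card X \<ge> 1" using v fX by (auto simp: Suc_le_eq card_gt_0_iff)
    have sub: "{e\<in>G. e \<subseteq> X} \<subseteq> {e\<in>G. e \<subseteq> X - {v}} \<union> (\<lambda>y. {v, y}) ` {y\<in>X. {v, y} \<in> G}"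
    proof
      fix e assume e: "e \<in> {e\<in>G. e \<subseteq> X}"
      show "e \<in> {e\<in>G. e \<subseteq> X - {v}} \<union> (\<lambda>y. {v, y}) ` {y\<in>X. {v, y} \<in> G}"
      proof (cases "v \<in> e")
        case True
        obtain a b where "e = {a, b}" using e G by (metis (mono_tags, lifting) card_2_iff mem_Collect_eq)
        then obtain y where "e = {v, y}" using True by blast
        then show ?thesis using e by auto
      qed (use e in auto)
    qed
    have "card {e\<in>G. e \<subseteq> X} \<le> card ({e\<in>G. e \<subseteq> X - {v}} \<union> (\<lambda>y. {v, y}) ` {y\<in>X. {v, y} \<in> G})"
      using fG fX by (intro card_mono[OF _ sub]) auto
    also have "\<dots> \<le> card {e\<in>G. e \<subseteq> X - {v}} + card {y\<in>X. {v, y} \<in> G}"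
      by (rule order_trans[OF card_Un_le]) (use fX in \<open>simp add: card_image_le\<close>)
    finally have c: "card {e\<in>G. e \<subseteq> X} \<le> card {e\<in>G. e \<subseteq> X - {v}} + card {y\<in>X. {v, y} \<in> G}" .
    have "real (card {e\<in>G. e \<subseteq> X - {v}}) \<le> x * (real (card X) - 1)"
    proof (cases "X - {v} = {}")
      case True
      have "{e\<in>G. e \<subseteq> X - {v}} = {}" unfolding True using G by fastforce
      then have "card {e\<in>G. e \<subseteq> X - {v}} = 0" by (simp only: card.empty)
      then show ?thesis using x cX by simp
    next
      case False
      have "card (X - {v}) < card X" using cX by simp
      then have "\<not> Q (X - {v})" using X(2) by (meson not_le)
      then have "real (card {e\<in>G. e \<subseteq> X - {v}}) < x * real (card (X - {v}))" using False X(1) unfolding Q_def by auto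
      then show ?thesis using cX by (simp add: of_nat_diff)
    qed
    moreover have "x * real (card X) \<le> real (card {e\<in>G. e \<subseteq> X})" using X(1) unfolding Q_def by simp
    moreover have "real (card {e\<in>G. e \<subseteq> X}) \<le> real (card {e\<in>G. e \<subseteq> X - {v}}) + real (card {y\<in>X. {v, y} \<in> G})"
      using c by (simp only: of_nat_add[symmetric] of_nat_le_iff)
    ultimately show ?thesis by (simp add: algebra_simps)
  qed
  then show ?thesis using X(1) unfolding Q_def by blast
qed

text \<open>The degree threshold increases with the number of vertices, so it is inherited by the
  subgraph of minimum degree \<open>x\<close>.\<close>

lemma graph_cycles_count:
  fixes x :: real
  assumes U: "finite U" "U \<noteq> {}" and G: "\<And>e. e \<in> G \<Longrightarrow> e \<subseteq> U \<and> card e = 2" and x: "x > 0"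
    and big: "x * real (card U) \<le> real (card G)" and l: "l \<ge> 2"
    and xU: "16 * real l ^ 2 * real (card U) powr (1 / l) \<le> x"
  shows "x ^ (2 * l) / 2 \<le> real (card (graph_cycles (2 * l) G))" "finite (graph_cycles (2 * l) G)"
proof -
  obtain U' where U': "U' \<subseteq> U" "U' \<noteq> {}" "\<forall>v\<in>U'. x \<le> real (card {y\<in>U'. {v, y} \<in> G})"
    using min_degree_subgraph[OF U G x big] by blast
  have fU': "finite U'" using U' U finite_subset by auto
  have irr: "{v, v} \<notin> G" for v using G[of "{v,v}"] by auto
  interpret min_degree_graph U' "\<lambda>a b. {a, b} \<in> G" x
    by unfold_locales (use U' fU' x irr in \<open>auto simp: insert_commute\<close>)
  have "real (card U') powr (1 / l) \<le> real (card U) powr (1 / l)"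
    using U'(1) U(1) by (intro powr_mono2) (auto intro: card_mono)
  then have "16 * real l ^ 2 * real (card U') powr (1 / l) \<le> 16 * real l ^ 2 * real (card U) powr (1 / l)"
    by (intro mult_left_mono) auto
  then have "x ^ (2 * l) / 2 \<le> real (card {xs. length xs = 2 * l \<and> distinct xs \<and> set xs \<subseteq> U' \<and>
      (\<forall>i<2*l. {xs ! i, xs ! (Suc i mod (2 * l))} \<in> G)})"
    using xU by (intro cycle_supersaturation l) linarith
  moreover show fin: "finite (graph_cycles (2 * l) G)"
  proof (rule finite_subset[OF _ finite_lists_length_eq[OF U(1), of "2 * l"]])
    show "graph_cycles (2 * l) G \<subseteq> {xs. set xs \<subseteq> U \<and> length xs = 2 * l}"
      unfolding graph_cycles_def using G by (fastforce simp: set_conv_nth)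
  qed
  moreover have "card {xs. length xs = 2 * l \<and> distinct xs \<and> set xs \<subseteq> U' \<and>
      (\<forall>i<2*l. {xs ! i, xs ! (Suc i mod (2 * l))} \<in> G)} \<le> card (graph_cycles (2 * l) G)"
    using fin by (intro card_mono) (auto simp: graph_cycles_def)
  ultimately show "x ^ (2 * l) / 2 \<le> real (card (graph_cycles (2 * l) G))" by linarith
qed

text \<open>Supersaturation counts lists, while forbidden cycles are counted as edge sets; this
  crude bound on the lists per edge set is enough to compare them.\<close>

lemma cycles_per_edge_set:
  assumes J: "card (\<Union>J) \<le> k" "finite (\<Union>J)" and k: "k \<ge> 3"
  shows "card {xs\<in>graph_cycles k G. cycle_edges k xs = J} \<le> k ^ k"
proof -
  have "{xs\<in>graph_cycles k G. cycle_edges k xs = J} \<subseteq> {xs. set xs \<subseteq> \<Union>J \<and> length xs = k}"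
    using cycle_edges_card(3)[OF _ k] unfolding graph_cycles_def by blast
  then have "card {xs\<in>graph_cycles k G. cycle_edges k xs = J} \<le> card {xs. set xs \<subseteq> \<Union>J \<and> length xs = k}"
    by (intro card_mono finite_lists_length_eq J)
  also have "\<dots> = card (\<Union>J) ^ k" using card_lists_length_eq[OF J(2)] .
  also have "\<dots> \<le> k ^ k" using J(1) by (intro power_mono) auto
  finally show ?thesis .
qed

section \<open>Random choice of a triple over each edge\<close>

lemma card_PiE_restrict_le:
  assumes F: "finite F" "\<And>f. f \<in> F \<Longrightarrow> finite (X f)" and J: "J \<subseteq> F"
  shows "card {\<sigma>\<in>PiE F X. R (restrict \<sigma> J)} \<le> card {\<tau>\<in>PiE J X. R \<tau>} * (\<Prod>f\<in>F - J. card (X f))"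
proof -
  have fJ: "finite J" using F(1) J finite_subset by auto
  have fin: "finite (PiE J X)" "finite (PiE (F - J) X)" using F J fJ by (auto intro!: finite_PiE)
  have "card {\<sigma>\<in>PiE F X. R (restrict \<sigma> J)} \<le> card ({\<tau>\<in>PiE J X. R \<tau>} \<times> PiE (F - J) X)"
  proof (rule card_inj_on_le[where f="\<lambda>\<sigma>. (restrict \<sigma> J, restrict \<sigma> (F - J))"])
    show "inj_on (\<lambda>\<sigma>. (restrict \<sigma> J, restrict \<sigma> (F - J))) {\<sigma>\<in>PiE F X. R (restrict \<sigma> J)}"
    proof (rule inj_onI)
      fix \<sigma> \<tau> assume h: "\<sigma> \<in> {\<sigma>\<in>PiE F X. R (restrict \<sigma> J)}" "\<tau> \<in> {\<sigma>\<in>PiE F X. R (restrict \<sigma> J)}"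
        "(restrict \<sigma> J, restrict \<sigma> (F - J)) = (restrict \<tau> J, restrict \<tau> (F - J))"
      show "\<sigma> = \<tau>"
      proof (rule PiE_ext[of _ F X])
        fix f assume "f \<in> F"
        then show "\<sigma> f = \<tau> f" using h(3) J by (cases "f \<in> J") (auto dest!: fun_cong[of _ _ f])
      qed (use h in auto)
    qed
    show "(\<lambda>\<sigma>. (restrict \<sigma> J, restrict \<sigma> (F - J))) ` {\<sigma>\<in>PiE F X. R (restrict \<sigma> J)} \<subseteq> {\<tau>\<in>PiE J X. R \<tau>} \<times> PiE (F - J) X"
    proof (rule image_subsetI)
      fix \<sigma> assume \<sigma>: "\<sigma> \<in> {\<sigma>\<in>PiE F X. R (restrict \<sigma> J)}"
      then have "restrict \<sigma> J \<in> PiE J X" "restrict \<sigma> (F - J) \<in> PiE (F - J) X"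
        using J by (auto intro!: restrict_PiE_iff[THEN iffD2])
      then show "(restrict \<sigma> J, restrict \<sigma> (F - J)) \<in> {\<tau>\<in>PiE J X. R \<tau>} \<times> PiE (F - J) X" using \<sigma> by simp
    qed
    show "finite ({\<tau>\<in>PiE J X. R \<tau>} \<times> PiE (F - J) X)" using fin by auto
  qed
  then show ?thesis using F(1) by (simp add: card_cartesian_product card_PiE)
qed


text \<open>Marginals of the uniform distribution on a product are uniform: the probability of an
  event that depends only on the coordinates in \<open>J\<close> may be bounded on
  \<open>PiE J X\<close>.\<close>

lemma card_PiE_restrict_fraction:
  fixes \<eta> :: real
  assumes F: "finite F" "\<And>f. f \<in> F \<Longrightarrow> finite (X f)" and J: "J \<subseteq> F"
    and R: "real (card {\<tau>\<in>PiE J X. R \<tau>}) \<le> \<eta> * (\<Prod>f\<in>J. real (card (X f)))"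
  shows "real (card {\<sigma>\<in>PiE F X. R (restrict \<sigma> J)}) \<le> \<eta> * (\<Prod>f\<in>F. real (card (X f)))"
proof -
  have "real (card {\<sigma>\<in>PiE F X. R (restrict \<sigma> J)}) \<le> real (card {\<tau>\<in>PiE J X. R \<tau>}) * (\<Prod>f\<in>F - J. real (card (X f)))"
    using card_PiE_restrict_le[OF F J, where R=R] by (simp only: of_nat_prod[symmetric] of_nat_mult[symmetric] of_nat_le_iff)
  also have "\<dots> \<le> \<eta> * (\<Prod>f\<in>J. real (card (X f))) * (\<Prod>f\<in>F - J. real (card (X f)))"
    by (intro mult_right_mono R prod_nonneg) auto
  also have "\<dots> = \<eta> * (\<Prod>f\<in>F. real (card (X f)))" using prod.subset_diff[OF J F(1), of "\<lambda>f. real (card (X f))"] by simp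
  finally show ?thesis .
qed

text \<open>Union bound: among all choices of one triple for each edge of the cycle, at most half contain a forbidden set
  or use the same apex twice.\<close>

lemma expand_cycle:
  fixes \<theta> d :: real
  assumes xs: "xs \<in> graph_cycles k G" and k: "k \<ge> 3"
    and G: "\<And>f. f \<in> G \<Longrightarrow> card f = 2"
    and X: "\<And>f e. f \<in> G \<Longrightarrow> e \<in> X f \<Longrightarrow> f \<subseteq> e \<and> card e = 3"
      "\<And>f. f \<in> G \<Longrightarrow> finite (X f)" "\<And>f. f \<in> G \<Longrightarrow> d \<le> real (card (X f))"
    and d: "8 * real k ^ 2 \<le> d" and \<theta>: "\<theta> = 1 / 2 ^ (k + 2)"
    and B: "\<And>J. J \<subseteq> cycle_edges k xs \<Longrightarrow> J \<noteq> {} \<Longrightarrow>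
        real (card {\<tau>\<in>PiE J X. \<tau> ` J \<in> B}) \<le> \<theta> * (\<Prod>f\<in>J. real (card (X f)))"
      "{} \<notin> B"
  shows "\<exists>S. S \<subseteq> \<Union>(X ` cycle_edges k xs) \<and> linear_cycle_edges k S \<and> (\<forall>b\<in>B. \<not> b \<subseteq> S)"
proof -
  let ?F = "cycle_edges k xs"
  note ce = cycle_edges_card[OF xs k]
  have FG: "?F \<subseteq> G" using cycle_edges_subset[OF xs] .
  have fX: "finite (X f)" if "f \<in> ?F" for f using that FG X(2) by auto
  define N where "N = (\<Prod>f\<in>?F. real (card (X f)))"
  have d0: "d > 0" using d k by (smt (verit) of_nat_0_less_iff zero_less_power zero_less_numeral less_le_trans mult_pos_pos)
  have Xpos: "real (card (X f)) > 0" if "f \<in> ?F" for f using that FG X(3)[of f] d0 by auto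
  have N0: "N > 0" unfolding N_def using Xpos by (intro prod_pos) auto
  define P where "P = PiE ?F X"
  have finP: "finite P" unfolding P_def using ce(4) fX by (intro finite_PiE) auto
  have cP: "real (card P) = N" unfolding P_def N_def using ce(4) by (simp add: card_PiE)
  define apex where "apex f e = (THE x. x \<in> e - f)" for f e :: "'a set"
  have apex: "apex f e \<notin> f" "e = insert (apex f e) f" if "f \<in> G" "e \<in> X f" for f e
  proof -
    have c: "card f = 2" "f \<subseteq> e" "card e = 3" using G X(1) that by auto
    then have "finite f" "finite e" by (auto intro: card_ge_0_finite)
    then have "card (e - f) = 1" using c by (simp add: card_Diff_subset)
    then obtain x where x: "e - f = {x}" by (auto simp: card_1_singleton_iff)
    then have "apex f e = x" unfolding apex_def by simp
    then show "apex f e \<notin> f" "e = insert (apex f e) f" using x c(2) by auto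
  qed
  \<comment> \<open>The three kinds of failure: the triples over \<open>J\<close> form a forbidden
    set, two edges of the cycle get the same apex, an apex lies on the cycle.\<close>
  define Bad1 where "Bad1 J = {\<sigma>\<in>P. (\<lambda>\<tau>. \<tau> ` J \<in> B) (restrict \<sigma> J)}" for J
  define Bad2 where "Bad2 p = {\<sigma>\<in>P. (\<lambda>\<tau>. apex (fst p) (\<tau> (fst p)) = apex (snd p) (\<tau> (snd p))) (restrict \<sigma> {fst p, snd p})}" for p
  define Bad3 where "Bad3 p = {\<sigma>\<in>P. (\<lambda>\<tau>. apex (fst p) (\<tau> (fst p)) = snd p) (restrict \<sigma> {fst p})}" for p
  have b1: "real (card (Bad1 J)) \<le> \<theta> * N" if "J \<subseteq> ?F" "J \<noteq> {}" for J
    unfolding Bad1_def P_def N_def by (rule card_PiE_restrict_fraction[OF ce(4) fX that(1) B(1)[OF that]])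
  have fix_apex: "card {e\<in>X f. apex f e = y} \<le> 1" if "f \<in> ?F" for f y
  proof -
    have "{e\<in>X f. apex f e = y} \<subseteq> {insert y f}" using apex(2) that FG by auto
    then show ?thesis using card_mono[of "{insert y f}"] by simp
  qed
  have b3: "real (card (Bad3 p)) \<le> (1 / d) * N" if p: "fst p \<in> ?F" for p
    unfolding Bad3_def P_def N_def
  proof (rule card_PiE_restrict_fraction[OF ce(4) fX])
    show "{fst p} \<subseteq> ?F" using p by simp
    have "card {\<tau>\<in>PiE {fst p} X. apex (fst p) (\<tau> (fst p)) = snd p} \<le> card {e\<in>X (fst p). apex (fst p) e = snd p}"
    proof (rule card_inj_on_le[where f="\<lambda>\<tau>. \<tau> (fst p)"])
      show "inj_on (\<lambda>\<tau>. \<tau> (fst p)) {\<tau>\<in>PiE {fst p} X. apex (fst p) (\<tau> (fst p)) = snd p}"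
      proof (rule inj_onI)
        fix \<sigma> \<tau> assume "\<sigma> \<in> {\<tau>\<in>PiE {fst p} X. apex (fst p) (\<tau> (fst p)) = snd p}"
          "\<tau> \<in> {\<tau>\<in>PiE {fst p} X. apex (fst p) (\<tau> (fst p)) = snd p}" "\<sigma> (fst p) = \<tau> (fst p)"
        then show "\<sigma> = \<tau>" by (intro PiE_ext[of \<sigma> "{fst p}" X]) auto
      qed
    qed (use fX[OF p] in auto)
    then have "real (card {\<tau>\<in>PiE {fst p} X. apex (fst p) (\<tau> (fst p)) = snd p}) \<le> 1" using fix_apex[OF p, of "snd p"] by linarith
    also have "\<dots> \<le> (1 / d) * (\<Prod>f\<in>{fst p}. real (card (X f)))" using X(3)[of "fst p"] p FG d0 by (auto simp: field_simps)
    finally show "real (card {\<tau>\<in>PiE {fst p} X. apex (fst p) (\<tau> (fst p)) = snd p}) \<le> (1 / d) * (\<Prod>f\<in>{fst p}. real (card (X f)))" .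
  qed
  have b2: "real (card (Bad2 p)) \<le> (1 / d) * N" if p: "fst p \<in> ?F" "snd p \<in> ?F" "fst p \<noteq> snd p" for p
    unfolding Bad2_def P_def N_def
  proof (rule card_PiE_restrict_fraction[OF ce(4) fX])
    let ?f = "fst p" and ?g = "snd p"
    show "{?f, ?g} \<subseteq> ?F" using p by simp
    have "card {\<tau>\<in>PiE {?f, ?g} X. apex ?f (\<tau> ?f) = apex ?g (\<tau> ?g)} \<le> card (X ?f)"
    proof (rule card_inj_on_le[where f="\<lambda>\<tau>. \<tau> ?f"])
      show "inj_on (\<lambda>\<tau>. \<tau> ?f) {\<tau>\<in>PiE {?f, ?g} X. apex ?f (\<tau> ?f) = apex ?g (\<tau> ?g)}"
      proof (rule inj_onI)
        fix \<sigma> \<tau> assume h: "\<sigma> \<in> {\<tau>\<in>PiE {?f, ?g} X. apex ?f (\<tau> ?f) = apex ?g (\<tau> ?g)}"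
          "\<tau> \<in> {\<tau>\<in>PiE {?f, ?g} X. apex ?f (\<tau> ?f) = apex ?g (\<tau> ?g)}" "\<sigma> ?f = \<tau> ?f"
        have m: "\<sigma> ?g \<in> X ?g" "\<tau> ?g \<in> X ?g" using h(1,2) by (auto dest: PiE_mem)
        have "apex ?g (\<sigma> ?g) = apex ?g (\<tau> ?g)" using h by auto
        then have "\<sigma> ?g = \<tau> ?g" using apex(2)[of ?g] m p FG by (metis subsetD)
        then show "\<sigma> = \<tau>" using h by (intro PiE_ext[of \<sigma> "{?f, ?g}" X]) auto
      qed
    qed (use fX[OF p(1)] in auto)
    then have "real (card {\<tau>\<in>PiE {?f, ?g} X. apex ?f (\<tau> ?f) = apex ?g (\<tau> ?g)}) \<le> real (card (X ?f)) * 1" by simp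
    also have "\<dots> \<le> real (card (X ?f)) * (real (card (X ?g)) / d)"
      using X(3)[of ?g] p FG d0 by (intro mult_left_mono) (auto simp: field_simps)
    also have "\<dots> = (1 / d) * (\<Prod>f\<in>{?f, ?g}. real (card (X f)))" using p(3) by simp
    finally show "real (card {\<tau>\<in>PiE {?f, ?g} X. apex ?f (\<tau> ?f) = apex ?g (\<tau> ?g)}) \<le> (1 / d) * (\<Prod>f\<in>{?f, ?g}. real (card (X f)))" .
  qed
  define I1 where "I1 = Pow ?F - {{}}"
  define I2 where "I2 = {p\<in>?F \<times> ?F. fst p \<noteq> snd p}"
  define I3 where "I3 = ?F \<times> set xs"
  have fI: "finite I1" "finite I2" "finite I3" unfolding I1_def I2_def I3_def using ce(4) by auto
  have c1: "real (card I1) \<le> 2 ^ k"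
  proof -
    have "card I1 \<le> card (Pow ?F)" unfolding I1_def using ce(4) by (intro card_mono) auto
    then show ?thesis using ce(2,4) by (simp add: card_Pow)
  qed
  have c2: "real (card I2) \<le> real k ^ 2"
  proof -
    have "card I2 \<le> card (?F \<times> ?F)" unfolding I2_def using ce(4) by (intro card_mono) auto
    then show ?thesis using ce(2) by (simp add: card_cartesian_product power2_eq_square flip: of_nat_mult)
  qed
  have c3: "real (card I3) = real k ^ 2"
    unfolding I3_def using ce(2) xs by (simp add: card_cartesian_product distinct_card graph_cycles_def power2_eq_square)
  have fin: "finite (Bad1 J)" "finite (Bad2 p)" "finite (Bad3 p')" for J p p'
    unfolding Bad1_def Bad2_def Bad3_def using finP by auto
  let ?BAD = "(\<Union>J\<in>I1. Bad1 J) \<union> ((\<Union>p\<in>I2. Bad2 p) \<union> (\<Union>p\<in>I3. Bad3 p))"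
  have "card ?BAD \<le> (\<Sum>J\<in>I1. card (Bad1 J)) + ((\<Sum>p\<in>I2. card (Bad2 p)) + (\<Sum>p\<in>I3. card (Bad3 p)))"
    by (intro order_trans[OF card_Un_le] add_mono card_UN_le fI)
  then have "real (card ?BAD) \<le> (\<Sum>J\<in>I1. real (card (Bad1 J))) + ((\<Sum>p\<in>I2. real (card (Bad2 p))) + (\<Sum>p\<in>I3. real (card (Bad3 p))))"
    by (simp only: of_nat_sum[symmetric] of_nat_add[symmetric] of_nat_le_iff)
  also have "\<dots> \<le> (\<Sum>J\<in>I1. \<theta> * N) + ((\<Sum>p\<in>I2. (1 / d) * N) + (\<Sum>p\<in>I3. (1 / d) * N))"
    by (intro add_mono sum_mono b1 b2 b3) (auto simp: I1_def I2_def I3_def)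
  also have "\<dots> = real (card I1) * \<theta> * N + (real (card I2) + real (card I3)) * ((1 / d) * N)" by (simp add: algebra_simps)
  also have "\<dots> \<le> 2 ^ k * \<theta> * N + (real k ^ 2 + real k ^ 2) * ((1 / d) * N)"
    using c1 c2 c3 N0 d0 \<theta> by (intro add_mono mult_right_mono) auto
  \<comment> \<open>There are at most \<open>2 ^ k\<close> sets \<open>J\<close>, each failing with
    probability at most \<open>\<theta>\<close>, and at most \<open>2 * k\<^sup>2\<close>
    coincidences, each with probability at most
    \<open>1 / d \<le> 1 / (8 * k\<^sup>2)\<close>.\<close>
  also have "\<dots> \<le> 1 / 4 * N + 1 / 4 * N"
  proof (rule add_mono)
    show "2 ^ k * \<theta> * N \<le> 1 / 4 * N" unfolding \<theta> by simp
    have "(real k ^ 2 + real k ^ 2) * (1 / d) \<le> 1 / 4" using d d0 by (simp add: field_simps)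
    then have "(real k ^ 2 + real k ^ 2) * (1 / d) * N \<le> 1 / 4 * N" using N0 by (intro mult_right_mono) auto
    then show "(real k ^ 2 + real k ^ 2) * ((1 / d) * N) \<le> 1 / 4 * N" by (simp only: mult.assoc)
  qed
  also have "\<dots> < N" using N0 by simp
  finally have "card ?BAD < card P" using cP by simp
  then have "\<not> P \<subseteq> ?BAD" using fin fI by (meson card_mono finite_UN_I finite_UnI not_le)
  then obtain \<sigma> where \<sigma>: "\<sigma> \<in> P" "\<sigma> \<notin> ?BAD" by blast
  have \<sigma>1: "\<sigma> ` J \<notin> B" if "J \<subseteq> ?F" "J \<noteq> {}" for J
  proof -
    have "\<sigma> \<notin> Bad1 J" using \<sigma>(2) that unfolding I1_def by auto
    then show ?thesis using \<sigma>(1) unfolding Bad1_def by simp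
  qed
  have \<sigma>2: "apex f (\<sigma> f) \<noteq> apex g (\<sigma> g)" if "f \<in> ?F" "g \<in> ?F" "f \<noteq> g" for f g
  proof -
    have "\<sigma> \<notin> Bad2 (f, g)" using \<sigma>(2) that unfolding I2_def by auto
    then show ?thesis using \<sigma>(1) unfolding Bad2_def by simp
  qed
  have \<sigma>3: "apex f (\<sigma> f) \<notin> set xs" if "f \<in> ?F" for f
  proof
    assume a: "apex f (\<sigma> f) \<in> set xs"
    then have "\<sigma> \<notin> Bad3 (f, apex f (\<sigma> f))" using \<sigma>(2) that unfolding I3_def by auto
    then show False using \<sigma>(1) unfolding Bad3_def by simp
  qed
  have \<sigma>X: "\<sigma> f \<in> X f" if "f \<in> ?F" for f using \<sigma>(1) that unfolding P_def by (rule PiE_mem)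
  define w where "w i = xs ! i" for i
  define f where "f i = {xs ! i, xs ! (Suc i mod k)}" for i
  define u where "u i = apex (f i) (\<sigma> (f i))" for i
  have fF: "f i \<in> ?F" if "i < k" for i using that unfolding f_def cycle_edges_def by auto
  have finj: "inj_on f {..<k}" using ce(1) unfolding f_def .
  have Feq: "?F = f ` {..<k}" unfolding f_def cycle_edges_def by simp
  have len: "length xs = k" "distinct xs" using xs unfolding graph_cycles_def by auto
  have "linear_cycle_edges k (\<sigma> ` ?F)"
    unfolding linear_cycle_edges_def
  proof (rule exI[of _ w], rule exI[of _ u], intro conjI)
    show "inj_on w {..<k}" using len by (auto simp: inj_on_def w_def nth_eq_iff_index_eq)
    show "inj_on u {..<k}"
    proof (rule inj_onI)
      fix i j assume ij: "i \<in> {..<k}" "j \<in> {..<k}" "u i = u j"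
      then have "f i = f j" using \<sigma>2[of "f i" "f j"] fF unfolding u_def by auto
      then show "i = j" using finj ij by (auto dest: inj_onD)
    qed
    have "w ` {..<k} \<subseteq> set xs" unfolding w_def using len by auto
    moreover have "u i \<notin> set xs" if "i < k" for i unfolding u_def by (intro \<sigma>3 fF that)
    ultimately show "w ` {..<k} \<inter> u ` {..<k} = {}" by auto
    have "\<sigma> (f i) = {w i, w (Suc i mod k), u i}" if "i < k" for i
      using apex(2)[OF _ \<sigma>X[OF fF[OF that]]] fF[OF that] FG unfolding u_def w_def f_def by auto
    then show "\<sigma> ` ?F = (\<lambda>i. {w i, w (Suc i mod k), u i}) ` {..<k}" unfolding Feq image_image by auto
  qed
  moreover have "\<sigma> ` ?F \<subseteq> \<Union>(X ` ?F)" using \<sigma>X by auto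
  moreover have "\<not> b \<subseteq> \<sigma> ` ?F" if b: "b \<in> B" for b
  proof
    assume "b \<subseteq> \<sigma> ` ?F"
    then obtain J where J: "J \<subseteq> ?F" "b = \<sigma> ` J" by (meson subset_imageE)
    moreover have "J \<noteq> {}" using J b B(2) by auto
    ultimately show False using \<sigma>1 b by auto
  qed
  ultimately show ?thesis by blast
qed

lemma robust_mono_eps: "robust V H T \<epsilon> \<Longrightarrow> \<epsilon>' \<le> \<epsilon> \<Longrightarrow> robust V H T \<epsilon>'"
  unfolding robust_def by (meson mult_right_mono of_nat_0_le_iff order_trans)

text \<open>A set \<open>J\<close> of graph edges counts as bad if more than a \<open>\<theta>\<close>-fraction of the ways to extend its edges to
  triples is forbidden.\<close>

lemma bad_projection_weight:
  fixes T d \<theta> W :: real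
  assumes fG: "finite G" and X: "\<And>f. f \<in> G \<Longrightarrow> finite (X f)" "\<And>f. f \<in> G \<Longrightarrow> d \<le> real (card (X f))"
    "\<And>f g. f \<in> G \<Longrightarrow> g \<in> G \<Longrightarrow> f \<noteq> g \<Longrightarrow> X f \<inter> X g = {}"
    and T: "T > 0" and d: "d > 0" and \<theta>: "\<theta> > 0"
    and B: "finite B" "(\<Sum>b\<in>B. (1 / T) ^ (card b - 1)) \<le> W"
    and Bad: "\<And>J. J \<in> Bad \<Longrightarrow> J \<subseteq> G \<and> J \<noteq> {} \<and> \<theta> * (\<Prod>f\<in>J. real (card (X f))) < real (card {\<tau>\<in>PiE J X. \<tau> ` J \<in> B})"
  shows "\<theta> * d * (\<Sum>J\<in>Bad. (d / T) ^ (card J - 1)) \<le> W"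
proof -
  have fBad: "finite Bad" using fG Bad by (meson finite_Pow_iff finite_subset PowI subsetI)
  have Xne: "X f \<noteq> {}" if "f \<in> G" for f using X(2)[OF that] d by auto
  define Sel where "Sel J = (\<lambda>\<tau>. \<tau> ` J) ` {\<tau>\<in>PiE J X. \<tau> ` J \<in> B}" for J
  have Sel_B: "Sel J \<subseteq> B" for J unfolding Sel_def by auto
  have inj_tau: "inj_on \<tau> J" if "\<tau> \<in> PiE J X" "J \<subseteq> G" for \<tau> J
  proof (rule inj_onI)
    fix f g assume h: "f \<in> J" "g \<in> J" "\<tau> f = \<tau> g"
    then have "\<tau> f \<in> X f \<inter> X g" using that by (auto dest: PiE_mem)
    then show "f = g" using X(3) h that by blast
  qed
  have Sel_card: "card b = card J" if "b \<in> Sel J" "J \<subseteq> G" for b J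
    using that inj_tau unfolding Sel_def by (auto simp: card_image)
  \<comment> \<open>The fibres are disjoint, so a forbidden set determines the edges over which it
    lies. Hence different \<open>J\<close> use different members of \<open>B\<close>, and no weight
    is counted twice.\<close>
  have Sel_rec: "J = {f\<in>G. b \<inter> X f \<noteq> {}}" if bJ: "b \<in> Sel J" "J \<subseteq> G" for b J
  proof -
    obtain \<tau> where \<tau>: "\<tau> \<in> PiE J X" "b = \<tau> ` J" using bJ(1) unfolding Sel_def by auto
    have m: "\<tau> f \<in> X f" if "f \<in> J" for f using \<tau>(1) that by (rule PiE_mem)
    show ?thesis
    proof (intro equalityI subsetI)
      fix f assume "f \<in> J"
      then show "f \<in> {f\<in>G. b \<inter> X f \<noteq> {}}" using m \<tau>(2) bJ(2) by blast
    next
      fix f assume "f \<in> {f\<in>G. b \<inter> X f \<noteq> {}}"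
      then obtain g where g: "f \<in> G" "g \<in> J" "\<tau> g \<in> X f" using \<tau>(2) by auto
      then have "\<tau> g \<in> X f \<inter> X g" using m by auto
      then have "f = g" using X(3)[of f g] g bJ(2) by blast
      then show "f \<in> J" using g by simp
    qed
  qed
  have inj_Sel: "inj_on (\<lambda>\<tau>. \<tau> ` J) {\<tau>\<in>PiE J X. \<tau> ` J \<in> B}" if J: "J \<subseteq> G" for J
  proof (rule inj_onI)
    fix \<sigma> \<tau> assume h: "\<sigma> \<in> {\<tau>\<in>PiE J X. \<tau> ` J \<in> B}" "\<tau> \<in> {\<tau>\<in>PiE J X. \<tau> ` J \<in> B}" "\<sigma> ` J = \<tau> ` J"
    show "\<sigma> = \<tau>"
    proof (rule PiE_ext[of _ J X])
      fix f assume f: "f \<in> J"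
      then have "\<sigma> f \<in> \<tau> ` J" using h(3) by blast
      then obtain g where g: "g \<in> J" "\<sigma> f = \<tau> g" by auto
      have "\<sigma> f \<in> X f" "\<tau> g \<in> X g" using h f g by (auto dest: PiE_mem)
      then have "f = g" using X(3)[of f g] f g J by (metis IntI empty_iff subsetD)
      then show "\<sigma> f = \<tau> f" using g by simp
    qed (use h in auto)
  qed
  \<comment> \<open>A bad \<open>J\<close> accounts for at least
    \<open>\<theta> * d ^ card J\<close> forbidden sets of its own size, so \<open>d / T\<close>
    takes over the role of \<open>1 / T\<close> for sets of graph edges.\<close>
  have main: "\<theta> * d * (d / T) ^ (card J - 1) \<le> (\<Sum>b\<in>Sel J. (1 / T) ^ (card b - 1))" if J: "J \<in> Bad" for J
  proof -
    have JG: "J \<subseteq> G" "J \<noteq> {}" using Bad[OF J] by auto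
    then have fJ: "finite J" using fG finite_subset by auto
    have cJ: "card J \<ge> 1" using fJ JG by (simp add: Suc_le_eq card_gt_0_iff)
    have "d ^ card J \<le> (\<Prod>f\<in>J. real (card (X f)))"
    proof -
      have "(\<Prod>f\<in>J. d) \<le> (\<Prod>f\<in>J. real (card (X f)))" using d X(2) JG by (intro prod_mono) auto
      then show ?thesis by simp
    qed
    then have "\<theta> * d ^ card J \<le> \<theta> * (\<Prod>f\<in>J. real (card (X f)))" using \<theta> by (intro mult_left_mono) auto
    also have "\<dots> \<le> real (card (Sel J))" using Bad[OF J] card_image[OF inj_Sel[OF JG(1)]] unfolding Sel_def by simp
    finally have "\<theta> * d ^ card J * (1 / T) ^ (card J - 1) \<le> real (card (Sel J)) * (1 / T) ^ (card J - 1)"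
      using T by (intro mult_right_mono) auto
    also have "\<dots> = (\<Sum>b\<in>Sel J. (1 / T) ^ (card b - 1))" using Sel_card[OF _ JG(1)] by simp
    also have "\<theta> * d ^ card J * (1 / T) ^ (card J - 1) = \<theta> * d * (d / T) ^ (card J - 1)"
    proof -
      have "d ^ card J = d * d ^ (card J - 1)" using cJ by (metis Suc_diff_1 less_eq_Suc_le One_nat_def power_Suc)
      then show ?thesis by (simp add: power_divide)
    qed
    finally show ?thesis .
  qed
  have "\<theta> * d * (\<Sum>J\<in>Bad. (d / T) ^ (card J - 1)) \<le> (\<Sum>J\<in>Bad. \<Sum>b\<in>Sel J. (1 / T) ^ (card b - 1))"
    unfolding sum_distrib_left by (intro sum_mono main)
  also have "\<dots> = (\<Sum>b\<in>(\<Union>J\<in>Bad. Sel J). (1 / T) ^ (card b - 1))"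
  proof (rule sum.UNION_disjoint[symmetric])
    show "\<forall>J\<in>Bad. finite (Sel J)" using Sel_B B(1) finite_subset by blast
    show "\<forall>I\<in>Bad. \<forall>J\<in>Bad. I \<noteq> J \<longrightarrow> Sel I \<inter> Sel J = {}"
    proof (intro ballI impI)
      fix I J assume IJ: "I \<in> Bad" "J \<in> Bad" "I \<noteq> J"
      show "Sel I \<inter> Sel J = {}"
      proof (rule ccontr)
        assume "Sel I \<inter> Sel J \<noteq> {}"
        then obtain b where "b \<in> Sel I" "b \<in> Sel J" by auto
        then show False using Sel_rec[of b I] Sel_rec[of b J] Bad IJ by metis
      qed
    qed
  qed (rule fBad)
  also have "\<dots> \<le> (\<Sum>b\<in>B. (1 / T) ^ (card b - 1))" using B(1) T Sel_B by (intro sum_mono2) auto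
  finally show ?thesis using B(2) by linarith
qed

text \<open>Cheap sets of fewer than \<open>k\<close> edges are destroyed by deleting an edge of each in a random set of \<open>s\<close> vertices;
  those of \<open>k\<close> edges are whole cycles and are merely outnumbered, which is why supersaturation is needed here.\<close>

theorem robust_sparse:
  fixes T d q \<theta> :: real and l :: nat
  defines "k \<equiv> 2 * l"
  assumes A: "finite A" and G: "\<And>f. f \<in> G \<Longrightarrow> f \<subseteq> A \<and> card f = 2" "G \<noteq> {}" and l: "l \<ge> 2"
    and X: "\<And>f e. f \<in> G \<Longrightarrow> e \<in> X f \<Longrightarrow> f \<subseteq> e \<and> card e = 3"
      "\<And>f. f \<in> G \<Longrightarrow> finite (X f)" "\<And>f. f \<in> G \<Longrightarrow> d \<le> real (card (X f)) \<and> real (card (X f)) \<le> 2 * d"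
      "\<And>f g. f \<in> G \<Longrightarrow> g \<in> G \<Longrightarrow> f \<noteq> g \<Longrightarrow> X f \<inter> X g = {}"
    and d: "8 * real k ^ 2 \<le> d" and \<theta>: "\<theta> = 1 / 2 ^ (k + 2)" and T: "T > 0"
    and s: "2 \<le> s" "s \<le> card A" and q: "q = real s / real (card A)"
    and c1: "64 * real l ^ 2 * (real s * real s powr (1 / l)) \<le> q ^ 2 * real (card G)"
    and c2: "q * T \<le> d"
    and c3: "4 * real k ^ k * q ^ (k - 2) * (T / d) ^ (k - 1) \<le> real s powr (1 - 1 / l)"
  shows "robust (\<Union>(X ` G)) (cycle_copies k (\<Union>(X ` G))) T (\<theta> / 32)"
  unfolding robust_def
proof (intro allI impI)
  let ?V = "\<Union>(X ` G)"
  fix B assume B: "B \<subseteq> Pow ?V - {{}}" "(\<Sum>b\<in>B. (1 / T) ^ (card b - 1)) \<le> \<theta> / 32 * real (card ?V)"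
  let ?n = "card A"
  have k: "k \<ge> 4" "k \<ge> 3" unfolding k_def using l by auto
  have fG: "finite G" using A G(1) by (meson finite_Pow_iff finite_subset PowI subsetI)
  have fV: "finite ?V" using fG X(2) by auto
  have fB: "finite B" using B(1) fV by (meson finite_Diff finite_Pow_iff finite_subset)
  have d0: "d > 0" using d k by (smt (verit) of_nat_0_less_iff zero_less_power zero_less_numeral less_le_trans mult_pos_pos)
  have \<theta>0: "\<theta> > 0" unfolding \<theta> by simp
  have n0: "?n > 0" using s by simp
  have q01: "0 < q" "q \<le> 1" unfolding q using s n0 by auto
  have m0: "real (card G) > 0" using fG G(2) by (simp add: card_gt_0_iff)
  define m where "m = real (card G)"
  have cV: "real (card ?V) \<le> 2 * d * m"
  proof -
    have "card ?V \<le> (\<Sum>f\<in>G. card (X f))" using fG by (rule card_UN_le)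
    then have "real (card ?V) \<le> (\<Sum>f\<in>G. real (card (X f)))" by (simp only: of_nat_sum[symmetric] of_nat_le_iff)
    also have "\<dots> \<le> (\<Sum>f\<in>G. 2 * d)" using X(3) by (intro sum_mono) auto
    finally show ?thesis unfolding m_def by (simp add: mult.commute)
  qed
  define Bad where "Bad = {J. J \<noteq> {} \<and> (\<exists>xs\<in>graph_cycles k G. J \<subseteq> cycle_edges k xs) \<and>
      \<theta> * (\<Prod>f\<in>J. real (card (X f))) < real (card {\<tau>\<in>PiE J X. \<tau> ` J \<in> B})}"
  have BadG: "J \<subseteq> G" if "J \<in> Bad" for J using that cycle_edges_subset unfolding Bad_def by blast
  have fBad: "finite Bad" using fG BadG by (meson finite_Pow_iff finite_subset PowI subsetI)
  have weight: "(\<Sum>J\<in>Bad. (d / T) ^ (card J - 1)) \<le> m / 16"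
  proof -
    have "\<theta> * d * (\<Sum>J\<in>Bad. (d / T) ^ (card J - 1)) \<le> \<theta> / 32 * real (card ?V)"
      by (rule bad_projection_weight[OF fG X(2) _ X(4) T d0 \<theta>0 fB B(2)]) (use BadG X(3) in \<open>auto simp: Bad_def\<close>)
    also have "\<dots> \<le> \<theta> / 32 * (2 * d * m)" using cV \<theta>0 by (intro mult_left_mono) auto
    also have "\<dots> = \<theta> * d * (m / 16)" by simp
    finally show ?thesis using \<theta>0 d0 by (simp add: mult_le_cancel_left_pos)
  qed
  define Bs where "Bs = {J\<in>Bad. card J < k}"
  define Bf where "Bf = {J\<in>Bad. card J = k}"
  have cardBad: "card J \<le> k" "card J \<ge> 1" if "J \<in> Bad" for J
  proof -
    obtain xs where xs: "xs \<in> graph_cycles k G" "J \<subseteq> cycle_edges k xs" using \<open>J \<in> Bad\<close> unfolding Bad_def by auto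
    show "card J \<le> k" using card_mono[OF cycle_edges_card(4)[OF xs(1) k(2)] xs(2)] cycle_edges_card(2)[OF xs(1) k(2)] by simp
    have "J \<noteq> {}" "finite J" using that finite_subset[OF xs(2) cycle_edges_card(4)[OF xs(1) k(2)]] unfolding Bad_def by auto
    then show "card J \<ge> 1" by (simp add: Suc_le_eq card_gt_0_iff)
  qed
  have Bs_un: "card J + 1 \<le> card (\<Union>J)" if J: "J \<in> Bs" for J
  proof -
    obtain xs where xs: "xs \<in> graph_cycles k G" "J \<subseteq> cycle_edges k xs" "J \<noteq> {}" using J unfolding Bs_def Bad_def by auto
    moreover have "J \<noteq> cycle_edges k xs" using that cycle_edges_card(2)[OF xs(1) k(2)] unfolding Bs_def by auto
    ultimately show ?thesis using cycle_edges_card(5)[OF xs(1) k(2)] by blast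
  qed
  have Bf_un: "card (\<Union>J) = k" if J: "J \<in> Bf" for J
  proof -
    obtain xs where xs: "xs \<in> graph_cycles k G" "J \<subseteq> cycle_edges k xs" "J \<noteq> {}" using J unfolding Bf_def Bad_def by auto
    note ce = cycle_edges_card[OF xs(1) k(2)]
    have "J = cycle_edges k xs" using that xs(2) ce(2,4) unfolding Bf_def by (metis (mono_tags, lifting) card_subset_eq mem_Collect_eq)
    then show ?thesis using ce(3) xs(1) unfolding graph_cycles_def by (simp add: distinct_card)
  qed
  have unA: "\<Union>J \<subseteq> A" if "J \<in> Bad" for J using BadG[OF that] G(1) by auto
  define Us where "Us = {U. U \<subseteq> A \<and> card U = s}"
  have fUs: "finite Us" unfolding Us_def using A by simp
  let ?C = "real (?n choose s)"
  have C0: "?C > 0" using s by (simp add: zero_less_binomial_iff)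
  have qd: "q \<le> d / T" using c2 T by (simp add: pos_le_divide_eq)
  have s1: "q ^ 2 / 2 * ?C * m \<le> (\<Sum>U\<in>Us. real (card {f\<in>G. f \<subseteq> U}))"
  proof -
    have "(\<Sum>f\<in>G. q ^ 2 / 2 * ?C) \<le> (\<Sum>f\<in>G. real (sdeg Us f))"
      unfolding Us_def q by (intro sum_mono sdeg_subsets_ge2) (use A G s in auto)
    then show ?thesis using sum_sample[OF fG fUs, of "\<lambda>e. e"] unfolding m_def by (simp add: mult.commute)
  qed
  have s2: "(\<Sum>U\<in>Us. real (card {J\<in>Bs. \<Union>J \<subseteq> U})) \<le> q ^ 2 * ?C * (m / 16)"
  proof -
    have "(\<Sum>J\<in>Bs. real (sdeg Us (\<Union>J))) \<le> (\<Sum>J\<in>Bs. q ^ 2 * ?C * (d / T) ^ (card J - 1))"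
    proof (rule sum_mono)
      fix J assume J: "J \<in> Bs"
      then have JB: "J \<in> Bad" unfolding Bs_def by simp
      have "real (sdeg Us (\<Union>J)) \<le> q ^ card (\<Union>J) * ?C" unfolding Us_def q by (intro sdeg_subsets_le A s(2) unA JB)
      also have "\<dots> \<le> q ^ (2 + (card J - 1)) * ?C"
        using Bs_un[OF J] cardBad(2)[OF JB] q01 by (intro mult_right_mono power_decreasing) auto
      also have "\<dots> = q ^ 2 * ?C * q ^ (card J - 1)" by (simp add: power_add power2_eq_square)
      also have "\<dots> \<le> q ^ 2 * ?C * (d / T) ^ (card J - 1)" using q01 qd by (intro mult_left_mono power_mono) auto
      finally show "real (sdeg Us (\<Union>J)) \<le> q ^ 2 * ?C * (d / T) ^ (card J - 1)" .
    qed
    also have "\<dots> = q ^ 2 * ?C * (\<Sum>J\<in>Bs. (d / T) ^ (card J - 1))" by (simp add: sum_distrib_left)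
    also have "\<dots> \<le> q ^ 2 * ?C * (m / 16)"
    proof (rule mult_left_mono)
      have "(\<Sum>J\<in>Bs. (d / T) ^ (card J - 1)) \<le> (\<Sum>J\<in>Bad. (d / T) ^ (card J - 1))"
        using fBad T d0 by (intro sum_mono2) (auto simp: Bs_def)
      then show "(\<Sum>J\<in>Bs. (d / T) ^ (card J - 1)) \<le> m / 16" using weight by linarith
    qed (use q01 C0 in auto)
    finally show ?thesis using sum_sample[of Bs Us Union] fBad fUs unfolding Bs_def by simp
  qed
  \<comment> \<open>\<open>\<mu>\<close> is the price of a forbidden whole cycle. Supersaturation
    turns \<open>m'\<close> edges on \<open>s\<close> vertices into at least
    \<open>m' * s powr (1 - 1 / l) / 2\<close> lists, and a forbidden cycle has at most
    \<open>k ^ k\<close> lists; so more than \<open>\<mu> * z\<close> edges leave an allowed cycle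
    when \<open>z\<close> whole cycles are forbidden.\<close>
  define \<mu> where "\<mu> = 4 * real k ^ k / real s powr (1 - 1 / l)"
  have \<mu>0: "\<mu> > 0" unfolding \<mu>_def using k s by simp
  have s3: "\<mu> * (\<Sum>U\<in>Us. real (card {J\<in>Bf. \<Union>J \<subseteq> U})) \<le> q ^ 2 * ?C * (m / 16)"
  proof -
    have p0: "(d / T) ^ (k - 1) > 0" using d0 T by simp
    have "real (card Bf) * (d / T) ^ (k - 1) = (\<Sum>J\<in>Bf. (d / T) ^ (card J - 1))" unfolding Bf_def by simp
    also have "\<dots> \<le> (\<Sum>J\<in>Bad. (d / T) ^ (card J - 1))" using fBad T d0 by (intro sum_mono2) (auto simp: Bf_def)
    finally have cb: "real (card Bf) * (d / T) ^ (k - 1) \<le> m / 16" using weight by linarith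
    have "(\<Sum>J\<in>Bf. real (sdeg Us (\<Union>J))) \<le> (\<Sum>J\<in>Bf. q ^ k * ?C)"
    proof (rule sum_mono)
      fix J assume J: "J \<in> Bf"
      then have "real (sdeg Us (\<Union>J)) \<le> q ^ card (\<Union>J) * ?C" unfolding Us_def q by (intro sdeg_subsets_le A s(2) unA) (auto simp: Bf_def)
      then show "real (sdeg Us (\<Union>J)) \<le> q ^ k * ?C" using Bf_un[OF J] by simp
    qed
    then have "(\<Sum>U\<in>Us. real (card {J\<in>Bf. \<Union>J \<subseteq> U})) \<le> real (card Bf) * (q ^ k * ?C)"
      using sum_sample[of Bf Us Union] fBad fUs unfolding Bf_def by simp
    then have "\<mu> * (\<Sum>U\<in>Us. real (card {J\<in>Bf. \<Union>J \<subseteq> U})) \<le> \<mu> * (real (card Bf) * (q ^ k * ?C))"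
      using \<mu>0 by (intro mult_left_mono) auto
    also have "\<dots> = (\<mu> * q ^ (k - 2) * (T / d) ^ (k - 1)) * (real (card Bf) * (d / T) ^ (k - 1)) * (q ^ 2 * ?C)"
    proof -
      have 1: "(T / d) ^ (k - 1) * (d / T) ^ (k - 1) = 1" using T d0 by (simp add: power_mult_distrib[symmetric])
      have "k - 2 + 2 = k" using k by simp
      then have 2: "q ^ k = q ^ (k - 2) * q ^ 2" by (metis power_add)
      have "(\<mu> * q ^ (k - 2) * (T / d) ^ (k - 1)) * (real (card Bf) * (d / T) ^ (k - 1)) * (q ^ 2 * ?C)
         = \<mu> * (real (card Bf) * ((q ^ (k - 2) * q ^ 2) * ?C)) * ((T / d) ^ (k - 1) * (d / T) ^ (k - 1))"
        by (simp only: mult_ac)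
      then show ?thesis by (simp only: 1 2 mult_1_right)
    qed
    also have "\<dots> \<le> 1 * (m / 16) * (q ^ 2 * ?C)"
    proof (intro mult_mono cb)
      have "\<mu> * q ^ (k - 2) * (T / d) ^ (k - 1) = 4 * real k ^ k * q ^ (k - 2) * (T / d) ^ (k - 1) / real s powr (1 - 1 / l)"
        unfolding \<mu>_def by (simp only: times_divide_eq_left)
      moreover have "real s powr (1 - 1 / l) > 0" using s by simp
      ultimately show "\<mu> * q ^ (k - 2) * (T / d) ^ (k - 1) \<le> 1" using c3 by (simp only: pos_divide_le_eq mult_1)
    qed (use d0 T q01 C0 m_def in auto)
    finally show ?thesis by (simp add: mult_ac)
  qed
  \<comment> \<open>The last term reserves a quarter of \<open>q\<^sup>2 * m\<close>, which keeps
    the sample dense enough for supersaturation: in \<open>c1\<close>, 64 / 4 = 16 is the constant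
    required there. In units of \<open>q\<^sup>2 * ?C * m\<close> the sum is at least 1/2 - 1/16 -
    1/16 - 1/4 > 0.\<close>
  let ?\<phi> = "\<lambda>U. real (card {f\<in>G. f \<subseteq> U}) - real (card {J\<in>Bs. \<Union>J \<subseteq> U}) - \<mu> * real (card {J\<in>Bf. \<Union>J \<subseteq> U}) - q ^ 2 * m / 4"
  have "0 < (\<Sum>U\<in>Us. ?\<phi> U)"
  proof -
    have cU: "real (card Us) = ?C" unfolding Us_def using n_subsets[OF A] by simp
    have "q ^ 2 * ?C * m > 0" using q01 C0 m0 unfolding m_def by simp
    moreover have "(\<Sum>U\<in>Us. ?\<phi> U) = (\<Sum>U\<in>Us. real (card {f\<in>G. f \<subseteq> U})) - (\<Sum>U\<in>Us. real (card {J\<in>Bs. \<Union>J \<subseteq> U}))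
        - \<mu> * (\<Sum>U\<in>Us. real (card {J\<in>Bf. \<Union>J \<subseteq> U})) - ?C * (q ^ 2 * m / 4)"
      unfolding sum_subtractf sum_distrib_left[symmetric] using cU by simp
    ultimately show ?thesis using s1 s2 s3 by (simp add: field_simps)
  qed
  then obtain U where U: "U \<in> Us" "0 < ?\<phi> U" by (metis (no_types, lifting) not_le sum_nonpos)
  have fU: "finite U" "card U = s" "U \<noteq> {}" using U(1) A s finite_subset unfolding Us_def by auto
  define BU where "BU = {J\<in>Bs. \<Union>J \<subseteq> U}"
  define pick where "pick J = (SOME f. f \<in> J)" for J :: "'a set set"
  have pick: "pick J \<in> J" if "J \<in> BU" for J
  proof -
    have "J \<noteq> {}" using that unfolding BU_def Bs_def Bad_def by auto
    then show ?thesis unfolding pick_def by (simp add: some_in_eq)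
  qed
  define G' where "G' = {f\<in>G. f \<subseteq> U} - pick ` BU"
  have fBU: "finite BU" unfolding BU_def Bs_def using fBad by simp
  have "card {f\<in>G. f \<subseteq> U} - card (pick ` BU) \<le> card G'" unfolding G'_def using fBU by (intro diff_card_le_card_Diff) auto
  moreover have "card (pick ` BU) \<le> card BU" using fBU by (rule card_image_le)
  ultimately have "card {f\<in>G. f \<subseteq> U} \<le> card G' + card BU" by linarith
  then have "real (card {f\<in>G. f \<subseteq> U}) \<le> real (card G') + real (card BU)" by (simp only: of_nat_add[symmetric] of_nat_le_iff)
  define m' where "m' = real (card G')"
  define z where "z = real (card {J\<in>Bf. \<Union>J \<subseteq> U})"
  have m'1: "\<mu> * z + q ^ 2 * m / 4 < m'"
    using U(2) \<open>real (card {f\<in>G. f \<subseteq> U}) \<le> real (card G') + real (card BU)\<close> unfolding m'_def z_def BU_def by linarith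
  define x where "x = m' / real s"
  have s0: "real s > 0" using s by simp
  have z0: "\<mu> * z \<ge> 0" unfolding z_def using \<mu>0 by simp
  have m'2: "16 * real l ^ 2 * (real s * real s powr (1 / l)) \<le> m'" using m'1 c1 z0 unfolding m_def by linarith
  have xge: "16 * real l ^ 2 * real s powr (1 / l) \<le> x" unfolding x_def using m'2 s0 by (simp add: field_simps)
  have "0 < 16 * real l ^ 2 * real s powr (1 / l)" using l s by simp
  then have x0: "x > 0" using xge by linarith
  have gc: "x ^ (2 * l) / 2 \<le> real (card (graph_cycles (2 * l) G'))" "finite (graph_cycles (2 * l) G')"
  proof -
    have e: "\<And>f. f \<in> G' \<Longrightarrow> f \<subseteq> U \<and> card f = 2" using G(1) unfolding G'_def by auto
    have b: "x * real (card U) \<le> real (card G')" unfolding x_def m'_def fU(2) using s0 by simp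
    have p: "16 * real l ^ 2 * real (card U) powr (1 / l) \<le> x" unfolding fU(2) by (rule xge)
    show "x ^ (2 * l) / 2 \<le> real (card (graph_cycles (2 * l) G'))" by (rule graph_cycles_count(1)[OF fU(1,3) e x0 b l p])
    show "finite (graph_cycles (2 * l) G')" by (rule graph_cycles_count(2)[OF fU(1,3) e x0 b l p])
  qed
  \<comment> \<open>One factor \<open>x = m' / s\<close> is kept and the other
    \<open>2 * l - 1\<close> are bounded below by \<open>s powr (1 / l)\<close>. This makes the
    bound linear in \<open>m'\<close>, as the comparison with \<open>\<mu> * z\<close>
    requires.\<close>
  have xpow: "m' * real s powr (1 - 1 / l) \<le> x ^ (2 * l)"
  proof -
    have l1: "1 \<le> 16 * real l ^ 2" using l by (smt (verit) one_le_power of_nat_1 of_nat_mono one_le_numeral order_trans)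
    have "1 * real s powr (1 / l) \<le> 16 * real l ^ 2 * real s powr (1 / l)" using l1 by (intro mult_right_mono) auto
    then have "real s powr (1 / l) \<le> x" using xge by simp
    then have "(real s powr (1 / l)) ^ (2 * l - 1) \<le> x ^ (2 * l - 1)" by (intro power_mono) auto
    then have "x * (real s powr (1 / l)) ^ (2 * l - 1) \<le> x * x ^ (2 * l - 1)" using x0 by (intro mult_left_mono) auto
    also have "x * x ^ (2 * l - 1) = x ^ (2 * l)" using l by (metis Suc_diff_1 less_le_trans mult_pos_pos pos2 power_Suc)
    also have "(real s powr (1 / l)) ^ (2 * l - 1) = real s powr (real (2 * l - 1) / l)"
      using s0 by (simp add: powr_realpow[symmetric] powr_powr)
    also have "x * real s powr (real (2 * l - 1) / l) = m' * (real s powr (real (2 * l - 1) / l) / real s powr 1)"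
      unfolding x_def using s0 by simp
    also have "real s powr (real (2 * l - 1) / l) / real s powr 1 = real s powr (1 - 1 / l)"
    proof -
      have "real (2 * l - 1) / l - 1 = 1 - 1 / l" using l by (simp add: of_nat_diff field_simps)
      then show ?thesis by (metis powr_diff)
    qed
    finally show ?thesis .
  qed
  have "real k ^ k * z < real (card (graph_cycles k G'))"
  proof -
    have "4 * (real k ^ k * z) = \<mu> * z * real s powr (1 - 1 / l)" unfolding \<mu>_def using s0 by simp
    also have "\<dots> \<le> m' * real s powr (1 - 1 / l)"
    proof -
      have "q ^ 2 * m \<ge> 0" unfolding m_def by simp
      then show ?thesis using m'1 by (intro mult_right_mono) auto
    qed
    also have "\<dots> \<le> x ^ (2 * l)" by (rule xpow)
    finally have "2 * (real k ^ k * z) \<le> x ^ (2 * l) / 2" by simp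
    moreover have "x ^ (2 * l) / 2 > 0" using x0 by simp
    moreover have "real k ^ k * z \<ge> 0" unfolding z_def by simp
    ultimately show ?thesis using gc(1) unfolding k_def by linarith
  qed
  then have lt: "k ^ k * card {J\<in>Bf. \<Union>J \<subseteq> U} < card (graph_cycles k G')"
    unfolding z_def by (metis of_nat_less_iff of_nat_mult of_nat_power)
  have "\<exists>xs\<in>graph_cycles k G'. cycle_edges k xs \<notin> Bf"
  proof (rule ccontr)
    assume "\<not> ?thesis"
    then have all: "\<And>xs. xs \<in> graph_cycles k G' \<Longrightarrow> cycle_edges k xs \<in> Bf" by auto
    have inU: "\<Union>(cycle_edges k xs) \<subseteq> U" if "xs \<in> graph_cycles k G'" for xs
      using cycle_edges_subset[OF that] unfolding G'_def by auto
    have "graph_cycles k G' \<subseteq> (\<Union>J\<in>{J\<in>Bf. \<Union>J \<subseteq> U}. {xs\<in>graph_cycles k G'. cycle_edges k xs = J})"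
      using all inU by auto
    moreover have fz: "finite {J\<in>Bf. \<Union>J \<subseteq> U}" unfolding Bf_def using fBad by simp
    ultimately have "card (graph_cycles k G') \<le> card (\<Union>J\<in>{J\<in>Bf. \<Union>J \<subseteq> U}. {xs\<in>graph_cycles k G'. cycle_edges k xs = J})"
      using gc(2) unfolding k_def by (intro card_mono) auto
    also have "\<dots> \<le> (\<Sum>J\<in>{J\<in>Bf. \<Union>J \<subseteq> U}. card {xs\<in>graph_cycles k G'. cycle_edges k xs = J})" by (rule card_UN_le[OF fz])
    also have "\<dots> \<le> (\<Sum>J\<in>{J\<in>Bf. \<Union>J \<subseteq> U}. k ^ k)"
    proof (rule sum_mono, rule cycles_per_edge_set)
      fix J assume J: "J \<in> {J\<in>Bf. \<Union>J \<subseteq> U}"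
      then show "card (\<Union>J) \<le> k" using Bf_un by simp
      show "finite (\<Union>J)" using J fU(1) finite_subset by auto
    qed (rule k(2))
    finally show False using lt by (simp add: mult.commute)
  qed
  then obtain xs where xs: "xs \<in> graph_cycles k G'" "cycle_edges k xs \<notin> Bf" by auto
  have xsG: "xs \<in> graph_cycles k G" using xs(1) graph_cycles_mono[of G' G] unfolding G'_def by auto
  note ce = cycle_edges_card[OF xsG k(2)]
  have noBad: "J \<notin> Bad" if J: "J \<subseteq> cycle_edges k xs" "J \<noteq> {}" for J
  proof
    assume JB: "J \<in> Bad"
    have "J \<noteq> cycle_edges k xs" using xs(2) JB ce(2) unfolding Bf_def by auto
    then have "card J < k" using psubset_card_mono[OF ce(4), of J] J(1) ce(2) by auto
    moreover have "\<Union>J \<subseteq> U" using cycle_edges_subset[OF xs(1)] J(1) unfolding G'_def by auto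
    ultimately have "J \<in> BU" using JB unfolding BU_def Bs_def by simp
    then have "pick J \<in> G'" "pick J \<in> pick ` BU" using pick J(1) cycle_edges_subset[OF xs(1)] by auto
    then show False unfolding G'_def by auto
  qed
  have "\<exists>S. S \<subseteq> \<Union>(X ` cycle_edges k xs) \<and> linear_cycle_edges k S \<and> (\<forall>b\<in>B. \<not> b \<subseteq> S)"
  proof (rule expand_cycle[OF xsG k(2) _ X(1) X(2) _ d \<theta>])
    show "real (card {\<tau>\<in>PiE J X. \<tau> ` J \<in> B}) \<le> \<theta> * (\<Prod>f\<in>J. real (card (X f)))"
      if "J \<subseteq> cycle_edges k xs" "J \<noteq> {}" for J
      using noBad[OF that] that xsG unfolding Bad_def by auto
  qed (use G X(3) B(1) in auto)
  then obtain S where S: "S \<subseteq> \<Union>(X ` cycle_edges k xs)" "linear_cycle_edges k S" "\<forall>b\<in>B. \<not> b \<subseteq> S" by auto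
  have "S \<subseteq> ?V" using S(1) cycle_edges_subset[OF xsG] by auto
  then have "S \<in> cycle_copies k ?V" unfolding cycle_copies_def using S(2) by simp
  then show "\<exists>S\<in>cycle_copies k ?V. \<forall>b\<in>B. \<not> b \<subseteq> S" using S(3) by auto
qed

section \<open>Choice of the parameters\<close>

lemma sum_shadow_degrees:
  assumes V: "finite V" "\<And>e. e \<in> V \<Longrightarrow> card e = 3"
  shows "(\<Sum>f\<in>{f. card f = 2 \<and> (\<exists>e\<in>V. f \<subseteq> e)}. sdeg V f) = 3 * card V" "finite {f. card f = 2 \<and> (\<exists>e\<in>V. f \<subseteq> e)}"
proof -
  let ?P = "{f. card f = 2 \<and> (\<exists>e\<in>V. f \<subseteq> e)}"
  have fe: "finite e" if "e \<in> V" for e using V(2)[OF that] by (auto intro: card_ge_0_finite)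
  have PU: "?P \<subseteq> (\<Union>e\<in>V. Pow e)" by auto
  show fP: "finite ?P" by (rule finite_subset[OF PU]) (use V(1) fe in auto)
  have "(\<Sum>f\<in>?P. sdeg V f) = (\<Sum>f\<in>?P. \<Sum>e\<in>V. if f \<subseteq> e then 1 else 0)"
    unfolding sdeg_def using V(1) by (simp add: sum.If_cases Int_def)
  also have "\<dots> = (\<Sum>e\<in>V. \<Sum>f\<in>?P. if f \<subseteq> e then 1 else 0)" by (rule sum.swap)
  also have "\<dots> = (\<Sum>e\<in>V. 3)"
  proof (rule sum.cong[OF refl])
    fix e assume e: "e \<in> V"
    have "?P \<inter> {f. f \<subseteq> e} = {f. f \<subseteq> e \<and> card f = 2}" using e by auto
    then show "(\<Sum>f\<in>?P. if f \<subseteq> e then 1 else 0) = (3::nat)"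
      using fP n_subsets[OF fe[OF e], of 2] V(2)[OF e] by (simp add: sum.If_cases choose_two)
  qed
  finally show "(\<Sum>f\<in>?P. sdeg V f) = 3 * card V" by simp
qed

text \<open>The sampling density is \<open>48 * k / d\<close>, at most \<open>49 * k / d\<close>
  after rounding up: double counting gives \<open>d * card P \<le> 3 * card V\<close>, and 48 = 16 *
  3. The exponent in the bound on \<open>T\<close> is \<open>(2 * k - 3) / (k - 1)\<close>, from the
  condition for the whole cycle in \<open>robust_dense\<close>; as it is below 2, the other
  condition follows.\<close>

lemma robust_large_codegrees:
  fixes T d :: real and l :: nat
  defines "k \<equiv> 2 * l"
  assumes A: "finite A" "card A \<ge> 2" and V: "\<And>e. e \<in> V \<Longrightarrow> e \<subseteq> A \<and> card e = 3" "V \<noteq> {}" and l: "l \<ge> 2"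
    and cd: "\<And>f. card f = 2 \<Longrightarrow> \<exists>e\<in>V. f \<subseteq> e \<Longrightarrow> d \<le> real (sdeg V f)"
    and d: "96 * real k \<le> d" and T: "0 < T" "T \<le> (d / (49 * real k)) powr ((4 * real l - 3) / (2 * real l - 1))"
  shows "robust V (cycle_copies k V) T (1 / 8)"
proof -
  let ?n = "card A"
  have k: "k \<ge> 4" unfolding k_def using l by simp
  have fV: "finite V" using A V by (meson finite_Pow_iff finite_subset PowI subsetI)
  have d0: "d > 0" using d k by linarith
  define P where "P = {f. card f = 2 \<and> (\<exists>e\<in>V. f \<subseteq> e)}"
  have fP: "finite P" unfolding P_def by (rule sum_shadow_degrees(2)) (use fV V in auto)
  have PV: "d * real (card P) \<le> 3 * real (card V)"
  proof -
    have "d * real (card P) = (\<Sum>f\<in>P. d)" by simp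
    also have "\<dots> \<le> (\<Sum>f\<in>P. real (sdeg V f))" using cd by (intro sum_mono) (auto simp: P_def)
    also have "\<dots> = real (\<Sum>f\<in>P. sdeg V f)" by simp
    also have "\<dots> = 3 * real (card V)" unfolding P_def using sum_shadow_degrees(1)[of V] fV V by simp
    finally show ?thesis .
  qed
  have dn: "d \<le> real ?n"
  proof -
    obtain e where e: "e \<in> V" using V(2) by auto
    then obtain a b c where abc: "e = {a, b, c}" "a \<noteq> b" using V(1)[OF e] by (auto simp: card_3_iff)
    have "d \<le> real (sdeg V {a, b})" by (rule cd) (use e abc in auto)
    also have "sdeg V {a, b} \<le> card {x. x \<noteq> a \<and> x \<noteq> b \<and> {a, b, x} \<in> V}"
      by (rule third_vertices(1)) (use fV V abc in auto)
    also have "\<dots> \<le> ?n" using V(1) A(1) by (intro card_mono) auto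
    finally show ?thesis by simp
  qed
  have n0: "real ?n > 0" using A by simp
  define s where "s = nat \<lceil>48 * real k * real ?n / d\<rceil>"
  have s1: "48 * real k * real ?n / d \<le> real s" unfolding s_def by (rule of_nat_ceiling)
  have s2: "real s \<le> 48 * real k * real ?n / d + 1" unfolding s_def using d0 n0 k by (simp add: of_nat_ceiling)
  define q where "q = real s / real ?n"
  have q1: "48 * real k / d \<le> q" unfolding q_def using s1 n0 by (simp add: field_simps)
  have q2: "q \<le> 49 * real k / d"
  proof -
    have "q \<le> (48 * real k * real ?n / d + 1) / real ?n" unfolding q_def using s2 n0 by (intro divide_right_mono) auto
    also have "\<dots> = 48 * real k / d + 1 / real ?n" using n0 d0 by (simp add: field_simps)
    also have "1 / real ?n \<le> real k / d" using dn d0 n0 k by (intro frac_le) auto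
    finally show ?thesis by (simp add: add_divide_distrib[symmetric])
  qed
  define E where "E = d / (49 * real k)"
  have E1: "E \<ge> 1" unfolding E_def using d k by (simp add: field_simps)
  have qE: "q \<le> 1 / E" unfolding E_def using q2 by simp
  have q0: "q \<ge> 0" unfolding q_def by simp
  let ?g = "(4 * real l - 3) / (2 * real l - 1)"
  have g2: "?g \<le> 2" using l by (simp add: field_simps)
  have TE: "T \<le> E powr ?g" using T(2) unfolding E_def .
  have "T * q ^ 2 \<le> 1"
  proof -
    have "T \<le> E powr 2" using TE g2 E1 by (meson order_trans powr_mono)
    then have "T * q ^ 2 \<le> E ^ 2 * (1 / E) ^ 2"
      using E1 T(1) q0 qE by (intro mult_mono power_mono) (auto simp: powr_numeral)
    then show ?thesis using E1 by (simp add: power_divide)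
  qed
  moreover have "T ^ (k - 1) * q ^ (2 * k - 3) \<le> 1"
  proof -
    have "T ^ (k - 1) \<le> (E powr ?g) ^ (k - 1)" using TE T(1) by (intro power_mono) auto
    also have "\<dots> = E powr (?g * real (k - 1))" using E1 by (simp add: powr_realpow[symmetric] powr_powr)
    also have "?g * real (k - 1) = real (2 * k - 3)" unfolding k_def using l by (simp add: of_nat_diff field_simps)
    also have "E powr real (2 * k - 3) = E ^ (2 * k - 3)" using E1 by (intro powr_realpow) auto
    finally have "T ^ (k - 1) * q ^ (2 * k - 3) \<le> E ^ (2 * k - 3) * (1 / E) ^ (2 * k - 3)"
      using q0 qE E1 by (intro mult_mono power_mono) auto
    then show ?thesis using E1 by (simp add: power_divide)
  qed
  moreover have "16 * real k * real (card P) \<le> q * real (card V)"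
  proof -
    have "16 * real k * real (card P) = 16 * real k / d * (d * real (card P))" using d0 by simp
    also have "\<dots> \<le> 16 * real k / d * (3 * real (card V))" using PV d0 by (intro mult_left_mono) auto
    also have "\<dots> = 48 * real k / d * real (card V)" by simp
    also have "\<dots> \<le> q * real (card V)" using q1 by (intro mult_right_mono) auto
    finally show ?thesis .
  qed
  moreover have "6 \<le> s"
  proof -
    have "6 * 1 \<le> (48 * real k) * (real ?n / d)" using dn d0 k by (intro mult_mono) (auto simp: field_simps)
    then have "6 \<le> real s" using s1 by simp
    then show ?thesis by simp
  qed
  moreover have "s \<le> ?n"
  proof -
    have "48 * real k * real ?n / d \<le> real ?n / 2" using d d0 n0 by (simp add: field_simps)
    then have "real s \<le> real ?n" using s2 A(2) by simp
    then show ?thesis by simp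
  qed
  ultimately show ?thesis using robust_dense[OF A(1) V(1) V(2) _ _ _ _ _ q_def, of k P T] k T(1)
    unfolding P_def using V(1) by auto
qed

text \<open>The density condition \<open>c1\<close> of \<open>robust_sparse\<close> says
  \<open>x \<le> s powr (1 - 1 / l)\<close>, and \<open>Y\<close> is the value of \<open>s\<close>
  with equality. The conditions on \<open>T\<close> favour small samples, so \<open>s\<close> is
  \<open>Y\<close> rounded up.\<close>

lemma robust_fibres:
  fixes T d x Y :: real and l :: nat
  defines "k \<equiv> 2 * l"
  assumes A: "finite A" and G: "\<And>f. f \<in> G \<Longrightarrow> f \<subseteq> A \<and> card f = 2" "G \<noteq> {}" and l: "l \<ge> 2"
    and X: "\<And>f e. f \<in> G \<Longrightarrow> e \<in> X f \<Longrightarrow> f \<subseteq> e \<and> card e = 3"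
      "\<And>f. f \<in> G \<Longrightarrow> finite (X f)" "\<And>f. f \<in> G \<Longrightarrow> d \<le> real (card (X f)) \<and> real (card (X f)) \<le> 2 * d"
      "\<And>f g. f \<in> G \<Longrightarrow> g \<in> G \<Longrightarrow> f \<noteq> g \<Longrightarrow> X f \<inter> X g = {}"
    and d: "8 * real k ^ 2 \<le> d" and T: "T > 0"
    and x: "x = 64 * real l ^ 2 * real (card A) ^ 2 / real (card G)" and Y: "Y = x powr (l / (real l - 1))"
    and c1: "2 * Y \<le> real (card A)" and c2: "2 * Y * T \<le> d * real (card A)"
    and c3: "8 * real k ^ k * x * T \<le> d * real (card A) powr ((2 * real l - 2) / (2 * real l - 1))"
  shows "robust (\<Union>(X ` G)) (cycle_copies k (\<Union>(X ` G))) T ((1 / 2 ^ (k + 2)) / 32)"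
proof -
  let ?n = "card A"
  have k: "k \<ge> 4" unfolding k_def using l by simp
  have fG: "finite G" using A G(1) by (meson finite_Pow_iff finite_subset PowI subsetI)
  have m0: "real (card G) > 0" using fG G(2) by (simp add: card_gt_0_iff)
  have d0: "d > 0" using d k by (smt (verit) of_nat_0_less_iff zero_less_power zero_less_numeral less_le_trans mult_pos_pos)
  have l1: "real l - 1 > 0" using l by simp
  have n0: "real ?n > 0"
  proof -
    obtain f where f: "f \<in> G" using G(2) by auto
    then have "f \<noteq> {}" using G(1)[OF f] by auto
    then show ?thesis using A G(1)[OF f] by (auto simp: card_gt_0_iff)
  qed
  have "card G \<le> card {f. f \<subseteq> A \<and> card f = 2}" using A G(1) by (intro card_mono) auto
  also have "\<dots> = ?n choose 2" using n_subsets[OF A] .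
  also have "\<dots> \<le> ?n ^ 2" by (simp add: choose_two power2_eq_square mult_le_mono2 div_le_mono2 order_trans[OF div_le_dividend])
  finally have mn: "real (card G) \<le> real ?n ^ 2" by (metis of_nat_mono of_nat_power)
  have x1: "x \<ge> 1"
  proof -
    have "1 * 1 \<le> (64 * real l ^ 2) * (real ?n ^ 2 / real (card G))"
    proof (intro mult_mono)
      have "1 \<le> real l ^ 2" using l by (intro one_le_power) simp
      then show "1 \<le> 64 * real l ^ 2" by simp
      show "1 \<le> real ?n ^ 2 / real (card G)" using mn m0 by simp
    qed auto
    then show ?thesis unfolding x by simp
  qed
  have Y1: "Y \<ge> 1" unfolding Y using x1 l1 by (intro ge_one_powr_ge_zero) auto
  define s where "s = nat \<lceil>Y\<rceil>"
  have s1: "Y \<le> real s" unfolding s_def by (rule of_nat_ceiling)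
  have s2: "real s \<le> 2 * Y" unfolding s_def using Y1 by (simp add: of_nat_ceiling) linarith
  have s0: "real s > 0" using s1 Y1 by linarith
  define q where "q = real s / real ?n"
  have q0: "q \<ge> 0" unfolding q_def by simp
  have ex: "l / (real l - 1) * (1 - 1 / l) = 1" using l by (simp add: field_simps)
  have sx: "x \<le> real s powr (1 - 1 / l)"
  proof -
    have "x = Y powr (1 - 1 / l)" unfolding Y powr_powr ex using x1 by simp
    also have "\<dots> \<le> real s powr (1 - 1 / l)" using s1 Y1 l by (intro powr_mono2) auto
    finally show ?thesis .
  qed
  have sx2: "real s powr (1 - 1 / l) \<le> 2 * x"
  proof -
    have "real s powr (1 - 1 / l) \<le> (2 * Y) powr (1 - 1 / l)" using s2 l by (intro powr_mono2) auto
    also have "\<dots> = 2 powr (1 - 1 / l) * x" unfolding Y using x1 by (subst powr_mult) (simp_all only: powr_powr ex, simp_all)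
    also have "\<dots> \<le> 2 powr 1 * x" using x1 l by (intro mult_right_mono powr_mono) auto
    finally show ?thesis by simp
  qed
  have split: "real s powr (1 - 1 / l) * real s powr (1 / l) = real s" using s0 by (simp add: powr_add[symmetric])
  have sn: "s \<le> ?n" using s2 c1 by linarith
  have s2': "2 \<le> s"
  proof (rule ccontr)
    assume "\<not> 2 \<le> s"
    then have "real s powr (1 - 1 / l) \<le> 1" using s0 by (cases "s = 1") auto
    moreover have "x \<ge> 64" 
    proof -
      have "64 * 1 \<le> (64 * real l ^ 2) * (real ?n ^ 2 / real (card G))"
      proof (intro mult_mono)
        have "1 \<le> real l ^ 2" using l by (intro one_le_power) simp
        then show "64 \<le> 64 * real l ^ 2" by simp
        show "1 \<le> real ?n ^ 2 / real (card G)" using mn m0 by simp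
      qed auto
      then show ?thesis unfolding x by simp
    qed
    ultimately show False using sx by linarith
  qed
  show ?thesis
    unfolding k_def
  proof (rule robust_sparse[OF A G l X, where s=s and q=q])
    show "8 * (real (2 * l))\<^sup>2 \<le> d" using d unfolding k_def .
    show "q = real s / real ?n" by (rule q_def)
    show "64 * (real l)\<^sup>2 * (real s * real s powr (1 / real l)) \<le> q\<^sup>2 * real (card G)"
    proof -
      have "x * (real s * real s powr (1 / l)) \<le> real s powr (1 - 1 / l) * (real s * real s powr (1 / l))"
        using sx by (intro mult_right_mono) auto
      also have "\<dots> = real s ^ 2" using split by (simp add: power2_eq_square mult_ac)
      finally have "x * (real s * real s powr (1 / l)) * (real (card G) / real ?n ^ 2) \<le> real s ^ 2 * (real (card G) / real ?n ^ 2)"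
        by (intro mult_right_mono) auto
      then show ?thesis unfolding x q_def using m0 n0 by (simp add: power_divide)
    qed
    show "q * T \<le> d"
    proof -
      have "real s * T \<le> 2 * Y * T" using s2 T by (intro mult_right_mono) auto
      also have "\<dots> \<le> d * real ?n" by (rule c2)
      finally show ?thesis unfolding q_def using n0 by (simp add: field_simps)
    qed
    show "4 * real (2 * l) ^ (2 * l) * q ^ (2 * l - 2) * (T / d) ^ (2 * l - 1) \<le> real s powr (1 - 1 / real l)"
    proof -
      define z where "z = real s powr (1 - 1 / l)"
      have z0: "z > 0" unfolding z_def using s0 by simp
      have kk: "1 \<le> real k ^ k" using k by (intro one_le_power) simp
      \<comment> \<open>In terms of \<open>z = s powr (1 - 1 / l)\<close> the claim no longer
        involves \<open>s\<close> separately: up to constants it reads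
        \<open>(z * T / d) ^ (2 * l - 1) \<le> n ^ (2 * l - 2)\<close>, the origin of the exponent
        in \<open>c3\<close>.\<close>
      have sz: "real s ^ (2 * l - 2) = z ^ (2 * l)"
      proof -
        have "(1 - 1 / l) * real (2 * l) = real (2 * l - 2)" using l by (simp add: of_nat_diff field_simps)
        then have "z ^ (2 * l) = real s powr real (2 * l - 2)" unfolding z_def using s0 by (simp add: powr_realpow[symmetric] powr_powr)
        also have "\<dots> = real s ^ (2 * l - 2)" using s0 by (rule powr_realpow)
        finally show ?thesis by simp
      qed
      have "4 * real k ^ k * (z * (T / d)) ^ (2 * l - 1) \<le> real ?n ^ (2 * l - 2)"
      proof -
        have "4 * real k ^ k * (z * (T / d)) ^ (2 * l - 1) \<le> (4 * real k ^ k) ^ (2 * l - 1) * (z * (T / d)) ^ (2 * l - 1)"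
        proof (intro mult_right_mono)
          have "(4 * real k ^ k) ^ 1 \<le> (4 * real k ^ k) ^ (2 * l - 1)" using kk l by (intro power_increasing) auto
          then show "4 * real k ^ k \<le> (4 * real k ^ k) ^ (2 * l - 1)" by simp
        qed (use z0 T d0 in auto)
        also have "\<dots> = (4 * real k ^ k * (z * (T / d))) ^ (2 * l - 1)" by (rule power_mult_distrib[symmetric])
        also have "\<dots> \<le> (real ?n powr ((2 * real l - 2) / (2 * real l - 1))) ^ (2 * l - 1)"
        proof (intro power_mono)
          have "4 * real k ^ k * (z * (T / d)) \<le> 4 * real k ^ k * (2 * x * (T / d))"
            using sx2 T d0 unfolding z_def by (intro mult_left_mono mult_right_mono) auto
          also have "\<dots> = 8 * real k ^ k * x * T / d" by simp
          also have "\<dots> \<le> real ?n powr ((2 * real l - 2) / (2 * real l - 1))" using c3 d0 by (simp add: pos_divide_le_eq mult.commute)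
          finally show "4 * real k ^ k * (z * (T / d)) \<le> real ?n powr ((2 * real l - 2) / (2 * real l - 1))" .
        qed (use z0 T d0 in auto)
        also have "\<dots> = real ?n powr ((2 * real l - 2) / (2 * real l - 1) * real (2 * l - 1))" using n0 by (simp add: powr_realpow[symmetric] powr_powr)
        also have "(2 * real l - 2) / (2 * real l - 1) * real (2 * l - 1) = real (2 * l - 2)" using l by (simp add: of_nat_diff)
        also have "real ?n powr real (2 * l - 2) = real ?n ^ (2 * l - 2)" using n0 by (rule powr_realpow)
        finally show ?thesis .
      qed
      then have "4 * real k ^ k * (z * (T / d)) ^ (2 * l - 1) / real ?n ^ (2 * l - 2) * z \<le> 1 * z"
        using z0 n0 by (intro mult_right_mono) auto
      moreover have "4 * real k ^ k * (z * (T / d)) ^ (2 * l - 1) / real ?n ^ (2 * l - 2) * z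
          = 4 * real k ^ k * q ^ (2 * l - 2) * (T / d) ^ (2 * l - 1)"
      proof -
        have "z ^ (2 * l) = z ^ (2 * l - 1) * z" using l by (metis Suc_diff_1 less_le_trans mult_pos_pos pos2 power_Suc2)
        then have "z ^ (2 * l - 1) * z = real s ^ (2 * l - 2)" using sz by simp
        then show ?thesis unfolding q_def power_divide power_mult_distrib by (simp add: mult_ac)
      qed
      ultimately show ?thesis unfolding k_def z_def by simp
    qed
  qed (use T s2' sn in auto)
qed

section \<open>The two cases combined\<close>

lemma eventually_powr_ge:
  fixes e C :: real
  assumes "e > 0"
  shows "\<forall>\<^sub>F n::nat in sequentially. C \<le> real n powr e"
proof -
  have "filterlim (\<lambda>n::nat. real n powr e) at_top sequentially" using assms by real_asymp
  then show ?thesis by (rule filterlim_at_top[THEN iffD1, rule_format])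
qed

lemma dyadic_class:
  fixes w :: "'a \<Rightarrow> real" and t U :: real and N :: nat
  assumes R: "finite R" "\<And>f. f \<in> R \<Longrightarrow> t \<le> w f \<and> w f < t * 2 ^ N" and t: "t > 0" and N: "N \<ge> 1"
  shows "\<exists>i<N. sum w R \<le> real N * sum w {f\<in>R. t * 2 ^ i \<le> w f \<and> w f \<le> 2 * (t * 2 ^ i)}"
proof (rule ccontr)
  assume c: "\<not> ?thesis"
  define C where "C i = {f\<in>R. t * 2 ^ i \<le> w f \<and> w f \<le> 2 * (t * 2 ^ i)}" for i :: nat
  have w0: "w f \<ge> 0" if "f \<in> R" for f using R(2)[OF that] t by linarith
  have "R \<subseteq> (\<Union>i\<in>{..<N}. C i)"
  proof
    fix f assume f: "f \<in> R"
    have ex: "\<exists>j. w f < t * 2 ^ j" using R(2)[OF f] by auto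
    define j where "j = (LEAST j. w f < t * 2 ^ j)"
    have j1: "w f < t * 2 ^ j" unfolding j_def using ex by (rule LeastI_ex)
    have jN: "j \<le> N" unfolding j_def using R(2)[OF f] by (intro Least_le) auto
    have "j \<noteq> 0" using j1 R(2)[OF f] by (cases j) auto
    then obtain i where i: "j = Suc i" by (cases j) auto
    have "\<not> w f < t * 2 ^ i" using not_less_Least[of i "\<lambda>j. w f < t * 2 ^ j"] i unfolding j_def by simp
    then have "f \<in> C i" unfolding C_def using f j1 i by auto
    then show "f \<in> (\<Union>i\<in>{..<N}. C i)" using i jN by auto
  qed
  then have "sum w R \<le> sum w (\<Union>i\<in>{..<N}. C i)" using R(1) w0 by (intro sum_mono2) (auto simp: C_def)
  also have "\<dots> \<le> (\<Sum>i\<in>{..<N}. sum w (C i))"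
  proof -
    have "sum w (\<Union>i\<in>{..<n}. C i) \<le> (\<Sum>i\<in>{..<n}. sum w (C i))" for n
    proof (induction n)
      case (Suc n)
      have fin: "finite (C n)" "finite (\<Union>i\<in>{..<n}. C i)" using R(1) by (auto simp: C_def)
      have "sum w (\<Union>i\<in>{..<Suc n}. C i) = sum w (C n) + sum w (\<Union>i\<in>{..<n}. C i) - sum w (C n \<inter> (\<Union>i\<in>{..<n}. C i))"
        unfolding lessThan_Suc UN_insert using fin by (rule sum_Un)
      also have "\<dots> \<le> sum w (C n) + sum w (\<Union>i\<in>{..<n}. C i)"
        using w0 by (auto intro!: sum_nonneg simp: C_def)
      finally show ?case using Suc by simp
    qed simp
    then show ?thesis .
  qed
  also have "\<dots> < (\<Sum>i\<in>{..<N}. sum w R / real N)"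
  proof (rule sum_strict_mono)
    fix i assume "i \<in> {..<N}"
    then have "real N * sum w (C i) < sum w R" using c unfolding C_def by (auto simp: not_le)
    then show "sum w (C i) < sum w R / real N" using N by (simp add: pos_less_divide_eq mult.commute)
  qed (use N in \<open>auto simp: lessThan_empty_iff\<close>)
  also have "\<dots> = sum w R" using N by simp
  finally show False by simp
qed

text \<open>The first term of the minimum is the value of \<open>T\<close> at which large codegrees
  and vertex sampling in the graph case balance; the second is the limit set by whole cycles in the
  graph case. The robustness constant is the \<open>\<theta> / 32\<close> of
  \<open>robust_sparse\<close>.\<close>

definition has_robust_subset :: "nat \<Rightarrow> real \<Rightarrow> nat \<Rightarrow> 'a set set \<Rightarrow> bool" where
  "has_robust_subset l c0 n H \<longleftrightarrow>
     (\<exists>V T. V \<subseteq> H \<and> V \<noteq> {} \<and> 1 \<le> T \<and> robust V (cycle_copies (2 * l) V) T (1 / 2 ^ (2 * l + 2) / 32) \<and>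
        c0 * min ((real n * (real (card H) / (real n ^ 2 * ln (real n))) powr (real l / (real l - 1)))
                    powr ((4 * real l - 3) * (real l - 1) / (4 * real l ^ 2 - 5 * real l + 2)))
                 (real (card H) / (real n ^ 2 * ln (real n)) * real n powr ((2 * real l - 2) / (2 * real l - 1))) \<le> T)"

text \<open>
  With \<open>y = card H / (n\<^sup>2 ln n)\<close> and \<open>Q = n y powr (l / (l - 1))\<close>, the codegree threshold is \<open>d0 = Q powr e0\<close>: this is
  where the constraint \<open>T \<le> d0 powr g\<close> from large codegrees meets the constraint \<open>T \<le> Q / d0 powr (a - 1)\<close> from vertex
  sampling in the graph case. The factor \<open>ln n\<close> in \<open>y\<close> is lost in the dyadic pigeonholing of the bundles.
\<close>

lemma ex_robust_subset:
  fixes l :: nat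
  assumes l: "l \<ge> 2"
  shows "\<exists>c0>0. \<exists>K\<ge>1. \<forall>\<^sub>F n::nat in sequentially. \<forall>(A::'a set) H. card A = n \<and> (\<forall>e\<in>H. e \<subseteq> A \<and> card e = 3) \<and>
     K * real n ^ 2 \<le> real (card H) \<longrightarrow> has_robust_subset l c0 n H"
proof -
  define D where "D = 4 * real l ^ 2 - 5 * real l + 2"
  define k where "k = 2 * l"
  define a where "a = real l / (real l - 1)"
  define e0 where "e0 = (real l - 1) * (2 * real l - 1) / D"
  define e1 where "e1 = (4 * real l - 3) * (real l - 1) / D"
  define g where "g = (4 * real l - 3) / (2 * real l - 1)"
  define r where "r = (2 * real l - 2) / (2 * real l - 1)"
  \<comment> \<open>1536 = 64 * 24, with 64 from the \<open>x\<close> of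
    \<open>robust_fibres\<close> and 24 from the losses collected in \<open>dm\<close>.\<close>
  define c1 :: real where "c1 = 1536 * real l ^ 2"
  \<comment> \<open>The three entries serve, in this order, the large-codegree case, the condition
    on \<open>Y * T\<close> and the condition on \<open>x * T\<close>.\<close>
  define c0 :: real where "c0 = min (1 / (49 * real k) ^ 2) (min (1 / (2 * c1 ^ 2)) (1 / (8 * real k ^ k * c1)))"
  define K :: real where "K = 8 * real k ^ 2"
  have rl: "real l \<ge> 2" using l by simp
  have D0: "D > 0"
  proof -
    have "D = (real l - 2) * (4 * real l + 3) + 8" unfolding D_def by (simp add: algebra_simps power2_eq_square)
    then show ?thesis using rl by (simp add: add_nonneg_pos)
  qed
  have k4: "real k \<ge> 4" unfolding k_def using rl by simp
  have c1_1: "c1 \<ge> 1"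
  proof -
    have "1 \<le> real l ^ 2" using rl by (intro one_le_power) simp
    then show ?thesis unfolding c1_def by simp
  qed
  have kk: "real k ^ k \<ge> 1" using k4 by (intro one_le_power) simp
  have c0_0: "c0 > 0" unfolding c0_def using k4 c1_1 kk by (auto intro!: divide_pos_pos mult_pos_pos)
  have c0_le: "c0 \<le> 1 / (49 * real k) ^ 2" "c0 \<le> 1 / (2 * c1 ^ 2)" "c0 \<le> 1 / (8 * real k ^ k * c1)" unfolding c0_def by auto
  have K1: "K \<ge> 1"
  proof -
    have "1 \<le> real k ^ 2" using k4 by (intro one_le_power) simp
    then show ?thesis unfolding K_def by simp
  qed
  have a2: "1 < a" "a \<le> 2" unfolding a_def using rl by (auto simp: field_simps)
  have e0_0: "e0 > 0" unfolding e0_def using rl D0 by simp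
  have e1_0: "e1 > 0" unfolding e1_def using rl D0 by simp
  \<comment> \<open>This makes the sample fit into \<open>A\<close>: \<open>Y\<close> is at most
    about \<open>d0 powr a * n / Q\<close>, that is, \<open>n / Q powr (1 - e0 * a)\<close>.\<close>
  have e0a: "1 - e0 * a > 0"
  proof -
    have "e0 * a = real l * (2 * real l - 1) / D" unfolding e0_def a_def using rl by simp
    moreover have "real l * (2 * real l - 1) < D"
    proof -
      have "D - real l * (2 * real l - 1) = 2 * (real l - 1) ^ 2" unfolding D_def by (simp add: algebra_simps power2_eq_square)
      moreover have "(real l - 1) ^ 2 > 0" using rl by simp
      ultimately show ?thesis by linarith
    qed
    ultimately show ?thesis using D0 by simp
  qed
  have e0g: "e0 * g = e1" unfolding e0_def g_def e1_def using rl by simp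
  have g2: "g \<le> 2" "g \<ge> 0" unfolding g_def using rl by (auto simp: field_simps)
  have e1e0: "e1 + e0 * (a - 1) = 1"
  proof -
    have "a - 1 = 1 / (real l - 1)" unfolding a_def using rl by (simp add: field_simps)
    then have "e0 * (a - 1) = (2 * real l - 1) / D" unfolding e0_def using rl by simp
    then have "e1 + e0 * (a - 1) = ((4 * real l - 3) * (real l - 1) + (2 * real l - 1)) / D" unfolding e1_def by (simp add: add_divide_distrib)
    also have "(4 * real l - 3) * (real l - 1) + (2 * real l - 1) = D" unfolding D_def by (simp add: algebra_simps power2_eq_square)
    finally show ?thesis using D0 by simp
  qed
  have r23: "r \<ge> 2 / 3" unfolding r_def using rl by (simp add: field_simps)
  have ev: "\<forall>\<^sub>F n::nat in sequentially. 2 \<le> n \<and> 1 \<le> ln (real n) \<and> real n powr (1/2) \<le> real n / ln (real n) ^ 2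
     \<and> 96 * real k \<le> real n powr (1/2 * e0) \<and> 2 * c1 ^ 2 \<le> real n powr (1/2 * (1 - e0 * a))
     \<and> 1 / c0 \<le> real n powr (1/2 * e1) \<and> 1 / c0 \<le> real n powr (2/3) / ln (real n)"
  proof (intro eventually_conj)
    show "\<forall>\<^sub>F n::nat in sequentially. 2 \<le> n" by (rule eventually_ge_at_top)
    show "\<forall>\<^sub>F n::nat in sequentially. 1 \<le> ln (real n)" by real_asymp
    show "\<forall>\<^sub>F n::nat in sequentially. real n powr (1/2) \<le> real n / ln (real n) ^ 2" by real_asymp
    show "\<forall>\<^sub>F n::nat in sequentially. 96 * real k \<le> real n powr (1/2 * e0)" using e0_0 by (intro eventually_powr_ge) simp
    show "\<forall>\<^sub>F n::nat in sequentially. 2 * c1 ^ 2 \<le> real n powr (1/2 * (1 - e0 * a))" using e0a by (intro eventually_powr_ge) simp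
    show "\<forall>\<^sub>F n::nat in sequentially. 1 / c0 \<le> real n powr (1/2 * e1)" using e1_0 by (intro eventually_powr_ge) simp
    have "filterlim (\<lambda>n::nat. real n powr (2/3) / ln (real n)) at_top sequentially" by real_asymp
    then show "\<forall>\<^sub>F n::nat in sequentially. 1 / c0 \<le> real n powr (2/3) / ln (real n)"
      by (rule filterlim_at_top[THEN iffD1, rule_format])
  qed
  have main: "\<exists>V T. V \<subseteq> H \<and> V \<noteq> {} \<and> 1 \<le> T \<and> robust V (cycle_copies k V) T (1 / 2 ^ (k + 2) / 32) \<and>
        c0 * min ((real n * (real (card H) / (real n ^ 2 * ln (real n))) powr a) powr e1)
                 (real (card H) / (real n ^ 2 * ln (real n)) * real n powr r) \<le> T"
    if n: "2 \<le> n \<and> 1 \<le> ln (real n) \<and> real n powr (1/2) \<le> real n / ln (real n) ^ 2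
     \<and> 96 * real k \<le> real n powr (1/2 * e0) \<and> 2 * c1 ^ 2 \<le> real n powr (1/2 * (1 - e0 * a))
     \<and> 1 / c0 \<le> real n powr (1/2 * e1) \<and> 1 / c0 \<le> real n powr (2/3) / ln (real n)"
    and cA: "card A = n" and H: "\<forall>e\<in>H. e \<subseteq> A \<and> card e = 3" and big: "K * real n ^ 2 \<le> real (card H)"
    for n :: nat and A :: "'a set" and H
  proof -
    let ?L = "ln (real n)"
    have n0: "real n > 0" "n \<ge> 2" using n by auto
    have L1: "?L \<ge> 1" using n by simp
    have finA: "finite A" using cA n0 by (metis card.infinite not_numeral_le_zero)
    have finH: "finite H" using finA H by (meson finite_Pow_iff finite_subset PowI subsetI)
    define t where "t = real (card H) / real n ^ 2"
    define y where "y = real (card H) / (real n ^ 2 * ?L)"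
    have tK: "t \<ge> K" unfolding t_def using big n0 by (simp add: pos_le_divide_eq)
    have yt: "y = t / ?L" unfolding y_def t_def by simp
    have y1: "y \<ge> 1 / ?L" unfolding yt using tK K1 L1 by (intro divide_right_mono) auto
    have y0: "y > 0" using y1 L1 by (smt (verit) divide_pos_pos)
    define Q where "Q = real n * y powr a"
    \<comment> \<open>Since \<open>card H \<ge> n\<^sup>2\<close>, \<open>y\<close> is at least
      \<open>1 / ln n\<close>; even then \<open>Q\<close> is polynomially large, so positive powers
      of \<open>Q\<close> beat every constant.\<close>
    have Q1: "Q \<ge> real n powr (1/2)"
    proof -
      have "(1 / ?L) ^ 2 \<le> (1 / ?L) powr a"
      proof -
        have "(1 / ?L) powr 2 \<le> (1 / ?L) powr a" using L1 a2 by (intro powr_mono') auto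
        then show ?thesis using L1 by (simp add: powr_numeral)
      qed
      also have "\<dots> \<le> y powr a" using y1 L1 a2 by (intro powr_mono2) auto
      finally have "real n * (1 / ?L) ^ 2 \<le> Q" unfolding Q_def using n0 by (intro mult_left_mono) auto
      then show ?thesis using n by (simp add: power_one_over)
    qed
    have Q0: "Q > 0" unfolding Q_def using n0 y0 by simp
    have Qpow: "real n powr (1/2 * e) \<le> Q powr e" if "e > 0" for e
    proof -
      have "(real n powr (1/2)) powr e \<le> Q powr e" using Q1 that by (intro powr_mono2) auto
      then show ?thesis by (simp add: powr_powr)
    qed
    define d0 where "d0 = Q powr e0"
    have d0_ge: "96 * real k \<le> d0" unfolding d0_def using Qpow[OF e0_0] n by linarith
    define T where "T = c0 * min (Q powr e1) (y * real n powr r)"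
    have T1: "T \<ge> 1"
    proof -
      have A1: "1 / c0 \<le> Q powr e1" using Qpow[OF e1_0] n by linarith
      have "1 / c0 \<le> real n powr (2/3) / ?L" using n by simp
      also have "\<dots> \<le> real n powr r / ?L" using r23 n0 L1 by (intro divide_right_mono powr_mono) auto
      also have "\<dots> = 1 / ?L * real n powr r" by simp
      also have "\<dots> \<le> y * real n powr r" using y1 by (intro mult_right_mono) auto
      finally have "1 / c0 \<le> min (Q powr e1) (y * real n powr r)" using A1 by simp
      then have "c0 * (1 / c0) \<le> T" unfolding T_def using c0_0 by (intro mult_left_mono) auto
      then show ?thesis using c0_0 by simp
    qed
    have TQ: "T \<le> c0 * Q powr e1" "T \<le> c0 * (y * real n powr r)" unfolding T_def using c0_0 by (auto intro!: mult_left_mono)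
    have "\<exists>V. V \<subseteq> H \<and> V \<noteq> {} \<and> robust V (cycle_copies k V) T (1 / 2 ^ (k + 2) / 32)"
    proof -
      have d00: "d0 > 0" using d0_ge k4 by linarith
      have H3: "\<And>e. e \<in> H \<Longrightarrow> card e = 3" using H by auto
      from codegree_peeling[OF finH d00 H3] show ?thesis
      proof
        assume "\<exists>W'\<subseteq>H. W' \<noteq> {} \<and> (\<forall>f. card f = 2 \<longrightarrow> (\<exists>e\<in>W'. f \<subseteq> e) \<longrightarrow> d0 \<le> real (sdeg W' f))"
        then obtain V where V: "V \<subseteq> H" "V \<noteq> {}" "\<forall>f. card f = 2 \<longrightarrow> (\<exists>e\<in>V. f \<subseteq> e) \<longrightarrow> d0 \<le> real (sdeg V f)" by auto
        have "robust V (cycle_copies (2 * l) V) T (1 / 8)"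
        proof (rule robust_large_codegrees[OF finA _ _ V(2) l, where d = d0])
          show "card A \<ge> 2" using cA n0 by simp
          show "e \<subseteq> A \<and> card e = 3" if "e \<in> V" for e using V(1) H that by auto
          show "d0 \<le> real (sdeg V f)" if "card f = 2" "\<exists>e\<in>V. f \<subseteq> e" for f using V(3) that by auto
          show "96 * real (2 * l) \<le> d0" using d0_ge unfolding k_def .
          have "(49 * real k) powr g \<le> (49 * real k) powr 2" using g2 k4 by (intro powr_mono) auto
          also have "\<dots> = (49 * real k) ^ 2" using k4 by (simp add: powr_numeral)
          finally have p: "(49 * real k) powr g \<le> (49 * real k) ^ 2" .
          have "T \<le> 1 / (49 * real k) ^ 2 * Q powr e1" using TQ(1) c0_le(1) by (smt (verit) mult_right_mono powr_ge_zero)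
          also have "\<dots> = Q powr e1 / (49 * real k) ^ 2" by simp
          also have "\<dots> \<le> Q powr e1 / (49 * real k) powr g" using p k4 by (intro divide_left_mono) auto
          also have "\<dots> = (d0 / (49 * real k)) powr g" unfolding d0_def using Q0 k4 e0g by (simp add: powr_divide powr_powr)
          finally show "T \<le> (d0 / (49 * real (2 * l))) powr ((4 * real l - 3) / (2 * real l - 1))" unfolding g_def k_def .
        qed (use T1 in simp)
        then have "robust V (cycle_copies k V) T (1 / 2 ^ (k + 2) / 32)"
          unfolding k_def by (rule robust_mono_eps) (simp add: field_simps order_trans[OF one_le_power[of 2 "2*l"]])
        then show ?thesis using V by auto
      next
        assume "\<exists>\<phi>. (\<forall>e\<in>H. \<phi> e \<subseteq> e \<and> card (\<phi> e) = 2) \<and> (\<forall>f. real (card {e\<in>H. \<phi> e = f}) < d0)"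
        then obtain \<phi> where \<phi>: "\<And>e. e \<in> H \<Longrightarrow> \<phi> e \<subseteq> e \<and> card (\<phi> e) = 2" "\<And>f. real (card {e\<in>H. \<phi> e = f}) < d0" by auto
        define X where "X f = {e\<in>H. \<phi> e = f}" for f
        define w where "w f = real (card (X f))" for f
        define P where "P = {f. f \<subseteq> A \<and> card f = 2}"
        have finP: "finite P" unfolding P_def using finA by simp
        have cP: "real (card P) \<le> real n ^ 2 / 2"
        proof -
          have "card P = n choose 2" unfolding P_def using n_subsets[OF finA] cA by simp
          then have "card P * 2 \<le> n * (n - 1)" unfolding choose_two using div_times_less_eq_dividend by metis
          also have "\<dots> \<le> n * n" by simp
          finally have "card P * 2 \<le> n * n" .
          then have "real (card P) * 2 \<le> real n * real n" by (metis of_nat_le_iff of_nat_mult of_nat_numeral)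
          then show ?thesis by (simp add: power2_eq_square)
        qed
        have finX: "finite (X f)" for f unfolding X_def using finH by simp
        have total: "sum w P = real (card H)"
        proof -
          have "H = (\<Union>f\<in>P. X f)" unfolding P_def X_def using \<phi>(1) H by blast
          moreover have "card (\<Union>f\<in>P. X f) = (\<Sum>f\<in>P. card (X f))"
            using finP finX by (intro card_UN_disjoint) (auto simp: X_def)
          ultimately show ?thesis unfolding w_def by simp
        qed
        \<comment> \<open>There are at most \<open>n\<^sup>2 / 2\<close> pairs, so those with fewer
          than \<open>t = card H / n\<^sup>2\<close> triples carry at most half of \<open>H\<close>.
          The other fibres have size at least \<open>t \<ge> K\<close>, as
          \<open>robust_fibres\<close> requires.\<close>
        define R where "R = {f\<in>P. t \<le> w f}"
        have finR: "finite R" unfolding R_def using finP by simp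
        have t0: "t > 0" using tK K1 by linarith
        have sR: "real (card H) / 2 \<le> sum w R"
        proof -
          have "sum w P = sum w R + sum w (P - R)" using finP by (metis (no_types, lifting) R_def add.commute mem_Collect_eq subsetI sum.subset_diff)
          moreover have "sum w (P - R) \<le> (\<Sum>f\<in>P - R. t)" by (rule sum_mono) (auto simp: R_def)
          moreover have "(\<Sum>f\<in>P - R. t) \<le> real (card P) * t"
            using finP t0 by (simp add: card_mono mult_right_mono)
          moreover have "real (card P) * t \<le> real n ^ 2 / 2 * t" using cP t0 by (intro mult_right_mono) auto
          moreover have "real n ^ 2 / 2 * t = real (card H) / 2" unfolding t_def using n0 by simp
          ultimately show ?thesis using total by linarith
        qed
        define N where "N = nat \<lfloor>log 2 (real n ^ 3)\<rfloor> + 1"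
        have lg: "log 2 (real n ^ 3) \<le> 9/2 * ?L"
        proof -
          have "log 2 (real n ^ 3) = 3 * ?L / ln 2" using n0 by (simp add: log_def ln_realpow)
          also have "\<dots> \<le> 3 * ?L / (2/3)" using L1 ln2_ge_two_thirds by (intro divide_left_mono) auto
          finally show ?thesis by simp
        qed
        have lg0: "log 2 (real n ^ 3) \<ge> 0" using n0 by simp
        have N6: "real N \<le> 6 * ?L"
        proof -
          have "real N = of_int \<lfloor>log 2 (real n ^ 3)\<rfloor> + 1" unfolding N_def using lg0 by simp
          then show ?thesis using lg L1 of_int_floor_le[of "log 2 (real n ^ 3)"] by linarith
        qed
        have pN: "real n ^ 3 < 2 ^ N"
        proof -
          have "log 2 (real n ^ 3) < real N" unfolding N_def using lg0 by simp linarith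
          then have "2 powr log 2 (real n ^ 3) < 2 powr real N" by simp
          then show ?thesis using n0 by (simp add: powr_realpow)
        qed
        have wn: "w f \<le> real n ^ 3" for f
        proof -
          have "card H \<le> card {e. e \<subseteq> A \<and> card e = 3}" using finA H by (intro card_mono) auto
          also have "\<dots> = n choose 3" using n_subsets[OF finA] cA by simp
          also have "\<dots> \<le> n ^ 3" using binomial_le_pow2 by (cases "3 \<le> n") (auto simp: binomial_le_pow binomial_eq_0)
          finally have "card H \<le> n ^ 3" .
          moreover have "card (X f) \<le> card H" unfolding X_def using finH by (intro card_mono) auto
          ultimately have "card (X f) \<le> n ^ 3" by simp
          then show ?thesis unfolding w_def by (metis of_nat_mono of_nat_power)
        qed
        have "\<exists>i<N. sum w R \<le> real N * sum w {f\<in>R. t * 2 ^ i \<le> w f \<and> w f \<le> 2 * (t * 2 ^ i)}"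
        proof (rule dyadic_class[OF finR _ t0])
          show "t \<le> w f \<and> w f < t * 2 ^ N" if "f \<in> R" for f
          proof
            show "t \<le> w f" using that unfolding R_def by simp
            have "w f < 1 * 2 ^ N" using wn[of f] pN by simp
            also have "\<dots> \<le> t * 2 ^ N" using tK K1 by (intro mult_right_mono) auto
            finally show "w f < t * 2 ^ N" .
          qed
        qed (simp add: N_def)
        then obtain i where i: "sum w R \<le> real N * sum w {f\<in>R. t * 2 ^ i \<le> w f \<and> w f \<le> 2 * (t * 2 ^ i)}" by auto
        define d where "d = t * 2 ^ i"
        define G where "G = {f\<in>R. d \<le> w f \<and> w f \<le> 2 * d}"
        have td: "t \<le> d" unfolding d_def using t0 by simp
        have dpos: "d > 0" using td t0 by linarith
        have finG: "finite G" unfolding G_def using finR by simp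
        have hG: "real (card H) / 2 \<le> real N * (2 * d * real (card G))"
        proof -
          have "sum w G \<le> (\<Sum>f\<in>G. 2 * d)" by (rule sum_mono) (auto simp: G_def)
          then have "sum w G \<le> 2 * d * real (card G)" by (simp add: mult.commute)
          then have "real N * sum w G \<le> real N * (2 * d * real (card G))" by (intro mult_left_mono) auto
          then show ?thesis using sR i unfolding d_def G_def by linarith
        qed
        have hpos: "real (card H) > 0" using t0 n0 unfolding t_def by (simp add: zero_less_divide_iff)
        have Gne: "G \<noteq> {}" using hG hpos by auto
        have m0: "real (card G) > 0" using Gne finG by (simp add: card_gt_0_iff)
        \<comment> \<open>24 = 4 * 6: a factor 2 each for the light pairs and for the spread within
          a dyadic class, and 6 from \<open>N \<le> 6 * ln n\<close>.\<close>
        have dm: "y * real n ^ 2 \<le> 24 * (d * real (card G))"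
        proof -
          have "real (card H) \<le> 4 * (real N * (d * real (card G)))" using hG by simp
          also have "\<dots> \<le> 4 * (6 * ?L * (d * real (card G)))" using N6 dpos by (intro mult_left_mono mult_right_mono) auto
          finally have "real (card H) / ?L \<le> 24 * (d * real (card G))" using L1 by (simp add: pos_divide_le_eq mult_ac)
          moreover have "y * real n ^ 2 = real (card H) / ?L" unfolding y_def using n0 by simp
          ultimately show ?thesis by simp
        qed
        \<comment> \<open>Here the codegree threshold enters the graph case: peeling left only
          fibres smaller than \<open>d0\<close>.\<close>
        have dd0: "d \<le> d0"
        proof -
          obtain f where "f \<in> G" using Gne by auto
          then have "d \<le> w f" unfolding G_def by simp
          then show ?thesis using \<phi>(2)[of f] unfolding w_def X_def by linarith
        qed
        define x where "x = 64 * real l ^ 2 * real (card A) ^ 2 / real (card G)"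
        define Y where "Y = x powr (real l / (real l - 1))"
        have x0: "x > 0" unfolding x_def using cA n0 m0 rl by simp
        have Y0: "Y \<ge> 0" unfolding Y_def by simp
        have xle: "x \<le> c1 * d / y"
        proof -
          have "x * (y * real n ^ 2) \<le> x * (24 * (d * real (card G)))" using dm x0 by (intro mult_left_mono) auto
          also have "\<dots> = c1 * d * real n ^ 2" unfolding x_def c1_def cA using m0 by simp
          finally have "(x * y) * real n ^ 2 \<le> (c1 * d) * real n ^ 2" by (simp add: mult_ac)
          then have "x * y \<le> c1 * d" using n0 by (simp add: mult_le_cancel_right)
          then show ?thesis using y0 by (simp add: pos_le_divide_eq)
        qed
        \<comment> \<open>The bound on \<open>x\<close> is raised to the power \<open>a\<close>, and
          \<open>y powr a = Q / n\<close> is substituted.\<close>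
        have Yle: "Y \<le> c1 ^ 2 * d powr a * real n / Q"
        proof -
          have "Y \<le> (c1 * d / y) powr a" unfolding Y_def a_def[symmetric] using xle x0 a2 by (intro powr_mono2) auto
          also have "\<dots> = c1 powr a * d powr a / y powr a" using c1_1 dpos y0 by (simp add: powr_divide powr_mult)
          also have "\<dots> \<le> c1 ^ 2 * d powr a / y powr a"
          proof (intro divide_right_mono mult_right_mono)
            have "c1 powr a \<le> c1 powr 2" using c1_1 a2 by (intro powr_mono) auto
            then show "c1 powr a \<le> c1 ^ 2" using c1_1 by (simp add: powr_numeral)
          qed auto
          also have "\<dots> = c1 ^ 2 * d powr a * real n / Q" unfolding Q_def using n0 y0 by (simp add: field_simps)
          finally show ?thesis .
        qed
        have rob: "robust (\<Union>(X ` G)) (cycle_copies (2 * l) (\<Union>(X ` G))) T ((1 / 2 ^ (2 * l + 2)) / 32)"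
        proof (rule robust_fibres[OF finA _ Gne l _ finX, where d = d and x = x and Y = Y])
          show "f \<subseteq> A \<and> card f = 2" if "f \<in> G" for f using that unfolding G_def R_def P_def by simp
          show "f \<subseteq> e \<and> card e = 3" if "f \<in> G" "e \<in> X f" for f e using that \<phi>(1) H unfolding X_def by auto
          show "d \<le> real (card (X f)) \<and> real (card (X f)) \<le> 2 * d" if "f \<in> G" for f using that unfolding G_def w_def by simp
          show "X f \<inter> X f' = {}" if "f \<in> G" "f' \<in> G" "f \<noteq> f'" for f f' using that unfolding X_def by auto
          show "8 * (real (2 * l))\<^sup>2 \<le> d" using td tK unfolding K_def k_def by linarith
          show "T > 0" using T1 by linarith
          show "2 * Y \<le> real (card A)"
          proof -
            have "d powr a \<le> d0 powr a" using dd0 dpos a2 by (intro powr_mono2) auto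
            also have "\<dots> = Q powr (e0 * a)" unfolding d0_def by (simp add: powr_powr)
            finally have "2 * Y \<le> 2 * (c1 ^ 2 * Q powr (e0 * a) * real n / Q)"
              using Yle Q0 n0 c1_1 by (smt (verit) divide_right_mono mult_left_mono mult_right_mono zero_le_power2)
            also have "\<dots> = 2 * c1 ^ 2 * (Q powr (e0 * a) / Q powr 1) * real n" using Q0 by simp
            also have "Q powr (e0 * a) / Q powr 1 = 1 / Q powr (1 - e0 * a)" using Q0 by (simp add: powr_diff)
            also have "2 * c1 ^ 2 * (1 / Q powr (1 - e0 * a)) * real n \<le> 1 * real n"
            proof (rule mult_right_mono)
              have "2 * c1 ^ 2 \<le> Q powr (1 - e0 * a)" using Qpow[OF e0a] n by linarith
              then show "2 * c1 ^ 2 * (1 / Q powr (1 - e0 * a)) \<le> 1" using Q0 by (simp add: pos_divide_le_eq)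
            qed simp
            finally show ?thesis using cA by simp
          qed
          show "2 * Y * T \<le> d * real (card A)"
          proof -
            have da: "d powr a = d * d powr (a - 1)" using dpos by (simp add: powr_diff)
            have "d powr (a - 1) \<le> d0 powr (a - 1)" using dd0 dpos a2 by (intro powr_mono2) auto
            also have "\<dots> = Q powr (e0 * (a - 1))" unfolding d0_def by (simp add: powr_powr)
            finally have dq: "d powr (a - 1) \<le> Q powr (e0 * (a - 1))" .
            have T2: "T \<le> Q powr e1 / (2 * c1 ^ 2)"
            proof -
              have "c0 * Q powr e1 \<le> 1 / (2 * c1 ^ 2) * Q powr e1" using c0_le(2) by (intro mult_right_mono) auto
              then show ?thesis using TQ(1) by simp
            qed
            have "2 * Y * T \<le> 2 * (c1 ^ 2 * d powr a * real n / Q) * (Q powr e1 / (2 * c1 ^ 2))"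
              using Yle T2 T1 Q0 c1_1 n0 Y0 by (intro mult_mono) auto
            also have "\<dots> = d * real n / Q * (d powr (a - 1) * Q powr e1)" unfolding da using c1_1 by simp
            also have "\<dots> \<le> d * real n / Q * (Q powr (e0 * (a - 1)) * Q powr e1)"
              using dq dpos Q0 by (intro mult_left_mono mult_right_mono) auto
            also have "Q powr (e0 * (a - 1)) * Q powr e1 = Q" using e1e0 Q0 by (simp add: powr_add[symmetric] add.commute)
            finally show ?thesis using Q0 cA by simp
          qed
          show "8 * real (2 * l) ^ (2 * l) * x * T \<le> d * real (card A) powr ((2 * real l - 2) / (2 * real l - 1))"
          proof -
            have T3: "T \<le> y * real n powr r / (8 * real k ^ k * c1)"
            proof -
              have "c0 * (y * real n powr r) \<le> 1 / (8 * real k ^ k * c1) * (y * real n powr r)" using c0_le(3) y0 by (intro mult_right_mono) auto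
              then show ?thesis using TQ(2) by simp
            qed
            have "8 * real k ^ k * x * T \<le> 8 * real k ^ k * (c1 * d / y) * (y * real n powr r / (8 * real k ^ k * c1))"
              using xle T3 x0 T1 kk y0 dpos c1_1 by (intro mult_mono) auto
            also have "\<dots> = d * real n powr r" using kk c1_1 y0 by (simp add: field_simps)
            finally show ?thesis unfolding k_def r_def cA .
          qed
        qed (use x_def Y_def in simp_all)
        have "\<Union>(X ` G) \<subseteq> H" unfolding X_def by auto
        moreover have "\<Union>(X ` G) \<noteq> {}"
        proof -
          obtain f where "f \<in> G" using Gne by auto
          then have "w f > 0" using dpos unfolding G_def by auto
          then have "X f \<noteq> {}" unfolding w_def by auto
          then show ?thesis using \<open>f \<in> G\<close> by auto
        qed
        ultimately show ?thesis using rob unfolding k_def by blast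
      qed
    qed
    then obtain V where V: "V \<subseteq> H" "V \<noteq> {}" "robust V (cycle_copies k V) T (1 / 2 ^ (k + 2) / 32)" by blast
    show ?thesis
      by (rule exI[of _ V], rule exI[of _ T], intro conjI V T1) (simp add: T_def Q_def y_def)
  qed
  show ?thesis
  proof (rule exI[of _ c0], intro conjI c0_0, rule exI[of _ K], intro conjI K1)
    show "\<forall>\<^sub>F n::nat in sequentially. \<forall>(A::'a set) H. card A = n \<and> (\<forall>e\<in>H. e \<subseteq> A \<and> card e = 3) \<and>
       K * real n ^ 2 \<le> real (card H) \<longrightarrow> has_robust_subset l c0 n H"
    proof (rule eventually_mono[OF ev], intro allI impI, elim conjE)
      fix n :: nat and A :: "'a set" and H
      assume "2 \<le> n" "1 \<le> ln (real n)" "real n powr (1/2) \<le> real n / ln (real n) ^ 2"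
        "96 * real k \<le> real n powr (1/2 * e0)" "2 * c1 ^ 2 \<le> real n powr (1/2 * (1 - e0 * a))"
        "1 / c0 \<le> real n powr (1/2 * e1)" "1 / c0 \<le> real n powr (2/3) / ln (real n)"
        "card A = n" "\<forall>e\<in>H. e \<subseteq> A \<and> card e = 3" "K * real n ^ 2 \<le> real (card H)"
      then show "has_robust_subset l c0 n H"
        using main[of n A H] unfolding has_robust_subset_def k_def a_def e1_def r_def D_def by blast
    qed
  qed
qed

section \<open>Iteration\<close>


text \<open>\<open>\<Psi>\<close> is a potential: a step from \<open>h\<close> to at most
  \<open>h - x\<close> costs \<open>x * \<phi> h\<close>, and \<open>drop\<close> charges this to
  the decrease of \<open>\<Psi>\<close>, as if \<open>\<phi>\<close> were integrated. The last step
  may end below \<open>M\<close>, but because of \<open>x \<le> h / 2\<close> the accounting never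
  goes below \<open>M / 2\<close>.\<close>

lemma container_iterate:
  fixes M :: real and \<phi> \<Psi> :: "real \<Rightarrow> real" and good :: "'a set \<Rightarrow> bool"
  assumes M: "M > 0" and fin: "finite \<Omega>"
    and step: "\<And>H. H \<subseteq> \<Omega> \<Longrightarrow> M < real (card H) \<Longrightarrow>
       \<exists>x \<C>. 0 < x \<and> x \<le> real (card H) / 2 \<and> finite \<C> \<and> real (card \<C>) \<le> exp (x * \<phi> (real (card H))) \<and>
         (\<forall>C\<in>\<C>. C \<subseteq> H \<and> real (card C) \<le> real (card H) - x) \<and> (\<forall>I\<subseteq>H. good I \<longrightarrow> (\<exists>C\<in>\<C>. I \<subseteq> C))"
    and base: "\<Psi> (M / 2) \<ge> 0"
    and mono: "\<And>a b. M / 2 \<le> a \<Longrightarrow> a \<le> b \<Longrightarrow> \<Psi> a \<le> \<Psi> b"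
    and drop: "\<And>h x. M < h \<Longrightarrow> 0 < x \<Longrightarrow> x \<le> h / 2 \<Longrightarrow> x * \<phi> h \<le> \<Psi> h - \<Psi> (h - x)"
    and H: "H \<subseteq> \<Omega>"
  shows "\<exists>\<C>. finite \<C> \<and> real (card \<C>) \<le> exp (\<Psi> (max (real (card H)) (M / 2))) \<and>
     (\<forall>C\<in>\<C>. C \<subseteq> H \<and> real (card C) \<le> M) \<and> (\<forall>I\<subseteq>H. good I \<longrightarrow> (\<exists>C\<in>\<C>. I \<subseteq> C))"
  using H
proof (induction "card H" arbitrary: H rule: less_induct)
  case less
  show ?case
  proof (cases "M < real (card H)")
    case False
    have "0 \<le> \<Psi> (max (real (card H)) (M / 2))" using base mono[of "M/2" "max (real (card H)) (M / 2)"] by simp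
    then show ?thesis using False by (intro exI[of _ "{H}"]) auto
  next
    case True
    define h where "h = real (card H)"
    obtain x \<C> where x: "0 < x" "x \<le> h / 2" and C: "finite \<C>" "real (card \<C>) \<le> exp (x * \<phi> h)"
      "\<forall>C\<in>\<C>. C \<subseteq> H \<and> real (card C) \<le> h - x" "\<forall>I\<subseteq>H. good I \<longrightarrow> (\<exists>C\<in>\<C>. I \<subseteq> C)"
      using step[OF less.prems True, folded h_def] by (elim exE conjE) (rule that)
    have hM: "M < h" using True unfolding h_def .
    have ex: "\<exists>\<D>. finite \<D> \<and> real (card \<D>) \<le> exp (\<Psi> (h - x)) \<and>
     (\<forall>D\<in>\<D>. D \<subseteq> C \<and> real (card D) \<le> M) \<and> (\<forall>I\<subseteq>C. good I \<longrightarrow> (\<exists>D\<in>\<D>. I \<subseteq> D))" if CC: "C \<in> \<C>" for C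
    proof -
      have c: "C \<subseteq> H" "real (card C) \<le> h - x" using C(3) CC by auto
      have "real (card C) < real (card H)" using c(2) x(1) unfolding h_def by simp
      then have "card C < card H" by simp
      from less.hyps[OF this order_trans[OF c(1) less.prems]] obtain \<D> where D: "finite \<D>" "real (card \<D>) \<le> exp (\<Psi> (max (real (card C)) (M / 2)))"
        "\<forall>D\<in>\<D>. D \<subseteq> C \<and> real (card D) \<le> M" "\<forall>I\<subseteq>C. good I \<longrightarrow> (\<exists>D\<in>\<D>. I \<subseteq> D)"
        by (elim exE conjE) (rule that)
      have "\<Psi> (max (real (card C)) (M / 2)) \<le> \<Psi> (h - x)" using c(2) x(2) hM by (intro mono) auto
      then have "exp (\<Psi> (max (real (card C)) (M / 2))) \<le> exp (\<Psi> (h - x))" by simp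
      then have "real (card \<D>) \<le> exp (\<Psi> (h - x))" using D(2) by linarith
      then show ?thesis using D(1,3,4) by (intro exI[of _ \<D>] conjI)
    qed
    define F where "F C = (SOME \<D>. finite \<D> \<and> real (card \<D>) \<le> exp (\<Psi> (h - x)) \<and>
     (\<forall>D\<in>\<D>. D \<subseteq> C \<and> real (card D) \<le> M) \<and> (\<forall>I\<subseteq>C. good I \<longrightarrow> (\<exists>D\<in>\<D>. I \<subseteq> D)))" for C
    have F: "finite (F C)" "real (card (F C)) \<le> exp (\<Psi> (h - x))"
      "\<forall>D\<in>F C. D \<subseteq> C \<and> real (card D) \<le> M" "\<forall>I\<subseteq>C. good I \<longrightarrow> (\<exists>D\<in>F C. I \<subseteq> D)" if "C \<in> \<C>" for C
      using someI_ex[OF ex[OF that]] unfolding F_def[symmetric] by auto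
    have "card (\<Union>C\<in>\<C>. F C) \<le> (\<Sum>C\<in>\<C>. card (F C))" by (rule card_UN_le[OF C(1)])
    then have "real (card (\<Union>C\<in>\<C>. F C)) \<le> (\<Sum>C\<in>\<C>. real (card (F C)))" by (simp only: of_nat_sum[symmetric] of_nat_le_iff)
    also have "\<dots> \<le> (\<Sum>C\<in>\<C>. exp (\<Psi> (h - x)))" by (intro sum_mono F(2))
    also have "\<dots> = real (card \<C>) * exp (\<Psi> (h - x))" by simp
    also have "\<dots> \<le> exp (x * \<phi> h) * exp (\<Psi> (h - x))" using C(2) by (intro mult_right_mono) auto
    also have "\<dots> = exp (x * \<phi> h + \<Psi> (h - x))" by (simp add: exp_add)
    also have "\<dots> \<le> exp (\<Psi> h)" using drop[OF hM x] by simp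
    also have "h = max (real (card H)) (M / 2)" using True M unfolding h_def by simp
    finally have card: "real (card (\<Union>C\<in>\<C>. F C)) \<le> exp (\<Psi> (max (real (card H)) (M / 2)))" .
    show ?thesis
    proof (intro exI[of _ "\<Union>C\<in>\<C>. F C"] conjI card)
      show "finite (\<Union>C\<in>\<C>. F C)" using C(1) F(1) by auto
      show "\<forall>D\<in>\<Union>C\<in>\<C>. F C. D \<subseteq> H \<and> real (card D) \<le> M" using C(3) F(3) by (meson UN_E order_trans)
      show "\<forall>I\<subseteq>H. good I \<longrightarrow> (\<exists>D\<in>\<Union>C\<in>\<C>. F C. I \<subseteq> D)"
      proof (intro allI impI)
        fix I assume I: "I \<subseteq> H" "good I"
        then obtain C0 where C0: "C0 \<in> \<C>" "I \<subseteq> C0" using C(4) by blast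
        then obtain D where "D \<in> F C0" "I \<subseteq> D" using F(4)[OF C0(1)] I(2) by blast
        then show "\<exists>D\<in>\<Union>C\<in>\<C>. F C. I \<subseteq> D" using C0(1) by blast
      qed
    qed
  qed
qed

text \<open>Comparison with the integral of the decreasing function \<open>u powr (-1 - a)\<close>
  over the interval from \<open>h - x\<close> to \<open>h\<close>, derived from
  \<open>1 + v \<le> exp v\<close>.\<close>

lemma powr_minus_tangent:
  fixes a h x :: real
  assumes "a > 0" "0 < x" "x < h"
  shows "x * h powr (-1 - a) \<le> (1 / a) * (h - x) powr (-a) - (1 / a) * h powr (-a)"
proof -
  define u where "u = (h - x) / h"
  have u: "u > 0" "h - x = u * h" "1 - u = x / h" unfolding u_def using assms by (auto simp: field_simps)
  have "a * (1 - u) \<le> a * (- ln u)" using ln_le_minus_one[OF u(1)] assms(1) by (intro mult_left_mono) auto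
  then have "1 + a * (1 - u) \<le> 1 + (- a * ln u)" by simp
  also have "\<dots> \<le> exp (- a * ln u)" by (rule exp_ge_add_one_self)
  also have "\<dots> = u powr (- a)" using u(1) by (simp add: powr_def)
  finally have "a * (x / h) * h powr (-a) \<le> (u powr (-a) - 1) * h powr (-a)" unfolding u(3) by (intro mult_right_mono) auto
  also have "\<dots> = (h - x) powr (-a) - h powr (-a)" unfolding u(2) using u(1) assms by (simp add: powr_mult algebra_simps)
  also have "a * (x / h) * h powr (-a) = a * (x * h powr (-1 - a))"
  proof -
    have "-1 - a = -a - 1" by simp
    then have "h powr (-1 - a) = h powr (-a) / h" using assms powr_diff[of h "-a" 1] by (metis less_trans powr_one order_less_imp_le)
    then show ?thesis by simp
  qed
  finally have "x * h powr (-1 - a) \<le> ((h - x) powr (-a) - h powr (-a)) / a" using assms(1) by (simp add: pos_le_divide_eq mult.commute)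
  then show ?thesis by (simp add: diff_divide_distrib)
qed

text \<open>The same comparison for the integrand \<open>1 / u\<close>, the limiting case
  \<open>a = 0\<close>.\<close>

lemma ln_tangent:
  fixes h x :: real
  assumes "0 < x" "x < h"
  shows "x / h \<le> ln h - ln (h - x)"
proof -
  have "ln ((h - x) / h) \<le> (h - x) / h - 1" using assms by (intro ln_le_minus_one) auto
  then have "ln (h - x) - ln h \<le> (h - x) / h - 1" using assms by (simp add: ln_div)
  moreover have "(h - x) / h - 1 = - (x / h)" using assms by (simp add: field_simps)
  ultimately show ?thesis by linarith
qed

lemma linear_cycle_edges_not_free:
  assumes k: "k \<ge> 3" and G: "three_graph G" and S: "S \<subseteq> edges G" "linear_cycle_edges k S"
  shows "\<not> free_of (linear_cycle k) G"
proof -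
  obtain w u where wu: "inj_on w {..<k}" "inj_on u {..<k}" "w ` {..<k} \<inter> u ` {..<k} = {}"
    and Seq: "S = (\<lambda>i. {w i, w (Suc i mod k), u i}) ` {..<k}"
    using S(2) unfolding linear_cycle_edges_def by blast
  \<comment> \<open>Even labels go to shared vertices, odd ones to private vertices; the reduction
    modulo \<open>k\<close> sends the label \<open>2 * k\<close>, which stands for 0, to
    \<open>w 0\<close>.\<close>
  define f where "f j = (if even j then w (j div 2 mod k) else u (j div 2))" for j :: nat
  have mem: "j div 2 mod k \<in> {..<k}" "odd j \<Longrightarrow> j div 2 \<in> {..<k}" if "j \<in> {1..2*k}" for j
    using that k by (auto elim!: oddE)
  have inj: "inj_on f {1..2 * k}"
  proof (rule inj_onI)
    fix i j assume ij: "i \<in> {1..2*k}" "j \<in> {1..2*k}" "f i = f j"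
    have ne: "w a \<noteq> u b" if "a \<in> {..<k}" "b \<in> {..<k}" for a b using wu(3) that by blast
    consider "even i" "even j" | "odd i" "odd j" | "even i" "odd j" | "odd i" "even j" by auto
    then show "i = j"
    proof cases
      case 1
      then have "i div 2 mod k = j div 2 mod k" using ij wu(1) mem unfolding f_def by (auto dest!: inj_onD)
      moreover have "1 \<le> i div 2" "i div 2 \<le> k" "1 \<le> j div 2" "j div 2 \<le> k" using 1 ij by (auto elim!: evenE)
      ultimately have "i div 2 = j div 2" by (metis le_neq_implies_less mod_less mod_self not_one_le_zero)
      then show ?thesis using 1 by (metis dvd_mult_div_cancel)
    next
      case 2
      then have "i div 2 = j div 2" using ij wu(2) mem unfolding f_def by (auto dest: inj_onD)
      then show ?thesis using 2 by (metis odd_two_times_div_two_succ)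
    next
      case 3
      then show ?thesis using ij ne[OF mem(1)[OF ij(1)] mem(2)[OF ij(2)]] unfolding f_def by simp
    next
      case 4
      then show ?thesis using ij ne[OF mem(1)[OF ij(2)] mem(2)[OF ij(1)]] unfolding f_def by simp
    qed
  qed
  have edge: "f ` {if i = 1 then 2 * k else 2 * i - 2, 2 * i - 1, 2 * i} = {w (i - 1), w (Suc (i - 1) mod k), u (i - 1)}"
    if i: "i \<in> {1..k}" for i
  proof -
    obtain a where a: "i = Suc a" "a < k" using i by (cases i) auto
    have "f (if i = 1 then 2 * k else 2 * i - 2) = w a" unfolding f_def a(1) using a(2) by auto
    moreover have "f (2 * i - 1) = u a" unfolding f_def a(1) by simp
    moreover have "f (2 * i) = w (Suc a mod k)" unfolding f_def a(1) by simp
    ultimately show ?thesis unfolding a(1) by auto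
  qed
  have img: "(\<lambda>e. f ` e) ` edges (linear_cycle k) = S"
  proof -
    have "(\<lambda>e. f ` e) ` edges (linear_cycle k) = (\<lambda>i. {w (i - 1), w (Suc (i - 1) mod k), u (i - 1)}) ` {1..k}"
      unfolding linear_cycle_def snd_conv image_image using edge by (intro image_cong) auto
    also have "\<dots> = (\<lambda>i. {w i, w (Suc i mod k), u i}) ` ((\<lambda>i. i - 1) ` {1..k})" by (simp only: image_image)
    also have "(\<lambda>i. i - 1) ` {1..k} = {..<k}"
    proof
      show "{..<k} \<subseteq> (\<lambda>i. i - 1) ` {1..k}" by (auto intro!: image_eqI[of _ _ "Suc _"])
    qed auto
    finally show ?thesis unfolding Seq .
  qed
  let ?H = "(f ` {1..2 * k}, S)"
  have "isomorphic (linear_cycle k) ?H"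
    unfolding isomorphic_def
  proof (intro exI[of _ f] conjI)
    show "bij_betw f (verts (linear_cycle k)) (verts ?H)" unfolding linear_cycle_def using inj by (simp add: bij_betw_def)
    show "edges ?H = (\<lambda>e. f ` e) ` edges (linear_cycle k)" using img by simp
  qed
  moreover have "subgraph ?H G"
  proof -
    have "f j \<in> verts G" if j: "j \<in> {1..2 * k}" for j
    proof -
      have "f j \<in> \<Union>S"
      proof (cases "even j")
        case True
        then have "f j = w (j div 2 mod k)" unfolding f_def by simp
        then show ?thesis unfolding Seq using mem(1)[OF j] by auto
      next
        case False
        then have "f j = u (j div 2)" unfolding f_def by simp
        then show ?thesis unfolding Seq using mem(2)[OF j False] by auto
      qed
      then show ?thesis using S(1) G unfolding three_graph_def by auto
    qed
    then show ?thesis unfolding subgraph_def using S(1) by auto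
  qed
  ultimately show ?thesis unfolding free_of_def by auto
qed

text \<open>The bound on \<open>t\<close> is the value at which the two terms coincide; after
  multiplication by \<open>t powr a\<close> only identities between exponents remain.\<close>

lemma second_term_le_first:
  fixes X L N t :: real
  assumes X: "X \<ge> 2" and L: "L > 0" and N: "N > 0" and t: "t > 0"
    and small: "t \<le> N powr (1 / (4 * X - 2)) * L powr (- ((4 * X ^ 2 - 7 * X + 4) / (2 * X - 2)))"
  shows "L ^ 4 * N powr (2 * X / (2 * X - 1)) \<le>
     L powr (3 + (2 * X - 2) / (4 * X ^ 2 - 5 * X + 2)) * N powr ((4 * X ^ 2 - 3 * X + 1) / (4 * X ^ 2 - 5 * X + 2))
       * t powr (- ((2 * X - 2) / (4 * X ^ 2 - 5 * X + 2)))"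
proof -
  define D where "D = 4 * X ^ 2 - 5 * X + 2"
  define a where "a = (2 * X - 2) / D"
  have D0: "D > 0"
  proof -
    have "D = (X - 2) * (4 * X + 3) + 8" unfolding D_def by (simp add: algebra_simps power2_eq_square)
    then show ?thesis using X by (simp add: add_nonneg_pos)
  qed
  have a0: "a > 0" unfolding a_def using X D0 by simp
  have "t powr a \<le> (N powr (1 / (4 * X - 2)) * L powr (- ((4 * X ^ 2 - 7 * X + 4) / (2 * X - 2)))) powr a"
    using small t a0 by (intro powr_mono2) auto
  also have "\<dots> = N powr (1 / (4 * X - 2) * a) * L powr (- ((4 * X ^ 2 - 7 * X + 4) / (2 * X - 2)) * a)"
    using L N by (simp add: powr_mult powr_powr)
  finally have tp: "t powr a \<le> \<dots>" .
  have eN: "2 * X / (2 * X - 1) + 1 / (4 * X - 2) * a = (4 * X ^ 2 - 3 * X + 1) / D"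
  proof -
    have "(2 * X - 1) \<noteq> 0" using X by simp
    have "1 / (4 * X - 2) * a = (X - 1) / ((2 * X - 1) * D)"
    proof -
      have e: "4 * X - 2 = 2 * (2 * X - 1)" "2 * X - 2 = 2 * (X - 1)" by auto
      have "1 / (2 * p) * (2 * q / D) = q / (p * D)" for p q :: real by simp
      then show ?thesis unfolding a_def e .
    qed
    moreover have "u / p + q / (p * D) = (u * D + q) / (p * D)" if "p \<noteq> 0" for u p q :: real
      using that D0 by (simp add: add_divide_distrib)
    ultimately have "2 * X / (2 * X - 1) + 1 / (4 * X - 2) * a = (2 * X * D + (X - 1)) / ((2 * X - 1) * D)"
      using \<open>2 * X - 1 \<noteq> 0\<close> by metis
    also have "2 * X * D + (X - 1) = (4 * X ^ 2 - 3 * X + 1) * (2 * X - 1)"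
      unfolding D_def by (simp add: algebra_simps power2_eq_square power3_eq_cube)
    also have "\<dots> / ((2 * X - 1) * D) = (4 * X ^ 2 - 3 * X + 1) / D" using \<open>2 * X - 1 \<noteq> 0\<close> D0 by simp
    finally show ?thesis .
  qed
  have eL: "4 + - ((4 * X ^ 2 - 7 * X + 4) / (2 * X - 2)) * a = 3 + a"
  proof -
    have "(4 * X ^ 2 - 7 * X + 4) / (2 * X - 2) * a = (4 * X ^ 2 - 7 * X + 4) / D" unfolding a_def using X by simp
    moreover have "(4 * X ^ 2 - 7 * X + 4) / D = 1 - a"
    proof -
      have "4 * X ^ 2 - 7 * X + 4 = D - (2 * X - 2)" unfolding D_def by simp
      then have "(4 * X ^ 2 - 7 * X + 4) / D = D / D - (2 * X - 2) / D" by (simp only: diff_divide_distrib)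
      then show ?thesis unfolding a_def using D0 by (simp only: divide_self_if) simp
    qed
    ultimately show ?thesis unfolding mult_minus_left by linarith
  qed
  have "L ^ 4 * N powr (2 * X / (2 * X - 1)) * t powr a \<le> L ^ 4 * N powr (2 * X / (2 * X - 1)) *
     (N powr (1 / (4 * X - 2) * a) * L powr (- ((4 * X ^ 2 - 7 * X + 4) / (2 * X - 2)) * a))"
    using tp L by (intro mult_left_mono) auto
  also have "\<dots> = (L powr 4 * L powr (- ((4 * X ^ 2 - 7 * X + 4) / (2 * X - 2)) * a)) * (N powr (2 * X / (2 * X - 1)) * N powr (1 / (4 * X - 2) * a))"
    using L by (simp add: mult_ac powr_numeral)
  also have "\<dots> = L powr (3 + a) * N powr ((4 * X ^ 2 - 3 * X + 1) / D)"
    unfolding powr_add[symmetric] eN eL ..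
  finally have "L ^ 4 * N powr (2 * X / (2 * X - 1)) \<le> L powr (3 + a) * N powr ((4 * X ^ 2 - 3 * X + 1) / D) / t powr a"
    using t by (simp add: pos_le_divide_eq)
  then show ?thesis unfolding a_def[symmetric] D_def[symmetric] by (simp add: powr_minus divide_inverse)
qed

text \<open>\<open>\<alpha>\<close> and \<open>\<beta>\<close> are the coefficients with which the
  reciprocals of the two lower bounds on \<open>T\<close> become
  \<open>\<alpha> * h powr (-1 - a)\<close> and \<open>\<beta> / h\<close>. The last two claims
  compare the integrals of these, times \<open>L\<close>, with the two terms of the theorem up to
  constants.\<close>

lemma container_bound_arith:
  fixes X L N t M h :: real
  defines "D \<equiv> 4 * X ^ 2 - 5 * X + 2"
  defines "a \<equiv> (2 * X - 2) / D"
  defines "\<alpha> \<equiv> N powr (- ((4 * X - 3) * (X - 1) / D)) * L powr (1 + a) * N powr (2 * (1 + a))"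
  defines "\<beta> \<equiv> L * N powr (2 * X / (2 * X - 1))"
  assumes X: "X \<ge> 2" and L: "L \<ge> 1" and N: "N > 0"
  shows "D > 0" "0 < a" "a \<le> 1" "\<alpha> > 0" "\<beta> > 0"
    "h > 0 \<Longrightarrow> 1 / ((N * (h / (N ^ 2 * L)) powr (X / (X - 1))) powr ((4 * X - 3) * (X - 1) / D)) = \<alpha> * h powr (-1 - a)"
    "h > 0 \<Longrightarrow> 1 / (h / (N ^ 2 * L) * N powr ((2 * X - 2) / (2 * X - 1))) = \<beta> / h"
    "t > 0 \<Longrightarrow> L * (\<alpha> * (t * N ^ 2) powr (-a)) \<le> L powr (3 + a) * N powr ((4 * X ^ 2 - 3 * X + 1) / D) * t powr (-a)"
    "L * (\<beta> * L) \<le> L ^ 4 * N powr (2 * X / (2 * X - 1))"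
proof -
  define e1 where "e1 = (4 * X - 3) * (X - 1) / D"
  show D0: "D > 0"
  proof -
    have "D = (X - 2) * (4 * X + 3) + 8" unfolding D_def by (simp add: algebra_simps power2_eq_square)
    then show ?thesis using X by (simp add: add_nonneg_pos)
  qed
  show a0: "0 < a" unfolding a_def using X D0 by simp
  show "a \<le> 1"
  proof -
    have "D - (2 * X - 2) = (X - 2) * (4 * X + 1) + 6" unfolding D_def by (simp add: algebra_simps power2_eq_square)
    also have "\<dots> \<ge> 0" using X by simp
    finally show ?thesis unfolding a_def using D0 by simp
  qed
  show "\<alpha> > 0" "\<beta> > 0" unfolding \<alpha>_def \<beta>_def using N L by auto
  \<comment> \<open>The origin of the exponent \<open>a\<close>: the first lower bound on
    \<open>T\<close> grows like \<open>h powr (1 + a)\<close>.\<close>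
  have ea: "X / (X - 1) * e1 = 1 + a"
  proof -
    have "X / (X - 1) * e1 = X * (4 * X - 3) / D" unfolding e1_def using X by simp
    also have "X * (4 * X - 3) = D + (2 * X - 2)" unfolding D_def by (simp add: algebra_simps power2_eq_square)
    finally show ?thesis unfolding a_def using D0 by (simp add: add_divide_distrib)
  qed
  show "1 / ((N * (h / (N ^ 2 * L)) powr (X / (X - 1))) powr ((4 * X - 3) * (X - 1) / D)) = \<alpha> * h powr (-1 - a)" if h: "h > 0"
  proof -
    have "(N * (h / (N ^ 2 * L)) powr (X / (X - 1))) powr e1 = N powr e1 * (h / (N ^ 2 * L)) powr (1 + a)"
      using N by (subst powr_mult) (simp only: powr_powr ea)
    also have "\<dots> = N powr e1 * (h powr (1 + a) / (N powr (2 * (1 + a)) * L powr (1 + a)))"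
    proof -
      have "N ^ 2 = N powr 2" using N by (simp add: powr_numeral)
      then have NN: "(N ^ 2) powr (1 + a) = N powr (2 * (1 + a))" by (simp only: powr_powr)
      have "(h / (N ^ 2 * L)) powr (1 + a) = h powr (1 + a) / (N powr (2 * (1 + a)) * L powr (1 + a))"
        unfolding NN[symmetric] using h N L by (simp add: powr_divide powr_mult)
      then show ?thesis by simp
    qed
    finally have "1 / ((N * (h / (N ^ 2 * L)) powr (X / (X - 1))) powr e1) = (1 / N powr e1) * (N powr (2 * (1 + a)) * L powr (1 + a)) * (1 / h powr (1 + a))"
      by simp
    also have "1 / N powr e1 = N powr (- e1)" by (simp add: powr_minus divide_inverse)
    also have "1 / h powr (1 + a) = h powr (-1 - a)"
    proof -
      have "-1 - a = - (1 + a)" by simp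
      then show ?thesis by (simp only: powr_minus divide_inverse mult_1)
    qed
    finally show ?thesis unfolding \<alpha>_def e1_def by (simp add: mult_ac)
  qed
  show "1 / (h / (N ^ 2 * L) * N powr ((2 * X - 2) / (2 * X - 1))) = \<beta> / h" if h: "h > 0"
  proof -
    have "1 / (h / (N ^ 2 * L) * N powr ((2 * X - 2) / (2 * X - 1))) = L * (N ^ 2 / N powr ((2 * X - 2) / (2 * X - 1))) / h"
      using h by (simp add: mult.commute)
    also have "N ^ 2 / N powr ((2 * X - 2) / (2 * X - 1)) = N powr (2 - (2 * X - 2) / (2 * X - 1))"
      using N by (simp add: powr_diff powr_numeral)
    also have "2 - (2 * X - 2) / (2 * X - 1) = 2 * X / (2 * X - 1)" using X by (simp add: field_simps)
    finally show ?thesis unfolding \<beta>_def .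
  qed
  show "L * (\<alpha> * (t * N ^ 2) powr (-a)) \<le> L powr (3 + a) * N powr ((4 * X ^ 2 - 3 * X + 1) / D) * t powr (-a)" if t: "t > 0"
  proof -
    have NN: "N ^ 2 = N powr 2" using N by (simp add: powr_numeral)
    have "(N ^ 2) powr (-a) = N powr (- 2 * a)" unfolding NN powr_powr by simp
    then have "(t * N ^ 2) powr (-a) = t powr (-a) * N powr (- 2 * a)" using t N by (simp add: powr_mult)
    then have "L * (\<alpha> * (t * N ^ 2) powr (-a)) = (L powr 1 * L powr (1 + a)) * (N powr (- e1) * N powr (2 * (1 + a)) * N powr (- 2 * a)) * t powr (-a)"
      unfolding \<alpha>_def e1_def using L by (simp add: mult_ac)
    also have "N powr (- e1) * N powr (2 * (1 + a)) * N powr (- 2 * a) = N powr (2 - e1)"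
      by (simp add: powr_add[symmetric])
    also have "2 - e1 = (4 * X ^ 2 - 3 * X + 1) / D"
    proof -
      have "2 - e1 = (2 * D - (4 * X - 3) * (X - 1)) / D" unfolding e1_def using D0 by (simp add: diff_divide_distrib)
      also have "2 * D - (4 * X - 3) * (X - 1) = 4 * X ^ 2 - 3 * X + 1" unfolding D_def by (simp add: algebra_simps power2_eq_square)
      finally show ?thesis .
    qed
    also have "L powr 1 * L powr (1 + a) = L powr (2 + a)" unfolding powr_add[symmetric] by simp
    \<comment> \<open>One power of \<open>L\<close> is given away here.\<close>
    also have "L powr (2 + a) * N powr ((4 * X ^ 2 - 3 * X + 1) / D) * t powr (-a) \<le> L powr (3 + a) * N powr ((4 * X ^ 2 - 3 * X + 1) / D) * t powr (-a)"
      using L by (intro mult_right_mono powr_mono) auto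
    finally show ?thesis .
  qed
  show "L * (\<beta> * L) \<le> L ^ 4 * N powr (2 * X / (2 * X - 1))"
  proof -
    have "L ^ 3 \<le> L ^ 4" using L by (intro power_increasing) auto
    then have "L ^ 3 * N powr (2 * X / (2 * X - 1)) \<le> L ^ 4 * N powr (2 * X / (2 * X - 1))" by (intro mult_right_mono) auto
    then show ?thesis unfolding \<beta>_def by (simp add: power3_eq_cube mult_ac)
  qed
qed

text \<open>The ground set of the container argument consists of triples. A container for the part
  of a cycle-free system inside the robust \<open>V\<close> is extended by all of
  \<open>H - V\<close>, so every step shrinks \<open>H\<close> by at least
  \<open>\<delta> * card V\<close>.\<close>

lemma container_family:
  fixes l :: nat
  assumes l: "l \<ge> 2"
  defines "D \<equiv> 4 * real l ^ 2 - 5 * real l + 2"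
  shows "\<exists>c>0::real. \<exists>K>0::real. \<forall>\<^sub>F n::nat in sequentially. \<forall>(A::'a set) t::real. card A = n \<longrightarrow> t \<ge> K \<longrightarrow>
    (\<exists>\<C>. finite \<C> \<and> real (card \<C>) \<le> exp (c * max
         (ln (real n) powr (3 + (2 * real l - 2) / D) * real n powr ((4 * real l ^ 2 - 3 * real l + 1) / D) * t powr (- ((2 * real l - 2) / D)))
         (ln (real n) ^ 4 * real n powr (2 * real l / (2 * real l - 1)))) \<and>
       (\<forall>C\<in>\<C>. (\<forall>e\<in>C. e \<subseteq> A \<and> card e = 3) \<and> real (card C) \<le> t * real n ^ 2) \<and>
       (\<forall>I. (\<forall>e\<in>I. e \<subseteq> A \<and> card e = 3) \<and> \<not> (\<exists>S\<subseteq>I. linear_cycle_edges (2 * l) S) \<longrightarrow> (\<exists>C\<in>\<C>. I \<subseteq> C)))"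
  (is "\<exists>c>0. \<exists>K>0. \<forall>\<^sub>F n in sequentially. ?P c K n")
proof -
  define k where "k = 2 * l"
  define \<epsilon> :: real where "\<epsilon> = 1 / 2 ^ (2 * l + 2) / 32"
  define X where "X = real l"
  have X2: "X \<ge> 2" unfolding X_def using l by simp
  have D: "D = 4 * X ^ 2 - 5 * X + 2" unfolding D_def X_def ..
  have e0: "\<epsilon> > 0" unfolding \<epsilon>_def by simp
  have k2: "k \<ge> 2" "k \<ge> 3" unfolding k_def using l by auto
  have "\<exists>c0>0. \<exists>K\<ge>1. \<forall>\<^sub>F n::nat in sequentially. \<forall>(A::'a set) H. card A = n \<and> (\<forall>e\<in>H. e \<subseteq> A \<and> card e = 3) \<and>
     K * real n ^ 2 \<le> real (card H) \<longrightarrow>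
     has_robust_subset l c0 n H"
    using ex_robust_subset[OF l, where 'a='a] .
  then obtain c0 K where c0: "c0 > 0" and K: "K \<ge> 1" and evR: "\<forall>\<^sub>F n::nat in sequentially. \<forall>(A::'a set) H. card A = n \<and> (\<forall>e\<in>H. e \<subseteq> A \<and> card e = 3) \<and>
     K * real n ^ 2 \<le> real (card H) \<longrightarrow>
     has_robust_subset l c0 n H"
    by (elim exE conjE) (rule that)
  obtain \<delta> b where db: "0 < \<delta>" "\<delta> \<le> 1/2" "0 < b" and CR: "\<forall>(V::'a set set) H (T::real). finite V \<and> V \<noteq> {} \<and> T \<ge> 1 \<and> H \<subseteq> Pow V \<and>
      (\<forall>S\<in>H. card S = k) \<and> robust V H T \<epsilon> \<longrightarrow>
      (\<exists>\<C>. finite \<C> \<and> real (card \<C>) \<le> exp (b * (real (card V) / T) * ln (real (card V) + 1)) \<and>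
         (\<forall>C\<in>\<C>. C \<subseteq> V \<and> real (card C) \<le> (1 - \<delta>) * real (card V)) \<and>
         (\<forall>I\<subseteq>V. (\<forall>S\<in>H. \<not> S \<subseteq> I) \<longrightarrow> (\<exists>C\<in>\<C>. I \<subseteq> C)))"
    using container_robust[OF k2(1) e0, where 'a="'a set"] by (elim exE conjE) (rule that)
  define a where "a = (2 * X - 2) / D"
  define c where "c = 4 * b / (\<delta> * c0) * (2 / a + 3)"
  have a0: "0 < a" "a \<le> 1" unfolding a_def D using container_bound_arith(2,3)[OF X2, of 1 1] by auto
  have c_pos: "c > 0" unfolding c_def using db c0 a0 by (intro mult_pos_pos divide_pos_pos add_pos_pos) auto
  have ev2: "\<forall>\<^sub>F n::nat in sequentially. 2 \<le> n \<and> 1 \<le> ln (real n)"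
    by (intro eventually_conj eventually_ge_at_top) real_asymp
  have main: "\<exists>\<C>. finite \<C> \<and> real (card \<C>) \<le> exp (c * max
         (ln (real n) powr (3 + a) * real n powr ((4 * X ^ 2 - 3 * X + 1) / D) * t powr (- a))
         (ln (real n) ^ 4 * real n powr (2 * X / (2 * X - 1)))) \<and>
       (\<forall>C\<in>\<C>. (\<forall>e\<in>C. e \<subseteq> A \<and> card e = 3) \<and> real (card C) \<le> t * real n ^ 2) \<and>
       (\<forall>I. (\<forall>e\<in>I. e \<subseteq> A \<and> card e = 3) \<and> \<not> (\<exists>S\<subseteq>I. linear_cycle_edges k S) \<longrightarrow> (\<exists>C\<in>\<C>. I \<subseteq> C))"
    if n2: "2 \<le> n" and L1: "1 \<le> ln (real n)" and t: "t \<ge> K" and cA: "card A = n"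
      and R: "\<forall>H. card A = n \<and> (\<forall>e\<in>H. e \<subseteq> A \<and> card e = 3) \<and>
     K * real n ^ 2 \<le> real (card H) \<longrightarrow>
     has_robust_subset l c0 n H"
    for n :: nat and t :: real and A :: "'a set"
  proof -
    let ?N = "real n" and ?L = "ln (real n)"
    have N0: "?N > 0" using n2 by simp
    have finA: "finite A" using cA n2 by (metis card.infinite not_numeral_le_zero)
    define \<alpha> where "\<alpha> = ?N powr (- ((4 * X - 3) * (X - 1) / D)) * ?L powr (1 + a) * ?N powr (2 * (1 + a))"
    define \<beta> where "\<beta> = ?L * ?N powr (2 * X / (2 * X - 1))"
    note ar = container_bound_arith[OF X2 L1 N0, folded D, folded a_def, folded \<alpha>_def \<beta>_def]
    define \<Omega> where "\<Omega> = {e. e \<subseteq> A \<and> card e = 3}"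
    have fin\<Omega>: "finite \<Omega>" unfolding \<Omega>_def using finA by simp
    have card\<Omega>: "real (card \<Omega>) \<le> ?N ^ 3"
    proof -
      have "card \<Omega> = n choose 3" unfolding \<Omega>_def using n_subsets[OF finA] cA by simp
      also have "\<dots> \<le> n ^ 3" by (cases "3 \<le> n") (auto simp: binomial_le_pow binomial_eq_0)
      finally show ?thesis by (metis of_nat_mono of_nat_power)
    qed
    define M where "M = t * ?N ^ 2"
    have t1: "t \<ge> 1" using t K by linarith
    have M4: "M \<ge> 4"
    proof -
      have "1 * 2 ^ 2 \<le> t * ?N ^ 2" using t1 n2 by (intro mult_mono power_mono) auto
      then show ?thesis unfolding M_def by simp
    qed
    \<comment> \<open>The cost is expressed per removed triple: \<open>4 * ?L\<close> bounds
      \<open>ln (card V + 1)\<close>, \<open>1 / c0\<close> comes from the lower bound on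
      \<open>T\<close>, and \<open>1 / \<delta>\<close> from
      \<open>x = \<delta> * card V\<close>.\<close>
    define B where "B = 4 * b * ?L / (\<delta> * c0)"
    have B0: "B \<ge> 0" unfolding B_def using db c0 L1 by simp
    define \<phi> where "\<phi> h = B * (\<alpha> * h powr (-1 - a) + \<beta> / h)" for h
    define \<Psi> where "\<Psi> h = B * (\<alpha> * (1 / a * (M / 2) powr (-a) - 1 / a * h powr (-a)) + \<beta> * (ln h - ln (M / 2)))" for h
    define good where "good I \<longleftrightarrow> \<not> (\<exists>S\<subseteq>I. linear_cycle_edges k S)" for I :: "'a set set"
    have "\<exists>\<C>. finite \<C> \<and> real (card \<C>) \<le> exp (\<Psi> (max (real (card \<Omega>)) (M / 2))) \<and>
       (\<forall>C\<in>\<C>. C \<subseteq> \<Omega> \<and> real (card C) \<le> M) \<and> (\<forall>I\<subseteq>\<Omega>. good I \<longrightarrow> (\<exists>C\<in>\<C>. I \<subseteq> C))"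
    proof (rule container_iterate[OF _ fin\<Omega>, where \<phi> = \<phi> and H = \<Omega>])
      show "M > 0" using M4 by simp
      show "0 \<le> \<Psi> (M / 2)" unfolding \<Psi>_def by simp
      show "\<Psi> u \<le> \<Psi> v" if uv: "M / 2 \<le> u" "u \<le> v" for u v
      proof -
        have u0: "u > 0" using uv M4 by linarith
        have "v powr (-a) \<le> u powr (-a)" using u0 uv a0 by (intro powr_mono2') auto
        then have "1 / a * v powr (-a) \<le> 1 / a * u powr (-a)" using a0 by (intro mult_left_mono) auto
        moreover have "ln u \<le> ln v" using u0 uv by simp
        ultimately show ?thesis unfolding \<Psi>_def using B0 ar(4,5)
          by (intro mult_left_mono add_mono) auto
      qed
      show "x * \<phi> h \<le> \<Psi> h - \<Psi> (h - x)" if hx: "M < h" "0 < x" "x \<le> h / 2" for h x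
      proof -
        have xh: "x < h" using hx M4 by linarith
        have "x * h powr (-1 - a) \<le> (1 / a) * (h - x) powr (-a) - (1 / a) * h powr (-a)" using a0(1) hx(2) xh by (rule powr_minus_tangent)
        then have l1: "\<alpha> * (x * h powr (-1 - a)) \<le> \<alpha> * ((1 / a) * (h - x) powr (-a) - (1 / a) * h powr (-a))" using ar(4) by (intro mult_left_mono) auto
        have l2: "\<beta> * (x / h) \<le> \<beta> * (ln h - ln (h - x))" using ln_tangent[OF hx(2) xh] ar(5) by (intro mult_left_mono) auto
        have "B * (\<alpha> * (x * h powr (-1 - a)) + \<beta> * (x / h)) \<le> B * (\<alpha> * ((1 / a) * (h - x) powr (-a) - (1 / a) * h powr (-a)) + \<beta> * (ln h - ln (h - x)))"
          by (rule mult_left_mono[OF add_mono[OF l1 l2] B0])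
        moreover have "x * \<phi> h = B * (\<alpha> * (x * h powr (-1 - a)) + \<beta> * (x / h))" unfolding \<phi>_def by (simp add: algebra_simps)
        moreover have "\<Psi> h - \<Psi> (h - x) = B * (\<alpha> * ((1 / a) * (h - x) powr (-a) - (1 / a) * h powr (-a)) + \<beta> * (ln h - ln (h - x)))"
          unfolding \<Psi>_def by (simp only: right_diff_distrib distrib_left)
        ultimately show ?thesis by linarith
      qed
      show "\<exists>x \<C>. 0 < x \<and> x \<le> real (card H) / 2 \<and> finite \<C> \<and> real (card \<C>) \<le> exp (x * \<phi> (real (card H))) \<and>
         (\<forall>C\<in>\<C>. C \<subseteq> H \<and> real (card C) \<le> real (card H) - x) \<and> (\<forall>I\<subseteq>H. good I \<longrightarrow> (\<exists>C\<in>\<C>. I \<subseteq> C))"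
        if H: "H \<subseteq> \<Omega>" "M < real (card H)" for H
      proof -
        define h where "h = real (card H)"
        have h0: "h > 0" using H(2) M4 unfolding h_def by linarith
        have finH: "finite H" using H(1) fin\<Omega> finite_subset by auto
        have "K * ?N ^ 2 \<le> M" unfolding M_def using t by (intro mult_right_mono) auto
        then have hK: "K * ?N ^ 2 \<le> real (card H)" using H(2) by linarith
        have H3: "\<forall>e\<in>H. e \<subseteq> A \<and> card e = 3" using H(1) unfolding \<Omega>_def by auto
        define T1 where "T1 = (?N * (h / (?N ^ 2 * ?L)) powr (X / (X - 1))) powr ((4 * X - 3) * (X - 1) / D)"
        define T2 where "T2 = h / (?N ^ 2 * ?L) * ?N powr ((2 * X - 2) / (2 * X - 1))"
        have "?L > 0" using L1 by linarith
        then have T12: "T1 > 0" "T2 > 0" unfolding T1_def T2_def using h0 N0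
          by (auto intro!: divide_pos_pos mult_pos_pos)
        obtain V T where V: "V \<subseteq> H" "V \<noteq> {}" "1 \<le> T" "robust V (cycle_copies k V) T \<epsilon>" "c0 * min T1 T2 \<le> T"
          using R[rule_format, of H] cA H3 hK
          unfolding has_robust_subset_def T1_def T2_def h_def k_def \<epsilon>_def X_def D_def by blast
        have finV: "finite V" using V(1) finH finite_subset by auto
        have cV: "real (card V) \<ge> 1" using finV V(2) by (simp add: Suc_le_eq card_gt_0_iff)
        have "\<exists>\<C>. finite \<C> \<and> real (card \<C>) \<le> exp (b * (real (card V) / T) * ln (real (card V) + 1)) \<and>
         (\<forall>C\<in>\<C>. C \<subseteq> V \<and> real (card C) \<le> (1 - \<delta>) * real (card V)) \<and>
         (\<forall>I\<subseteq>V. (\<forall>S\<in>cycle_copies k V. \<not> S \<subseteq> I) \<longrightarrow> (\<exists>C\<in>\<C>. I \<subseteq> C))"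
        proof (rule CR[rule_format], intro conjI)
          show "cycle_copies k V \<subseteq> Pow V" unfolding cycle_copies_def by auto
          show "\<forall>S\<in>cycle_copies k V. card S = k" unfolding cycle_copies_def using linear_cycle_card(1)[of k] k2 by auto
        qed (use finV V in auto)
        then obtain \<C> where C: "finite \<C>" "real (card \<C>) \<le> exp (b * (real (card V) / T) * ln (real (card V) + 1))"
         "\<forall>C\<in>\<C>. C \<subseteq> V \<and> real (card C) \<le> (1 - \<delta>) * real (card V)"
         "\<forall>I\<subseteq>V. (\<forall>S\<in>cycle_copies k V. \<not> S \<subseteq> I) \<longrightarrow> (\<exists>C\<in>\<C>. I \<subseteq> C)" by (elim exE conjE) (rule that)
        define x where "x = \<delta> * real (card V)"
        have VH: "card V \<le> card H" using V(1) finH by (intro card_mono) auto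
        have lnV: "ln (real (card V) + 1) \<le> 4 * ?L"
        proof -
          have "card H \<le> card \<Omega>" using H(1) fin\<Omega> by (intro card_mono) auto
          then have "real (card V) \<le> ?N ^ 3" using VH card\<Omega> by linarith
          moreover have "1 \<le> ?N ^ 3" using n2 by (intro one_le_power) simp
          moreover have "2 * ?N ^ 3 \<le> ?N * ?N ^ 3" using n2 by (intro mult_right_mono) auto
          ultimately have "real (card V) + 1 \<le> ?N ^ 4" by (simp add: power_numeral_reduce)
          then have "ln (real (card V) + 1) \<le> ln (?N ^ 4)" using cV N0 by (subst ln_le_cancel_iff) auto
          also have "\<dots> = 4 * ?L" using N0 by (simp add: ln_realpow)
          finally show ?thesis .
        qed
        have iT: "1 / T \<le> 1 / c0 * (1 / T1 + 1 / T2)"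
        proof -
          have mp: "min T1 T2 > 0" using T12 by simp
          have "1 / T \<le> 1 / (c0 * min T1 T2)" using V(5) V(3) mp c0 by (intro divide_left_mono) auto
          also have "\<dots> = 1 / c0 * (1 / min T1 T2)" by simp
          also have "\<dots> \<le> 1 / c0 * (1 / T1 + 1 / T2)"
            using T12 c0 by (intro mult_left_mono) (auto simp: min_def)
          finally show ?thesis .
        qed
        have cost: "b * (real (card V) / T) * ln (real (card V) + 1) \<le> x * \<phi> h"
        proof -
          have "b * (real (card V) / T) * ln (real (card V) + 1) \<le> b * (real (card V) / T) * (4 * ?L)"
            using lnV db(3) V(3) by (intro mult_left_mono) auto
          also have "\<dots> = 4 * b * ?L * real (card V) * (1 / T)" by simp
          also have "\<dots> \<le> 4 * b * ?L * real (card V) * (1 / c0 * (1 / T1 + 1 / T2))"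
            using iT db(3) L1 by (intro mult_left_mono) auto
          also have "1 / T1 + 1 / T2 = \<alpha> * h powr (-1 - a) + \<beta> / h" unfolding T1_def T2_def ar(6)[OF h0] ar(7)[OF h0] ..
          also have "4 * b * ?L * real (card V) * (1 / c0 * (\<alpha> * h powr (-1 - a) + \<beta> / h)) = x * \<phi> h"
            unfolding x_def \<phi>_def B_def using db(1) by simp
          finally show ?thesis .
        qed
        define \<C>' where "\<C>' = (\<lambda>C. C \<union> (H - V)) ` \<C>"
        have C1: "real (card \<C>') \<le> exp (x * \<phi> h)"
        proof -
          have "card \<C>' \<le> card \<C>" unfolding \<C>'_def using C(1) by (rule card_image_le)
          moreover have "exp (b * (real (card V) / T) * ln (real (card V) + 1)) \<le> exp (x * \<phi> h)" using cost by simp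
          ultimately show ?thesis using C(2) by linarith
        qed
        have C2: "D' \<subseteq> H \<and> real (card D') \<le> h - x" if D': "D' \<in> \<C>'" for D'
        proof -
          obtain C where CC: "C \<in> \<C>" "D' = C \<union> (H - V)" using D' unfolding \<C>'_def by auto
          have "card D' \<le> card C + card (H - V)" unfolding CC(2) by (rule card_Un_le)
          moreover have "card (H - V) = card H - card V" using V(1) finV by (simp add: card_Diff_subset)
          ultimately have "real (card D') \<le> real (card C) + (h - real (card V))" unfolding h_def using VH by linarith
          moreover have "real (card C) \<le> (1 - \<delta>) * real (card V)" "C \<subseteq> V" using C(3) CC(1) by auto
          ultimately show ?thesis using CC(2) V(1) unfolding x_def by (auto simp: algebra_simps)
        qed
        have C3: "\<exists>C\<in>\<C>'. I \<subseteq> C" if I: "I \<subseteq> H" "good I" for I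
        proof -
          have "\<forall>S\<in>cycle_copies k V. \<not> S \<subseteq> I \<inter> V" using I(2) unfolding good_def cycle_copies_def by auto
          then obtain C where "C \<in> \<C>" "I \<inter> V \<subseteq> C" using C(4)[rule_format, of "I \<inter> V"] by auto
          then show ?thesis unfolding \<C>'_def using I(1) by (intro bexI[of _ "C \<union> (H - V)"]) auto
        qed
        have xpos: "0 < x" unfolding x_def using db cV by simp
        have xhalf: "x \<le> h / 2"
        proof -
          have "\<delta> * real (card V) \<le> 1 / 2 * real (card H)" using db VH by (intro mult_mono) auto
          then show ?thesis unfolding x_def h_def by simp
        qed
        have finC': "finite \<C>'" unfolding \<C>'_def using C(1) by simp
        show ?thesis unfolding h_def[symmetric]
          by (rule exI[of _ x], rule exI[of _ \<C>'], intro conjI xpos xhalf finC' C1 ballI allI impI C3)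
            (use C2 in auto)
      qed
    qed auto
    then obtain \<C> where C: "finite \<C>" "real (card \<C>) \<le> exp (\<Psi> (max (real (card \<Omega>)) (M / 2)))"
       "\<forall>C\<in>\<C>. C \<subseteq> \<Omega> \<and> real (card C) \<le> M" "\<forall>I\<subseteq>\<Omega>. good I \<longrightarrow> (\<exists>C\<in>\<C>. I \<subseteq> C)" by (elim exE conjE) (rule that)
    define F1 where "F1 = ?L powr (3 + a) * ?N powr ((4 * X ^ 2 - 3 * X + 1) / D) * t powr (- a)"
    define F2 where "F2 = ?L ^ 4 * ?N powr (2 * X / (2 * X - 1))"
    have F0: "F1 \<ge> 0" "F2 \<ge> 0" unfolding F1_def F2_def by auto
    have "\<Psi> (max (real (card \<Omega>)) (M / 2)) \<le> B * (\<alpha> * (2 / a * M powr (-a)) + \<beta> * (3 * ?L))"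
    proof -
      define m where "m = max (real (card \<Omega>)) (M / 2)"
      have mM: "M / 2 \<le> m" "m > 0" unfolding m_def using M4 by auto
      \<comment> \<open>The potential is followed from at most \<open>n ^ 3\<close> triples down to
        \<open>M / 2 \<ge> 2\<close>, so the logarithmic part contributes at most
        \<open>3 * ?L\<close>.\<close>
      have "ln m - ln (M / 2) \<le> 3 * ?L"
      proof -
        have m3: "m \<le> max (?N ^ 3) (M / 2)" unfolding m_def using card\<Omega> by linarith
        have "0 \<le> ln (M / 2)" using M4 by simp
        show ?thesis
        proof (cases "?N ^ 3 \<le> M / 2")
          case True
          then have "ln m \<le> ln (M / 2)" using m3 mM by (subst ln_le_cancel_iff) auto
          then show ?thesis using L1 by linarith
        next
          case False
          then have "ln m \<le> ln (?N ^ 3)" using m3 mM N0 by (subst ln_le_cancel_iff) auto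
          then show ?thesis using N0 \<open>0 \<le> ln (M / 2)\<close> by (simp add: ln_realpow)
        qed
      qed
      moreover have "1 / a * (M / 2) powr (-a) - 1 / a * m powr (-a) \<le> 2 / a * M powr (-a)"
      proof -
        \<comment> \<open>Accounting down to \<open>M / 2\<close> instead of \<open>M\<close> costs
          the factor \<open>2 powr a \<le> 2\<close>.\<close>
        have "(M / 2) powr (-a) = M powr (-a) / 2 powr (-a)" using M4 by (subst powr_divide) auto
        also have "\<dots> = M powr (-a) * 2 powr a" by (simp only: powr_minus divide_inverse inverse_inverse_eq)
        also have "\<dots> \<le> M powr (-a) * 2 powr (1::real)" using a0 by (intro mult_left_mono powr_mono) auto
        finally have "1 / a * (M / 2) powr (-a) \<le> 1 / a * (M powr (-a) * 2)" using a0 by (intro mult_left_mono) auto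
        moreover have "1 / a * m powr (-a) \<ge> 0" using a0 by simp
        ultimately show ?thesis by (simp add: mult.commute)
      qed
      ultimately show ?thesis unfolding \<Psi>_def m_def[symmetric] using B0 ar(4,5) by (intro mult_left_mono add_mono) auto
    qed
    also have "\<dots> = 4 * b / (\<delta> * c0) * (2 / a * (?L * (\<alpha> * (t * ?N ^ 2) powr (-a))) + 3 * (?L * (\<beta> * ?L)))"
      unfolding B_def M_def by (simp add: algebra_simps)
    also have "\<dots> \<le> 4 * b / (\<delta> * c0) * (2 / a * F1 + 3 * F2)"
      unfolding F1_def F2_def using ar(8)[of t] ar(9) t1 a0 db c0 by (intro mult_left_mono add_mono) auto
    also have "\<dots> \<le> 4 * b / (\<delta> * c0) * (2 / a * max F1 F2 + 3 * max F1 F2)"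
      using a0 db c0 by (intro mult_left_mono add_mono) auto
    also have "\<dots> = c * max F1 F2" unfolding c_def by (simp only: distrib_right mult.assoc)
    finally have "\<Psi> (max (real (card \<Omega>)) (M / 2)) \<le> c * max F1 F2" .
    then have "exp (\<Psi> (max (real (card \<Omega>)) (M / 2))) \<le> exp (c * max F1 F2)" by simp
    then have "real (card \<C>) \<le> exp (c * max F1 F2)" using C(2) by linarith
    then show ?thesis
    proof (intro exI[of _ \<C>] conjI C(1) ballI allI impI)
      show "real (card \<C>) \<le> exp (c * max (?L powr (3 + a) * ?N powr ((4 * X\<^sup>2 - 3 * X + 1) / D) * t powr - a)
        (?L ^ 4 * ?N powr (2 * X / (2 * X - 1))))"
        if "real (card \<C>) \<le> exp (c * max F1 F2)" using that unfolding F1_def F2_def .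
      show "e \<subseteq> A" "card e = 3" if "C \<in> \<C>" "e \<in> C" for C e using C(3) that unfolding \<Omega>_def by auto
      show "real (card C) \<le> t * ?N ^ 2" if "C \<in> \<C>" for C using C(3) that unfolding M_def by auto
      show "\<exists>C\<in>\<C>. I \<subseteq> C" if "(\<forall>e\<in>I. e \<subseteq> A \<and> card e = 3) \<and> \<not> (\<exists>S\<subseteq>I. linear_cycle_edges k S)" for I
        using C(4)[rule_format, of I] that unfolding good_def \<Omega>_def by auto
    qed
  qed
  show ?thesis
  proof (rule exI[of _ c], intro conjI c_pos, rule exI[of _ K], intro conjI)
    show "K > 0" using K by simp
    show "\<forall>\<^sub>F n in sequentially. ?P c K n"
      using eventually_conj[OF ev2 evR]
    proof (rule eventually_mono, intro allI impI)
      fix n :: nat and A :: "'a set" and t :: real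
      assume h: "(2 \<le> n \<and> 1 \<le> ln (real n)) \<and> (\<forall>(A::'a set) H. card A = n \<and> (\<forall>e\<in>H. e \<subseteq> A \<and> card e = 3) \<and>
     K * real n ^ 2 \<le> real (card H) \<longrightarrow>
     has_robust_subset l c0 n H)"
        "card A = n" "K \<le> t"
      show "\<exists>\<C>. finite \<C> \<and> real (card \<C>) \<le> exp (c * max
         (ln (real n) powr (3 + (2 * real l - 2) / D) * real n powr ((4 * real l ^ 2 - 3 * real l + 1) / D) * t powr (- ((2 * real l - 2) / D)))
         (ln (real n) ^ 4 * real n powr (2 * real l / (2 * real l - 1)))) \<and>
       (\<forall>C\<in>\<C>. (\<forall>e\<in>C. e \<subseteq> A \<and> card e = 3) \<and> real (card C) \<le> t * real n ^ 2) \<and>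
       (\<forall>I. (\<forall>e\<in>I. e \<subseteq> A \<and> card e = 3) \<and> \<not> (\<exists>S\<subseteq>I. linear_cycle_edges (2 * l) S) \<longrightarrow> (\<exists>C\<in>\<C>. I \<subseteq> C))"
        unfolding X_def[symmetric] k_def[symmetric] a_def[symmetric]
        by (rule main[OF h(1)[THEN conjunct1, THEN conjunct1] h(1)[THEN conjunct1, THEN conjunct2] h(3,2)
              h(1)[THEN conjunct2, THEN spec]])
    qed
  qed
qed

theorem theorem3p4:
  fixes l :: nat
  assumes "l \<ge> 2"
  shows "\<exists>c>0::real. \<exists>K>0::real. \<forall>\<^sub>F n :: nat in sequentially. \<forall>t::real. t \<ge> K \<longrightarrow>
    (\<exists>C \<subseteq> three_graphs_on {1..n}.
       real (card C) \<le> exp (c * max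
         (ln (real n) powr (3 + (2 * real l - 2) / (4 * real l ^ 2 - 5 * real l + 2))
            * real n powr ((4 * real l ^ 2 - 3 * real l + 1) / (4 * real l ^ 2 - 5 * real l + 2))
            * t powr (- ((2 * real l - 2) / (4 * real l ^ 2 - 5 * real l + 2))))
         (ln (real n) ^ 4 * real n powr (2 * real l / (2 * real l - 1)))) \<and>
       (\<forall>G\<in>C. real (card (edges G)) \<le> t * real n ^ 2) \<and>
       (\<forall>H\<in>three_graphs_on {1..n}. free_of (linear_cycle (2 * l)) H \<longrightarrow> (\<exists>G\<in>C. subgraph H G)) \<and>
       (t \<le> real n powr (1 / (4 * real l - 2))
              * ln (real n) powr (- ((4 * real l ^ 2 - 7 * real l + 4) / (2 * real l - 2))) \<longrightarrow>
        real (card C) \<le> exp (c *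
         (ln (real n) powr (3 + (2 * real l - 2) / (4 * real l ^ 2 - 5 * real l + 2))
            * real n powr ((4 * real l ^ 2 - 3 * real l + 1) / (4 * real l ^ 2 - 5 * real l + 2))
            * t powr (- ((2 * real l - 2) / (4 * real l ^ 2 - 5 * real l + 2)))))))"
proof -
  let ?F1 = "\<lambda>n t. ln (real n) powr (3 + (2 * real l - 2) / (4 * real l ^ 2 - 5 * real l + 2))
            * real n powr ((4 * real l ^ 2 - 3 * real l + 1) / (4 * real l ^ 2 - 5 * real l + 2))
            * t powr (- ((2 * real l - 2) / (4 * real l ^ 2 - 5 * real l + 2)))"
  let ?F2 = "\<lambda>n. ln (real n) ^ 4 * real n powr (2 * real l / (2 * real l - 1))"
  obtain c K where c: "c > 0" and K: "K > 0" and ev: "\<forall>\<^sub>F n::nat in sequentially. \<forall>(A::nat set) t::real. card A = n \<longrightarrow> t \<ge> K \<longrightarrow>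
    (\<exists>\<C>. finite \<C> \<and> real (card \<C>) \<le> exp (c * max (?F1 n t) (?F2 n)) \<and>
       (\<forall>C\<in>\<C>. (\<forall>e\<in>C. e \<subseteq> A \<and> card e = 3) \<and> real (card C) \<le> t * real n ^ 2) \<and>
       (\<forall>I. (\<forall>e\<in>I. e \<subseteq> A \<and> card e = 3) \<and> \<not> (\<exists>S\<subseteq>I. linear_cycle_edges (2 * l) S) \<longrightarrow> (\<exists>C\<in>\<C>. I \<subseteq> C)))"
    using container_family[OF assms, where 'a=nat] by (elim exE conjE) (rule that)
  have ev2: "\<forall>\<^sub>F n::nat in sequentially. 2 \<le> n" by (rule eventually_ge_at_top)
  show ?thesis
  proof (rule exI[of _ c], intro conjI c, rule exI[of _ K], intro conjI K, rule eventually_mono[OF eventually_conj[OF ev2 ev]], intro allI impI)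
    fix n :: nat and t :: real
    assume h: "2 \<le> n \<and> (\<forall>(A::nat set) t::real. card A = n \<longrightarrow> t \<ge> K \<longrightarrow>
    (\<exists>\<C>. finite \<C> \<and> real (card \<C>) \<le> exp (c * max (?F1 n t) (?F2 n)) \<and>
       (\<forall>C\<in>\<C>. (\<forall>e\<in>C. e \<subseteq> A \<and> card e = 3) \<and> real (card C) \<le> t * real n ^ 2) \<and>
       (\<forall>I. (\<forall>e\<in>I. e \<subseteq> A \<and> card e = 3) \<and> \<not> (\<exists>S\<subseteq>I. linear_cycle_edges (2 * l) S) \<longrightarrow> (\<exists>C\<in>\<C>. I \<subseteq> C))))"
      and t: "K \<le> t"
    have cn: "card {1..n} = n" by simp
    obtain \<C> where C: "finite \<C>" "real (card \<C>) \<le> exp (c * max (?F1 n t) (?F2 n))"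
       "\<forall>C\<in>\<C>. (\<forall>e\<in>C. e \<subseteq> {1..n} \<and> card e = 3) \<and> real (card C) \<le> t * real n ^ 2"
       "\<forall>I. (\<forall>e\<in>I. e \<subseteq> {1..n} \<and> card e = 3) \<and> \<not> (\<exists>S\<subseteq>I. linear_cycle_edges (2 * l) S) \<longrightarrow> (\<exists>C\<in>\<C>. I \<subseteq> C)"
      using h[THEN conjunct2, rule_format, OF cn t] by (elim exE conjE) (rule that)
    define \<G> where "\<G> = (\<lambda>C. ({1..n}, C)) ` \<C>"
    have "card \<G> \<le> card \<C>" unfolding \<G>_def using C(1) by (rule card_image_le)
    then have cG: "real (card \<G>) \<le> exp (c * max (?F1 n t) (?F2 n))" using C(2) by linarith
    show "\<exists>C \<subseteq> three_graphs_on {1..n}. real (card C) \<le> exp (c * max (?F1 n t) (?F2 n)) \<and>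
       (\<forall>G\<in>C. real (card (edges G)) \<le> t * real n ^ 2) \<and>
       (\<forall>H\<in>three_graphs_on {1..n}. free_of (linear_cycle (2 * l)) H \<longrightarrow> (\<exists>G\<in>C. subgraph H G)) \<and>
       (t \<le> real n powr (1 / (4 * real l - 2))
              * ln (real n) powr (- ((4 * real l ^ 2 - 7 * real l + 4) / (2 * real l - 2))) \<longrightarrow>
        real (card C) \<le> exp (c * ?F1 n t))"
    proof (intro exI[of _ \<G>] conjI cG ballI impI)
      have "({1..n}, D) \<in> three_graphs_on {1..n}" if "D \<in> \<C>" for D
        using C(3) that unfolding three_graphs_on_def three_graph_def by simp
      then show "\<G> \<subseteq> three_graphs_on {1..n}" unfolding \<G>_def by blast
      show "real (card (edges G)) \<le> t * real n ^ 2" if "G \<in> \<G>" for G using that C(3) unfolding \<G>_def by auto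
      show "\<exists>G\<in>\<G>. subgraph H G" if H: "H \<in> three_graphs_on {1..n}" "free_of (linear_cycle (2 * l)) H" for H
      proof -
        have H3: "three_graph H" "verts H = {1..n}" using H(1) unfolding three_graphs_on_def by auto
        have "\<not> (\<exists>S\<subseteq>edges H. linear_cycle_edges (2 * l) S)"
          using linear_cycle_edges_not_free[OF _ H3(1), of "2 * l"] H(2) assms by auto
        moreover have "\<forall>e\<in>edges H. e \<subseteq> {1..n} \<and> card e = 3" using H3 unfolding three_graph_def by auto
        ultimately obtain C where "C \<in> \<C>" "edges H \<subseteq> C" using C(4)[rule_format, of "edges H"] by auto
        then show ?thesis unfolding \<G>_def subgraph_def using H3(2) by auto
      qed
      show "real (card \<G>) \<le> exp (c * ?F1 n t)"
        if small: "t \<le> real n powr (1 / (4 * real l - 2))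
              * ln (real n) powr (- ((4 * real l ^ 2 - 7 * real l + 4) / (2 * real l - 2)))"
      proof -
        have "?F2 n \<le> ?F1 n t"
          using assms h t K by (intro second_term_le_first small) auto
        then show ?thesis using cG by (simp add: max_absorb1)
      qed
    qed
  qed
qed

end
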